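(* Let $\mathbb{B}$ be a homogeneous, linear differential operator of order $n$ on $\mathbb{R}^n$ from $V$ to $W$ with constant coefficients that is elliptic and weakly canceling. Suppose that the inclusion $\mathrm{BV}^{\mathbb{B}}_{\mathrm{loc}}(\mathbb{R}^n)\subset \mathrm{L}^\infty_{\mathrm{loc}}(\mathbb{R}^n,V)$ is $\mathbb{B}$-strictly continuous, i.e. whenever $u_j\to u$ locally $\mathbb{B}$-strictly in $\mathrm{BV}^{\mathbb{B}}_{\mathrm{loc}}(\mathbb{R}^n)$, one has $u_j\to u$ in $\mathrm{L}^\infty(K,V)$ for every compact $K\subset\mathbb{R}^n$. Then $\mathbb{B}$ is canceling.
   Context: $V,W$ are finite-dimensional real inner product spaces. A homogeneous constant-coefficient linear operator of order $n$ on $\mathbb{R}^n$ from $V$ to $W$ is $\mathbb{B}u=\sum_{|\beta|=n}B_\beta\,\partial^\beta u$ with $B_\beta\in\mathrm{Lin}(V,W)$; its symbol is $\mathbb{B}(\xi)=\sum_{|\beta|=n}\xi^\beta B_\beta$. $\mathbb{B}$ is elliptic if $\ker\mathbb{B}(\xi)=\{0\}$ for all $0\neq\xi\in\mathbb{R}^n$; then $\mathbb{B}^\dagger(\xi)=[\mathbb{B}^*(\xi)\mathbb{B}(\xi)]^{-1}\mathbb{B}^*(\xi)$ is a left inverse of $\mathbb{B}(\xi)$ for $\xi\ne0$. Let $\mathcal{I}=\bigcap_{\xi\in\mathbb{S}^{n-1}}\mathrm{im}\,\mathbb{B}(\xi)\subset W$ and $\mathbf{L}w=\int_{\mathbb{S}^{n-1}}\mathbb{B}^\dagger(\xi)w\,\mathrm{d}\mathscr{H}^{n-1}(\xi)\in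 V$ for $w\in W$. $\mathbb{B}$ is canceling if $\mathcal{I}=\{0\}$, and weakly canceling if $\mathbf{L}(\mathcal{I})=\{0\}$. $\mathrm{BV}^{\mathbb{B}}_{\mathrm{loc}}(\mathbb{R}^n)$ is the space of $u\in \mathrm{W}^{n-1,1}_{\mathrm{loc}}(\mathbb{R}^n,V)$ such that $\mathbb{B}u$ is a $W$-valued Radon measure that is finite on bounded sets. Locally $\mathbb{B}$-strict convergence $u_j\to u$ means: $u_j\to u$ in $\mathrm{W}^{n-1,1}_{\mathrm{loc}}(\mathbb{R}^n,V)$ and $|\mathbb{B}u_j|(\Omega)\to|\mathbb{B}u|(\Omega)$ for every bounded open $\Omega\subset\mathbb{R}^n$ with $|\mathbb{B}u|(\partial\Omega)=0$. *)

theory Defs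
  imports "HOL-Analysis.Analysis" "HOL-Probability.Essential_Supremum"
begin

section \<open>Hausdorff measure\<close>

definition hausdorff_outer :: "nat \<Rightarrow> 'a::metric_space set \<Rightarrow> ennreal" where
  "hausdorff_outer m A =
     (SUP \<delta>\<in>{0<..}. INF C\<in>{C :: nat \<Rightarrow> 'a set.
          (\<forall>i. bounded (C i) \<and> diameter (C i) \<le> \<delta>) \<and> A \<subseteq> (\<Union>i. C i)}.
        \<Sum>i. if C i = {} then 0
            else ennreal (unit_ball_vol (real m) * (diameter (C i) / 2) ^ m))"

text \<open>Nonempty sets contribute \<open>1\<close> when \<open>m = 0\<close>, so the
  \<open>0\<close>-dimensional measure is counting measure.\<close>

definition hausdorff_measure :: "nat \<Rightarrow> 'a::metric_space measure" where
  "hausdorff_measure m = measure_of UNIV (sets borel) (hausdorff_outer m)"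


section \<open>Multi-indices, test functions and weak derivatives\<close>

type_synonym 'n multi_index = "'n \<Rightarrow> nat"

definition mi_order :: "'n::finite multi_index \<Rightarrow> nat" where
  "mi_order \<beta> = (\<Sum>i\<in>UNIV. \<beta> i)"

definition partial :: "'n::finite \<Rightarrow> (real ^ 'n \<Rightarrow> real) \<Rightarrow> real ^ 'n \<Rightarrow> real" where
  "partial i f = (\<lambda>x. frechet_derivative f (at x) (axis i 1))"

fun C_k :: "nat \<Rightarrow> (real ^ 'n::finite \<Rightarrow> real) \<Rightarrow> bool" where
  "C_k 0 f = continuous_on UNIV f"
| "C_k (Suc k) f = (f differentiable_on UNIV \<and> (\<forall>i. C_k k (partial i f)))"

definition test_function :: "(real ^ 'n::finite \<Rightarrow> real) \<Rightarrow> bool" where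
  "test_function \<phi> \<longleftrightarrow> (\<forall>k. C_k k \<phi>) \<and> compact (closure {x. \<phi> x \<noteq> 0})"

text \<open>The derivative \<open>\<partial>\<^sup>\<beta>\<close> of a smooth function: differentiate along any list of
  directions in which \<open>i\<close> occurs \<open>\<beta> i\<close> times; by the symmetry of higher
  derivatives the choice of the list is immaterial.\<close>

definition mi_deriv :: "'n::finite multi_index \<Rightarrow> (real ^ 'n \<Rightarrow> real) \<Rightarrow> real ^ 'n \<Rightarrow> real" where
  "mi_deriv \<beta> \<phi> = foldr partial (SOME is. \<forall>i. count_list is i = \<beta> i) \<phi>"

definition L1_loc :: "('a::euclidean_space \<Rightarrow> 'v::euclidean_space) \<Rightarrow> bool" where
  "L1_loc u \<longleftrightarrow> (\<forall>K. compact K \<longrightarrow> set_integrable lebesgue K u)"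

definition is_weak_deriv ::
  "'n::finite multi_index \<Rightarrow> (real ^ 'n \<Rightarrow> 'v::euclidean_space) \<Rightarrow> (real ^ 'n \<Rightarrow> 'v) \<Rightarrow> bool" where
  "is_weak_deriv \<beta> u g \<longleftrightarrow> L1_loc g \<and>
     (\<forall>\<phi>. test_function \<phi> \<longrightarrow>
        (LINT x|lebesgue. mi_deriv \<beta> \<phi> x *\<^sub>R u x)
          = (-1) ^ mi_order \<beta> *\<^sub>R (LINT x|lebesgue. \<phi> x *\<^sub>R g x))"

text \<open>Weak derivatives are unique up to null sets.\<close>

definition weak_deriv ::
  "'n::finite multi_index \<Rightarrow> (real ^ 'n \<Rightarrow> 'v::euclidean_space) \<Rightarrow> real ^ 'n \<Rightarrow> 'v" where
  "weak_deriv \<beta> u = (SOME g. is_weak_deriv \<beta> u g)"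

definition W1_loc :: "nat \<Rightarrow> (real ^ 'n::finite \<Rightarrow> 'v::euclidean_space) \<Rightarrow> bool" where
  "W1_loc k u \<longleftrightarrow> L1_loc u \<and> (\<forall>\<beta>. mi_order \<beta> \<le> k \<longrightarrow> (\<exists>g. is_weak_deriv \<beta> u g))"

definition conv_W1_loc ::
  "nat \<Rightarrow> (nat \<Rightarrow> real ^ 'n::finite \<Rightarrow> 'v::euclidean_space) \<Rightarrow> (real ^ 'n \<Rightarrow> 'v) \<Rightarrow> bool" where
  "conv_W1_loc k u\<^sub>j u \<longleftrightarrow> (\<forall>j. W1_loc k (u\<^sub>j j)) \<and> W1_loc k u \<and>
     (\<forall>\<beta> K. mi_order \<beta> \<le> k \<longrightarrow> compact K \<longrightarrow>
        (\<lambda>j. LINT x:K|lebesgue. norm (weak_deriv \<beta> (u\<^sub>j j) x - weak_deriv \<beta> u x)) \<longlonglongrightarrow> 0)"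

text \<open>The codomain \<^typ>\<open>ennreal\<close> makes the essential supremum over a null set equal to \<open>0\<close>.\<close>

definition Linf_norm :: "'a::euclidean_space set \<Rightarrow> ('a \<Rightarrow> 'v::euclidean_space) \<Rightarrow> ennreal" where
  "Linf_norm K u = esssup (restrict_space lebesgue K) (\<lambda>x. ennreal (norm (u x)))"

definition Linf_on :: "'a::euclidean_space set \<Rightarrow> ('a \<Rightarrow> 'v::euclidean_space) \<Rightarrow> bool" where
  "Linf_on K u \<longleftrightarrow> u \<in> borel_measurable (restrict_space lebesgue K) \<and> Linf_norm K u < \<infinity>"

definition conv_Linf ::
  "'a::euclidean_space set \<Rightarrow> (nat \<Rightarrow> 'a \<Rightarrow> 'v::euclidean_space) \<Rightarrow> ('a \<Rightarrow> 'v) \<Rightarrow> bool" where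
  "conv_Linf K u\<^sub>j u \<longleftrightarrow> (\<forall>j. Linf_on K (u\<^sub>j j)) \<and> Linf_on K u \<and>
     (\<lambda>j. Linf_norm K (\<lambda>x. u\<^sub>j j x - u x)) \<longlonglongrightarrow> 0"


section \<open>Vector-valued Radon measures\<close>

text \<open>Set functions that are countably additive on the bounded Borel sets; values on
  unbounded sets carry no meaning.\<close>

definition radon_measure :: "('a::euclidean_space set \<Rightarrow> 'w::euclidean_space) \<Rightarrow> bool" where
  "radon_measure \<mu> \<longleftrightarrow>
     (\<forall>A :: nat \<Rightarrow> 'a set. range A \<subseteq> sets borel \<longrightarrow> disjoint_family A \<longrightarrow> bounded (\<Union>i. A i) \<longrightarrow>
        (\<lambda>i. \<mu> (A i)) sums \<mu> (\<Union>i. A i))"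

definition total_variation ::
  "('a::euclidean_space set \<Rightarrow> 'w::euclidean_space) \<Rightarrow> 'a set \<Rightarrow> ennreal" where
  "total_variation \<mu> E =
     (SUP A\<in>{A :: nat \<Rightarrow> 'a set. range A \<subseteq> sets borel \<and> disjoint_family A \<and> (\<Union>i. A i) = E}.
        \<Sum>i. ennreal (norm (\<mu> (A i))))"

text \<open>Positive part in the Jordan decomposition of a scalar Radon measure (\<^const>\<open>ennreal\<close>
  maps negative numbers to \<open>0\<close>).\<close>

definition jordan_pos :: "('a::euclidean_space set \<Rightarrow> real) \<Rightarrow> 'a measure" where
  "jordan_pos \<nu> = measure_of UNIV (sets borel)
     (\<lambda>E. SUP F\<in>{F. F \<in> sets borel \<and> bounded F \<and> F \<subseteq> E}. ennreal (\<nu> F))"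

definition scalar_integral :: "('a::euclidean_space set \<Rightarrow> real) \<Rightarrow> ('a \<Rightarrow> real) \<Rightarrow> real" where
  "scalar_integral \<nu> \<phi> = (LINT x|jordan_pos \<nu>. \<phi> x) - (LINT x|jordan_pos (\<lambda>E. - \<nu> E). \<phi> x)"

definition vector_integral ::
  "('a::euclidean_space set \<Rightarrow> 'w::euclidean_space) \<Rightarrow> ('a \<Rightarrow> real) \<Rightarrow> 'w" where
  "vector_integral \<mu> \<phi> = (\<Sum>b\<in>Basis. scalar_integral (\<lambda>E. \<mu> E \<bullet> b) \<phi> *\<^sub>R b)"


section \<open>Operators of order \<open>n\<close> on \<open>\<real>\<^sup>n\<close>\<close>

text \<open>An operator is given by its coefficients \<open>B\<^sub>\<beta>\<close>. Only those with
  \<open>|\<beta>| = n = CARD('n)\<close> are ever used.\<close>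

type_synonym ('n, 'v, 'w) operator = "'n multi_index \<Rightarrow> 'v \<Rightarrow>\<^sub>L 'w"

definition symbol ::
  "('n::finite, 'v::euclidean_space, 'w::euclidean_space) operator \<Rightarrow> real ^ 'n \<Rightarrow> 'v \<Rightarrow> 'w" where
  "symbol B \<xi> v = (\<Sum>\<beta> | mi_order \<beta> = CARD('n). (\<Prod>i\<in>UNIV. (\<xi> $ i) ^ \<beta> i) *\<^sub>R blinfun_apply (B \<beta>) v)"

definition elliptic ::
  "('n::finite, 'v::euclidean_space, 'w::euclidean_space) operator \<Rightarrow> bool" where
  "elliptic B \<longleftrightarrow> (\<forall>\<xi>. \<xi> \<noteq> 0 \<longrightarrow> {v. symbol B \<xi> v = 0} = {0})"

definition symbol_dagger ::
  "('n::finite, 'v::euclidean_space, 'w::euclidean_space) operator \<Rightarrow> real ^ 'n \<Rightarrow> 'w \<Rightarrow> 'v" where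
  "symbol_dagger B \<xi> = inv (adjoint (symbol B \<xi>) \<circ> symbol B \<xi>) \<circ> adjoint (symbol B \<xi>)"

definition common_image ::
  "('n::finite, 'v::euclidean_space, 'w::euclidean_space) operator \<Rightarrow> 'w set" where
  "common_image B = (\<Inter>\<xi>\<in>sphere 0 1. range (symbol B \<xi>))"

definition L_map ::
  "('n::finite, 'v::euclidean_space, 'w::euclidean_space) operator \<Rightarrow> 'w \<Rightarrow> 'v" where
  "L_map B w = (LINT \<xi>:sphere 0 1|hausdorff_measure (CARD('n) - 1). symbol_dagger B \<xi> w)"

definition canceling ::
  "('n::finite, 'v::euclidean_space, 'w::euclidean_space) operator \<Rightarrow> bool" where
  "canceling B \<longleftrightarrow> common_image B = {0}"

definition weakly_canceling ::
  "('n::finite, 'v::euclidean_space, 'w::euclidean_space) operator \<Rightarrow> bool" where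
  "weakly_canceling B \<longleftrightarrow> L_map B ` common_image B = {0}"

text \<open>The distribution \<open>\<Sum>\<^sub>\<beta> B\<^sub>\<beta> \<partial>\<^sup>\<beta> u\<close> is represented by the Radon measure \<open>\<mu>\<close>.\<close>

definition represents ::
  "('n::finite, 'v::euclidean_space, 'w::euclidean_space) operator
     \<Rightarrow> (real ^ 'n \<Rightarrow> 'v) \<Rightarrow> ((real ^ 'n) set \<Rightarrow> 'w) \<Rightarrow> bool" where
  "represents B u \<mu> \<longleftrightarrow> radon_measure \<mu> \<and>
     (\<forall>\<phi>. test_function \<phi> \<longrightarrow>
        vector_integral \<mu> \<phi> =
          (\<Sum>\<beta> | mi_order \<beta> = CARD('n).
             (-1) ^ mi_order \<beta> *\<^sub>R blinfun_apply (B \<beta>) (LINT x|lebesgue. mi_deriv \<beta> \<phi> x *\<^sub>R u x)))"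

definition BV_loc ::
  "('n::finite, 'v::euclidean_space, 'w::euclidean_space) operator \<Rightarrow> (real ^ 'n \<Rightarrow> 'v) \<Rightarrow> bool" where
  "BV_loc B u \<longleftrightarrow> W1_loc (CARD('n) - 1) u \<and> (\<exists>\<mu>. represents B u \<mu>)"

text \<open>The representing measure is unique on bounded Borel sets, and so is its total variation.\<close>

definition op_variation ::
  "('n::finite, 'v::euclidean_space, 'w::euclidean_space) operator
     \<Rightarrow> (real ^ 'n \<Rightarrow> 'v) \<Rightarrow> (real ^ 'n) set \<Rightarrow> ennreal" where
  "op_variation B u E = total_variation (SOME \<mu>. represents B u \<mu>) E"

definition conv_strict_loc ::
  "('n::finite, 'v::euclidean_space, 'w::euclidean_space) operator
     \<Rightarrow> (nat \<Rightarrow> real ^ 'n \<Rightarrow> 'v) \<Rightarrow> (real ^ 'n \<Rightarrow> 'v) \<Rightarrow> bool" where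
  "conv_strict_loc B u\<^sub>j u \<longleftrightarrow> conv_W1_loc (CARD('n) - 1) u\<^sub>j u \<and>
     (\<forall>\<Omega>. open \<Omega> \<longrightarrow> bounded \<Omega> \<longrightarrow> op_variation B u (frontier \<Omega>) = 0 \<longrightarrow>
        (\<lambda>j. op_variation B (u\<^sub>j j) \<Omega>) \<longlonglongrightarrow> op_variation B u \<Omega>)"

end

theory Submission
  imports Defs "HOL-Probability.Characteristic_Functions" "HOL-Real_Asymp.Real_Asymp"
begin

text \<open>Suppose \<open>w \<noteq> 0\<close> lies in the image of every \<open>B(\<xi>)\<close> and let \<open>B(\<xi>) m(\<xi>) = w\<close> for \<open>\<xi> \<noteq> 0\<close>. The
  Fourier multiplier \<open>i\<^sup>-\<^sup>n m(\<xi>) (exp (-|\<xi>|\<^sup>2/8) - exp (-|\<xi>|\<^sup>2/2))\<close> defines a function \<open>v\<close> such that the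
  sums \<open>u\<^sub>J(x) = \<Sum>j<J. v(2\<^sup>j x)\<close> telescope under \<open>B\<close>: \<open>B u\<^sub>J = (\<theta>\<^sub>J - \<theta>) w\<close>, where \<open>\<theta>\<close> is a Gaussian and
  \<open>\<theta>\<^sub>J(x) = 2\<^sup>J\<^sup>n \<theta>(2\<^sup>J x)\<close>. Integration by parts in \<open>\<xi>\<close> bounds \<open>|\<partial>\<^sup>\<beta> v(x)|\<close> by a multiple of
  \<open>|x| powr (-|\<beta>| - 1/2)\<close>, so \<open>u\<^sub>J\<close> converges locally in \<open>W\<^sup>n\<^sup>-\<^sup>1\<^sup>,\<^sup>1\<close> to some \<open>u\<close> with
  \<open>B u = (c \<delta>\<^sub>0 - \<theta>) w\<close>, and because \<open>\<theta> \<ge> 0\<close> no mass is lost: the convergence is strict. If it were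
  locally uniform, then \<open>v(2\<^sup>J x) = u\<^sub>J\<^sub>+\<^sub>1(x) - u\<^sub>J(x)\<close> would tend to \<open>0\<close> uniformly on the unit ball, which
  forces \<open>v = 0\<close> and contradicts \<open>\<theta>\<^sub>1 \<noteq> \<theta>\<close>.\<close>

section \<open>Jordan decomposition of scalar Radon measures\<close>

text \<open>The function \<open>m\<close> is homogeneous of degree -n, hence not integrable at the
  origin. The Gaussian difference vanishes there to second order, so xi^beta times the multiplier
  has order |beta| + 2 - n, and after |beta| + 1 derivatives still the integrable order 1 - n.
  Integrating by parts that often gives decay |x|^(-|beta|-1); as the kernel is also bounded, every
  exponent -|beta| - s with 0 <= s <= 1 is available. Summation over the scales needs s > 0 (the
  ratio is 2^(-s)), local integrability of the bound for |beta| = n - 1 needs s < 1, and s = 1/2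
  meets both. All spaces are real, so powers of i are carried as phase shifts of a cosine. Weak
  derivatives and variations are evaluated on representatives picked by \<open>SOME\<close>. Both
  therefore need a uniqueness theorem, and both theorems rest on one fact: two positive Radon
  measures that agree on test functions are equal. Signed measures are compared by moving the
  negative parts to the other side.\<close>

lemma radon_measure_add:
  assumes "radon_measure \<nu>" "A \<in> sets borel" "B \<in> sets borel" "A \<inter> B = {}" "bounded A" "bounded B"
  shows "\<nu> (A \<union> B) = \<nu> A + \<nu> B"
proof -
  have z: "\<nu> {} = 0"
  proof -
    have "(\<lambda>i::nat. \<nu> {}) sums \<nu> (\<Union>i::nat. {})"
      using assms(1)[unfolded radon_measure_def, rule_format, of "\<lambda>_. {}"]
      by (simp add: disjoint_family_on_def)
    then have "summable (\<lambda>i::nat. \<nu> {})" by (rule sums_summable)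
    then show ?thesis by (simp add: summable_const_iff)
  qed
  let ?A = "\<lambda>i::nat. if i = 0 then A else if i = 1 then B else {}"
  have u: "(\<Union>i. ?A i) = A \<union> B" by (auto split: if_splits)
  have "(\<lambda>i. \<nu> (?A i)) sums \<nu> (\<Union>i. ?A i)"
    by (rule assms(1)[unfolded radon_measure_def, rule_format])
       (use assms u in \<open>auto simp: disjoint_family_on_def\<close>)
  moreover have "(\<lambda>i. \<nu> (?A i)) sums (\<Sum>i\<in>{0,1}. \<nu> (?A i))"
    by (rule sums_finite) (auto simp: z)
  ultimately show ?thesis unfolding u by (auto dest: sums_unique2)
qed

lemma radon_measure_empty: "radon_measure \<nu> \<Longrightarrow> \<nu> {} = 0"
  using radon_measure_add[of \<nu> "{}" "{}"] by simp

lemma radon_measure_diff: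
  assumes "radon_measure \<nu>" "A \<in> sets borel" "B \<in> sets borel" "A \<subseteq> B" "bounded B"
  shows "\<nu> (B - A) = \<nu> B - \<nu> A"
  using radon_measure_add[OF assms(1,2), of "B - A"] assms
  by (metis (no_types, lifting) Diff_disjoint Un_Diff_cancel add_diff_cancel_left' bounded_subset
      Diff_subset sets.Diff sup.absorb_iff2)

lemma radon_measure_uminus: "radon_measure \<nu> \<Longrightarrow> radon_measure (\<lambda>E. - \<nu> E)"
  unfolding radon_measure_def by (auto intro!: sums_minus)

lemma radon_measure_inner: "radon_measure \<mu> \<Longrightarrow> radon_measure (\<lambda>E. \<mu> E \<bullet> b)"
  unfolding radon_measure_def
  by (auto intro!: bounded_linear.sums[OF bounded_linear_inner_left])

text \<open>The supremum is superadditive on disjoint sets because two bounded competitors can be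
  united, and countably subadditive because a bounded competitor can be sliced along the sets of the
  sequence. Both arguments evaluate \<open>\<nu>\<close> on bounded sets only, where its additivity
  is known.\<close>

lemma jordan_pos_facts:
  fixes \<nu> :: "'a::euclidean_space set \<Rightarrow> real"
  assumes \<nu>: "radon_measure \<nu>"
  shows sets_jordan_pos: "sets (jordan_pos \<nu>) = sets borel"
    and emeasure_jordan_pos: "E \<in> sets borel \<Longrightarrow> emeasure (jordan_pos \<nu>) E =
      (SUP F\<in>{F. F \<in> sets borel \<and> bounded F \<and> F \<subseteq> E}. ennreal (\<nu> F))"
proof -
  let ?F = "\<lambda>E. {F. F \<in> sets borel \<and> bounded F \<and> F \<subseteq> E}"
  let ?S = "\<lambda>E. SUP F\<in>?F E. ennreal (\<nu> F)"
  show "sets (jordan_pos \<nu>) = sets borel"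
    unfolding jordan_pos_def using sets.sigma_sets_eq[of "borel :: 'a measure"] by simp
  have S0: "?S {} = 0" by (simp add: radon_measure_empty[OF \<nu>] cong: conj_cong)
  have add: "?S A + ?S B \<le> ?S (A \<union> B)" if "A \<in> sets borel" "B \<in> sets borel" "A \<inter> B = {}" for A B
  proof -
    have ne: "?F A \<noteq> {}" "?F B \<noteq> {}" by (auto intro!: exI[of _ "{}"])
    have pair: "ennreal (\<nu> F) + ennreal (\<nu> G) \<le> ?S (A \<union> B)" if FG: "F \<in> ?F A" "G \<in> ?F B" for F G
    \<comment> \<open>\<open>ennreal\<close> truncates negative values to 0, so
      \<open>\<nu> (F \<union> G)\<close> gives the sum only if both values are nonnegative.
      Otherwise one term is 0 and the other competitor alone suffices.\<close>
    proof (cases "0 \<le> \<nu> F \<and> 0 \<le> \<nu> G")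
      case True
      have "\<nu> (F \<union> G) = \<nu> F + \<nu> G"
        by (rule radon_measure_add[OF \<nu>]) (use FG that(1) \<open>A \<inter> B = {}\<close> in auto)
      then have "ennreal (\<nu> F) + ennreal (\<nu> G) = ennreal (\<nu> (F \<union> G))" using True by simp
      also have "\<dots> \<le> ?S (A \<union> B)" by (rule SUP_upper) (use FG in auto)
      finally show ?thesis .
    next
      case False
      then consider "\<nu> F < 0" | "\<nu> G < 0" by linarith
      then show ?thesis
      proof cases
        case 1
        have "ennreal (\<nu> G) \<le> ?S (A \<union> B)" by (rule SUP_upper) (use FG in auto)
        with 1 show ?thesis by (simp add: ennreal_neg)
      next
        case 2
        have "ennreal (\<nu> F) \<le> ?S (A \<union> B)" by (rule SUP_upper) (use FG in auto)
        with 2 show ?thesis by (simp add: ennreal_neg)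
      qed
    qed
    have "ennreal (\<nu> F) + ?S B \<le> ?S (A \<union> B)" if "F \<in> ?F A" for F
      unfolding ennreal_SUP_add_right[OF ne(2)] by (rule SUP_least) (rule pair[OF that])
    then show ?thesis
      unfolding ennreal_SUP_add_left[OF ne(1), symmetric] by (rule SUP_least)
  qed
  have ca: "countably_additive (sets borel) ?S"
  proof (rule countably_additiveI)
    fix A :: "nat \<Rightarrow> 'a set" assume A: "range A \<subseteq> sets borel" "disjoint_family A"
    show "(\<Sum>i. ?S (A i)) = ?S (\<Union>i. A i)"
    proof (rule antisym)
      have "(\<Sum>i<n. ?S (A i)) \<le> ?S (\<Union>i<n. A i)" for n
      proof (induction n)
        case (Suc n)
        have dj: "A i \<inter> A n = {}" if "i < n" for i
          using A(2) that unfolding disjoint_family_on_def by (metis UNIV_I less_irrefl)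
        have "(\<Sum>i<Suc n. ?S (A i)) \<le> ?S (\<Union>i<n. A i) + ?S (A n)"
          using Suc by (simp add: add_right_mono)
        also have "\<dots> \<le> ?S ((\<Union>i<n. A i) \<union> A n)"
          by (rule add) (use A(1) dj in auto)
        finally show ?case by (simp add: lessThan_Suc Un_commute)
      qed (simp add: S0)
      also have "?S (\<Union>i<n. A i) \<le> ?S (\<Union>i. A i)" for n
        by (rule SUP_subset_mono) auto
      finally show "(\<Sum>i. ?S (A i)) \<le> ?S (\<Union>i. A i)" by (rule suminf_le_const[OF summableI])
    next
      show "?S (\<Union>i. A i) \<le> (\<Sum>i. ?S (A i))"
      proof (rule SUP_least)
        fix F assume F: "F \<in> ?F (\<Union>i. A i)"
        have FU: "(\<Union>i. F \<inter> A i) = F" using F by auto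
        have "(\<lambda>i. \<nu> (F \<inter> A i)) sums \<nu> (\<Union>i. F \<inter> A i)"
          by (rule \<nu>[unfolded radon_measure_def, rule_format]) (use F A FU in \<open>auto simp: disjoint_family_on_def\<close>)
        then have "(\<lambda>n. ennreal (\<Sum>i<n. \<nu> (F \<inter> A i))) \<longlonglongrightarrow> ennreal (\<nu> F)"
          unfolding FU sums_def by (rule tendsto_ennrealI)
        moreover have "ennreal (\<Sum>i<n. \<nu> (F \<inter> A i)) \<le> (\<Sum>i. ?S (A i))" for n
        proof -
          \<comment> \<open>\<open>ennreal\<close> does not commute with sums that have negative
            terms; truncating each term at 0 first restores additivity.\<close>
          have "ennreal (\<Sum>i<n. \<nu> (F \<inter> A i)) \<le> ennreal (\<Sum>i<n. max 0 (\<nu> (F \<inter> A i)))"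
            by (intro ennreal_leI sum_mono) auto
          also have "\<dots> = (\<Sum>i<n. ennreal (max 0 (\<nu> (F \<inter> A i))))"
            by (rule sum_ennreal[symmetric]) simp
          also have "\<dots> = (\<Sum>i<n. ennreal (\<nu> (F \<inter> A i)))"
            by (intro sum.cong refl) (simp add: max_def ennreal_neg)
          also have "\<dots> \<le> (\<Sum>i<n. ?S (A i))"
            by (intro sum_mono SUP_upper) (use A F in \<open>auto intro: bounded_subset\<close>)
          also have "\<dots> \<le> (\<Sum>i. ?S (A i))" by (rule sum_le_suminf) auto
          finally show ?thesis .
        qed
        ultimately show "ennreal (\<nu> F) \<le> (\<Sum>i. ?S (A i))"
          by (intro LIMSEQ_le_const2) auto
      qed
    qed
  qed
  show "E \<in> sets borel \<Longrightarrow> emeasure (jordan_pos \<nu>) E = ?S E"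
    unfolding jordan_pos_def
    by (rule emeasure_measure_of_sigma)
       (use ca S0 in \<open>auto simp: positive_def sets.sigma_algebra_axioms[of borel, simplified]\<close>)
qed

text \<open>If \<open>\<nu>\<close> were unbounded on the subsets of a bounded set, one could split
  that set again and again, keeping a part on which \<open>\<nu>\<close> is still unbounded and
  discarding a part of measure at least 1 in modulus. The discarded parts are disjoint with bounded
  union, so their measures would have to be summable.\<close>

lemma radon_measure_bdd:
  fixes \<nu> :: "'a::euclidean_space set \<Rightarrow> real"
  assumes \<nu>: "radon_measure \<nu>" and E: "E \<in> sets borel" "bounded E"
  shows "\<exists>C. \<forall>F. F \<in> sets borel \<longrightarrow> F \<subseteq> E \<longrightarrow> \<bar>\<nu> F\<bar> \<le> C"
proof (rule ccontr)
  define bad where "bad E \<longleftrightarrow> E \<in> sets borel \<and> bounded E \<and>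
    (\<forall>C. \<exists>F. F \<in> sets borel \<and> F \<subseteq> E \<and> \<bar>\<nu> F\<bar> > C)" for E
  assume "\<not> ?thesis"
  then have b0: "bad E" using E unfolding bad_def by (auto simp: not_le)
  have step: "\<exists>D. bad D \<and> D \<subseteq> E \<and> \<bar>\<nu> (E - D)\<bar> \<ge> 1" if "bad E" for E
  proof -
    \<comment> \<open>The threshold \<open>1 + \<bar>\<nu> E\<bar>\<close> makes both
      \<open>\<nu> F\<close> and \<open>\<nu> (E - F)\<close> at least 1 in modulus. Hence either
      half may be the one that is discarded.\<close>
    from that obtain F where F: "F \<in> sets borel" "F \<subseteq> E" "\<bar>\<nu> F\<bar> > 1 + \<bar>\<nu> E\<bar>"
      unfolding bad_def by blast
    have E: "E \<in> sets borel" "bounded E" using that by (auto simp: bad_def)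
    have d: "\<nu> (E - F) = \<nu> E - \<nu> F" using radon_measure_diff[OF \<nu>] F E by auto
    have "bad F \<or> bad (E - F)"
    proof (rule ccontr)
      assume "\<not> ?thesis"
      moreover have "F \<in> sets borel \<and> bounded F" "E - F \<in> sets borel \<and> bounded (E - F)"
        using F E by (auto intro: bounded_subset)
      ultimately have "\<exists>C1. \<forall>G. G \<in> sets borel \<longrightarrow> G \<subseteq> F \<longrightarrow> \<bar>\<nu> G\<bar> \<le> C1"
        "\<exists>C2. \<forall>G. G \<in> sets borel \<longrightarrow> G \<subseteq> E - F \<longrightarrow> \<bar>\<nu> G\<bar> \<le> C2"
        unfolding bad_def by (meson not_le)+
      then obtain C1 C2 where C: "\<And>G. G \<in> sets borel \<Longrightarrow> G \<subseteq> F \<Longrightarrow> \<bar>\<nu> G\<bar> \<le> C1"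
        "\<And>G. G \<in> sets borel \<Longrightarrow> G \<subseteq> E - F \<Longrightarrow> \<bar>\<nu> G\<bar> \<le> C2"
        by blast
      have "\<bar>\<nu> G\<bar> \<le> C1 + C2" if G: "G \<in> sets borel" "G \<subseteq> E" for G
      proof -
        have "bounded G" using G E bounded_subset by blast
        then have "\<nu> ((G \<inter> F) \<union> (G - F)) = \<nu> (G \<inter> F) + \<nu> (G - F)"
          by (intro radon_measure_add[OF \<nu>]) (use G F in \<open>auto intro: bounded_subset\<close>)
        moreover have "(G \<inter> F) \<union> (G - F) = G" by auto
        ultimately have "\<nu> G = \<nu> (G \<inter> F) + \<nu> (G - F)" by simp
        moreover have "\<bar>\<nu> (G \<inter> F)\<bar> \<le> C1" "\<bar>\<nu> (G - F)\<bar> \<le> C2"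
          using C(1)[of "G \<inter> F"] C(2)[of "G - F"] G F by auto
        ultimately show ?thesis by linarith
      qed
      with \<open>bad E\<close> show False unfolding bad_def by (metis not_le)
    qed
    then show ?thesis
    proof
      assume "bad F" then show ?thesis using F d by (intro exI[of _ F]) auto
    next
      assume "bad (E - F)"
      moreover have "E - (E - F) = F" using F by auto
      ultimately show ?thesis using F by (intro exI[of _ "E - F"]) auto
    qed
  qed
  obtain D where D: "\<And>n. bad (D n)" "\<And>n. D (Suc n) \<subseteq> D n \<and> \<bar>\<nu> (D n - D (Suc n))\<bar> \<ge> 1"
    using dependent_nat_choice[of "\<lambda>_. bad" "\<lambda>_ A B. B \<subseteq> A \<and> \<bar>\<nu> (A - B)\<bar> \<ge> 1"] b0 step
    by (metis (no_types, lifting))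
  define A where "A n = D n - D (Suc n)" for n
  have anti: "D n \<subseteq> D m" if "m \<le> n" for m n
    using that by (induction rule: dec_induct) (use D(2) in auto)
  have dis: "disjoint_family A"
    unfolding disjoint_family_on_def
  proof (intro ballI impI)
    fix m n :: nat assume "m \<noteq> n"
    then consider "Suc m \<le> n" | "Suc n \<le> m" by linarith
    then show "A m \<inter> A n = {}" by cases (use anti in \<open>force simp: A_def\<close>)+
  qed
  have bU: "bounded (\<Union>i. A i)"
    by (rule bounded_subset[of "D 0"]) (use D(1)[of 0] anti in \<open>auto simp: A_def bad_def\<close>)
  have "(\<lambda>i. \<nu> (A i)) sums \<nu> (\<Union>i. A i)"
    by (rule \<nu>[unfolded radon_measure_def, rule_format])
       (use dis[unfolded A_def] bU[unfolded A_def] D(1) in \<open>auto simp: A_def bad_def\<close>)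
  then have "(\<lambda>i. \<nu> (A i)) \<longlonglongrightarrow> 0" by (intro summable_LIMSEQ_zero sums_summable)
  then have "\<forall>\<^sub>F i in sequentially. \<bar>\<nu> (A i)\<bar> < 1"
    by (auto dest: tendstoD[where e=1])
  then obtain i where "\<bar>\<nu> (A i)\<bar> < 1" by (auto simp: eventually_sequentially)
  with D(2)[of i] show False by (simp add: A_def)
qed

text \<open>Positive Radon measures. The Jordan parts, Lebesgue measure, the Gaussian densities and
  the point mass at the origin are all of this kind, and signed measures are handled as differences
  of two of them.\<close>

definition finite_on_bounded :: "'a::euclidean_space measure \<Rightarrow> bool" where
  "finite_on_bounded M \<longleftrightarrow>
     sets M = sets borel \<and> (\<forall>E\<in>sets borel. bounded E \<longrightarrow> emeasure M E < \<infinity>)"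

lemma finite_on_boundedD:
  assumes "finite_on_bounded M"
  shows "sets M = sets borel" "space M = UNIV" "E \<in> sets borel \<Longrightarrow> bounded E \<Longrightarrow> emeasure M E < \<infinity>"
  using assms sets_eq_imp_space_eq[of M borel] by (auto simp: finite_on_bounded_def)

lemma finite_on_bounded_jordan_pos:
  assumes \<nu>: "radon_measure \<nu>"
  shows "finite_on_bounded (jordan_pos \<nu>)"
  unfolding finite_on_bounded_def
proof (intro conjI ballI impI)
  fix E :: "'a set" assume E: "E \<in> sets borel" "bounded E"
  obtain C where C: "\<And>F. F \<in> sets borel \<Longrightarrow> F \<subseteq> E \<Longrightarrow> \<bar>\<nu> F\<bar> \<le> C"
    using radon_measure_bdd[OF \<nu> E] by blast
  have "emeasure (jordan_pos \<nu>) E \<le> ennreal C"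
    unfolding emeasure_jordan_pos[OF \<nu> E(1)]
    by (rule SUP_least) (use C in \<open>force intro!: ennreal_leI\<close>)
  then show "emeasure (jordan_pos \<nu>) E < \<infinity>" by (simp add: le_less_trans)
qed (rule sets_jordan_pos[OF \<nu>])

text \<open>Passing from a competitor \<open>F \<subseteq> E\<close> to \<open>E - F\<close> turns
  \<open>\<nu> F\<close> into \<open>\<nu> E - \<nu> F\<close>. This exchanges the suprema for
  \<open>\<nu>\<close> and \<open>- \<nu>\<close> up to the constant \<open>\<nu> E\<close>, and
  finiteness allows the subtraction.\<close>

lemma jordan_decomposition:
  assumes \<nu>: "radon_measure \<nu>" and E: "E \<in> sets borel" "bounded E"
  shows "\<nu> E = measure (jordan_pos \<nu>) E - measure (jordan_pos (\<lambda>E. - \<nu> E)) E"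
proof -
  let ?P = "measure (jordan_pos \<nu>) E" and ?N = "measure (jordan_pos (\<lambda>E. - \<nu> E)) E"
  have "\<nu> F \<le> measure (jordan_pos \<nu>) E" if "F \<in> sets borel" "F \<subseteq> E" and \<nu>: "radon_measure \<nu>" for F \<nu>
  proof -
    have "ennreal (\<nu> F) \<le> emeasure (jordan_pos \<nu>) E"
      unfolding emeasure_jordan_pos[OF \<nu> E(1)]
      by (rule SUP_upper) (use that E bounded_subset in auto)
    then show ?thesis
      using finite_on_boundedD(3)[OF finite_on_bounded_jordan_pos[OF \<nu>] E]
      by (metis ennreal_le_iff emeasure_eq_ennreal_measure infinity_ennreal_def measure_nonneg
          top.not_eq_extremum)
  qed note ub = this
  have lub: "measure (jordan_pos \<nu>) E \<le> c"
    if c: "\<And>F. F \<in> sets borel \<Longrightarrow> F \<subseteq> E \<Longrightarrow> \<nu> F \<le> c" and \<nu>: "radon_measure \<nu>" for c \<nu>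
  proof -
    have "0 \<le> c" using c[of "{}"] radon_measure_empty[OF \<nu>] by simp
    have "emeasure (jordan_pos \<nu>) E \<le> ennreal c"
      unfolding emeasure_jordan_pos[OF \<nu> E(1)]
      by (rule SUP_least) (use c in \<open>auto intro!: ennreal_leI\<close>)
    then show ?thesis using \<open>0 \<le> c\<close> by (metis enn2real_leI measure_def)
  qed
  have n: "radon_measure (\<lambda>E. - \<nu> E)" by (rule radon_measure_uminus[OF \<nu>])
  have d: "\<nu> (E - F) = \<nu> E - \<nu> F" if "F \<in> sets borel" "F \<subseteq> E" for F
    using radon_measure_diff[OF \<nu> that(1) E(1) that(2) E(2)] .
  have "?P \<le> \<nu> E + ?N"
  proof (rule lub[OF _ \<nu>])
    fix F assume F: "F \<in> sets borel" "F \<subseteq> E"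
    show "\<nu> F \<le> \<nu> E + ?N" using ub[of "E - F", OF _ _ n] d[OF F] F E by auto
  qed
  moreover have "?N \<le> ?P - \<nu> E"
  proof (rule lub[OF _ n])
    fix F assume F: "F \<in> sets borel" "F \<subseteq> E"
    show "- \<nu> F \<le> ?P - \<nu> E" using ub[of "E - F", OF _ _ \<nu>] d[OF F] F E by auto
  qed
  ultimately show ?thesis by linarith
qed

section \<open>Smooth bumps\<close>

lemma partial_eq: "(f has_derivative f') (at x) \<Longrightarrow> partial i f x = f' (axis i 1)"
  unfolding partial_def using frechet_derivative_at by metis

lemma C_k_Suc_differentiable: "C_k (Suc k) f \<Longrightarrow> f differentiable at x"
  by (auto simp: differentiable_on_def)

lemma C_k_SucD: "C_k (Suc k) f \<Longrightarrow> C_k k f"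
  by (induction k arbitrary: f) (auto intro: differentiable_imp_continuous_on)

lemma C_k_const: "C_k k (\<lambda>x :: real ^ 'n::finite. c)"
proof (induction k arbitrary: c)
  case (Suc k)
  have "partial i (\<lambda>x::real^'n. c) = (\<lambda>x. 0)" for i
    by (rule ext, subst partial_eq) (rule has_derivative_const refl)+
  then show ?case using Suc by simp
qed simp

lemma C_k_add: "C_k k f \<Longrightarrow> C_k k g \<Longrightarrow> C_k k (\<lambda>x. f x + g x)"
proof (induction k arbitrary: f g)
  case (Suc k)
  have "partial i (\<lambda>x. f x + g x) = (\<lambda>x. partial i f x + partial i g x)" for i
  proof
    fix x
    have "f differentiable at x" "g differentiable at x"
      using Suc.prems C_k_Suc_differentiable by blast+
    then show "partial i (\<lambda>x. f x + g x) x = partial i f x + partial i g x"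
      unfolding differentiable_def by (auto simp: partial_eq partial_eq[OF has_derivative_add])
  qed
  then show ?case using Suc by auto
qed (auto intro: continuous_on_add)

lemma C_k_mult: "C_k k f \<Longrightarrow> C_k k g \<Longrightarrow> C_k k (\<lambda>x. f x * g x)"
proof (induction k arbitrary: f g)
  case (Suc k)
  have p: "partial i (\<lambda>x. f x * g x) = (\<lambda>x. f x * partial i g x + partial i f x * g x)" for i
  proof
    fix x
    have "f differentiable at x" "g differentiable at x"
      using Suc.prems C_k_Suc_differentiable by blast+
    then show "partial i (\<lambda>x. f x * g x) x = f x * partial i g x + partial i f x * g x"
      unfolding differentiable_def by (auto simp: partial_eq partial_eq[OF has_derivative_mult])
  qed
  have "C_k k f" "C_k k g" using Suc.prems C_k_SucD by blast+
  then show ?case using Suc unfolding C_k.simps p by (auto intro!: C_k_add)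
qed (auto intro: continuous_on_mult)

lemma C_k_prod: "(\<And>i. i \<in> I \<Longrightarrow> C_k k (f i)) \<Longrightarrow> C_k k (\<lambda>x. \<Prod>i\<in>I. f i x)"
  by (induction I rule: infinite_finite_induct) (auto intro: C_k_const C_k_mult)

text \<open>The whole sequence of successive derivatives is part of the statement because each
  induction step on \<open>k\<close> replaces \<open>D j\<close> by
  \<open>D (Suc j)\<close>.\<close>

lemma C_k_affine_coordinate:
  assumes D: "\<And>k t. (D k has_real_derivative D (Suc k) t) (at t)"
  shows "C_k k (\<lambda>x :: real ^ 'n::finite. D j (c * (x $ i) + d))"
proof (induction k arbitrary: j)
  case 0
  have "isCont (D j) t" for t using D DERIV_isCont by blast
  then have "continuous_on UNIV (D j)" by (simp add: continuous_at_imp_continuous_on)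
  then show ?case unfolding C_k.simps
    by (rule continuous_on_compose2) (intro continuous_intros, simp)
next
  case (Suc k)
  have d: "((\<lambda>x. D j (c * (x $ i) + d)) has_derivative
      (\<lambda>h. (c * (h $ i)) * D (Suc j) (c * (x $ i) + d))) (at x)" for x :: "real^'n"
    by (rule derivative_eq_intros DERIV_compose_FDERIV[OF D] refl)+
       (auto intro!: bounded_linear_imp_has_derivative bounded_linear_vec_nth)
  have p: "partial l (\<lambda>x. D j (c * (x $ i) + d)) =
      (\<lambda>x. (c * (axis l 1 $ i)) * D (Suc j) (c * (x $ i) + d))" for l
    by (rule ext) (rule partial_eq[OF d])
  show ?case unfolding C_k.simps p
    using d by (auto simp: differentiable_on_def differentiable_def intro!: C_k_mult C_k_const Suc)
qed

section \<open>The flat function exp(-1/t) and smooth bumps supported on boxes\<close>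

definition flat_exp :: "real \<Rightarrow> real" where
  "flat_exp t = (if t > 0 then exp (- 1 / t) else 0)"

lemma flat_exp_bounds: "0 \<le> flat_exp t" "flat_exp t \<le> 1"
  by (auto simp: flat_exp_def)

lemma poly_times_exp_minus_tendsto_0: "((\<lambda>s::real. poly p s * exp (- s)) \<longlongrightarrow> 0) at_top"
proof -
  have "((\<lambda>s::real. \<Sum>i\<le>degree p. coeff p i * (s ^ i / exp s)) \<longlongrightarrow> (\<Sum>i\<le>degree p. coeff p i * 0)) at_top"
    by (intro tendsto_sum tendsto_mult tendsto_const tendsto_power_div_exp_0)
  then show ?thesis
    by (simp add: poly_altdef sum_distrib_right sum_divide_distrib exp_minus field_simps)
qed

text \<open>With s = 1/t, every derivative has the form p(s) exp(-s) for t > 0 and 0 otherwise.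
  Differentiation in t sends the polynomial p to s^2 (p - p'), which is the recursion that defines
  the sequence \<open>p\<close>.\<close>

lemma flat_exp_smooth:
  obtains D where "D 0 = flat_exp" "\<And>k t. (D k has_real_derivative D (Suc k) t) (at t)"
proof -
  define F where "F p t = (if t > 0 then poly p (1 / t) * exp (- 1 / t) else 0)" for p and t :: real
  define p where "p = rec_nat 1 (\<lambda>_ q. [:0, 0, 1::real:] * (q - pderiv q))"
  have tz: "((\<lambda>h. poly q (1 / h) * exp (- 1 / h)) \<longlongrightarrow> 0) (at_right 0)" for q :: "real poly"
    using filterlim_compose[OF poly_times_exp_minus_tendsto_0[of q] filterlim_inverse_at_top_right]
    by (simp add: field_simps)
  have "(F q has_real_derivative F ([:0, 0, 1:] * (q - pderiv q)) t) (at t)" for q t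
  proof -
    consider "t < 0" | "t > 0" | "t = 0" by linarith
    then show ?thesis
    proof cases
      case 1
      have "((\<lambda>t. 0) has_real_derivative 0) (at t)" by simp
      then have "(F q has_real_derivative 0) (at t)"
        by (rule has_field_derivative_transform_within_open[of _ _ _ "{..<0}"])
           (use 1 in \<open>auto simp: F_def\<close>)
      then show ?thesis using 1 by (simp add: F_def)
    next
      case 2
      have "((\<lambda>t. poly q (1 / t) * exp (- 1 / t)) has_real_derivative
          poly ([:0, 0, 1:] * (q - pderiv q)) (1 / t) * exp (- 1 / t)) (at t)"
        using 2 by (auto intro!: derivative_eq_intros simp: field_simps power2_eq_square)
      then have "(F q has_real_derivative
          poly ([:0, 0, 1:] * (q - pderiv q)) (1 / t) * exp (- 1 / t)) (at t)"
        by (rule has_field_derivative_transform_within_open[of _ _ _ "{0<..}"])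
           (use 2 in \<open>auto simp: F_def\<close>)
      then show ?thesis using 2 by (simp add: F_def)
    next
      case 3
      have "((\<lambda>h. (F q h - F q 0) / (h - 0)) \<longlongrightarrow> 0) (at 0)"
      proof (rule filterlim_split_at)
        show "((\<lambda>h. (F q h - F q 0) / (h - 0)) \<longlongrightarrow> 0) (at_left 0)"
          by (rule tendsto_eventually) (auto simp: F_def eventually_at_filter)
        \<comment> \<open>To the right of 0 the difference quotient is again of the form p(s)
          exp(-s), now with the polynomial s q(s); hence \<open>pCons 0 q\<close>.\<close>
        show "((\<lambda>h. (F q h - F q 0) / (h - 0)) \<longlongrightarrow> 0) (at_right 0)"
          by (rule Lim_transform_eventually[OF tz[of "pCons 0 q"]])
             (auto simp: F_def eventually_at_filter)
      qed
      then show ?thesis using 3 by (simp add: has_field_derivative_iff F_def)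
    qed
  qed
  then have "(F (p k) has_real_derivative F (p (Suc k)) t) (at t)" for k t by (simp add: p_def)
  moreover have "F (p 0) = flat_exp" by (auto simp: F_def p_def flat_exp_def)
  ultimately show ?thesis using that[of "\<lambda>k. F (p k)"] by blast
qed

text \<open>The parameter \<open>k\<close> changes only the steepness, not the set where the bump is
  nonzero: inside the box each factor is exp(-1/(k d)) with d the distance to a face, and it tends
  to 1 as \<open>k\<close> grows. The arguments are expanded to the affine form of
  \<open>C_k_affine_coordinate\<close>.\<close>

definition box_bump :: "real^'n::finite \<Rightarrow> real^'n \<Rightarrow> real \<Rightarrow> real^'n \<Rightarrow> real" where
  "box_bump a b k x =
     (\<Prod>i\<in>UNIV. flat_exp (k * (x $ i) - k * a $ i) * flat_exp (- k * (x $ i) + k * b $ i))"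

lemma box_bump_bounds: "0 \<le> box_bump a b k x" "box_bump a b k x \<le> 1"
  unfolding box_bump_def
  by (auto intro!: prod_nonneg prod_le_1 mult_nonneg_nonneg mult_le_one simp: flat_exp_bounds)

lemma box_bump_nonzero_iff:
  assumes "k > 0"
  shows "box_bump a b k x \<noteq> 0 \<longleftrightarrow> x \<in> box a b"
proof -
  have "k * (x $ i) - k * a $ i > 0 \<longleftrightarrow> a $ i < x $ i" "- k * (x $ i) + k * b $ i > 0 \<longleftrightarrow> x $ i < b $ i" for i
    using assms by auto
  then show ?thesis by (auto simp: box_bump_def mem_box_cart flat_exp_def)
qed

lemma test_function_box_bump:
  assumes "k > 0"
  shows "test_function (box_bump a b k)"
  unfolding test_function_def
proof (intro conjI allI)
  fix m
  obtain D where D: "D 0 = flat_exp" "\<And>k t. (D k has_real_derivative D (Suc k) t) (at t)"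
    using flat_exp_smooth by metis
  have "C_k m (\<lambda>x. flat_exp (c * (x $ i) + d))" for c i d
    using C_k_affine_coordinate[of D m 0, OF D(2)] by (simp add: D(1))
  note this[of k _ "- (k * a $ _)"] this[of "- k" _ "k * b $ _"]
  then show "C_k m (box_bump a b k)"
    unfolding box_bump_def by (intro C_k_prod C_k_mult) auto
next
  have "{x. box_bump a b k x \<noteq> 0} = box a b" using box_bump_nonzero_iff[OF assms] by blast
  then show "compact (closure {x. box_bump a b k x \<noteq> 0})"
    by (simp add: bounded_box)
qed

lemma box_bump_tendsto_indicator:
  "(\<lambda>n. box_bump a b (real (Suc n)) x) \<longlonglongrightarrow> indicator (box a b) x"
proof (cases "x \<in> box a b")
  case True
  have l: "(\<lambda>n. flat_exp (real (Suc n) * c)) \<longlonglongrightarrow> 1" if "c > 0" for c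
  proof -
    have "(\<lambda>n. exp (- 1 / (real (Suc n) * c))) \<longlonglongrightarrow> 1" using that by real_asymp
    then show ?thesis using that by (simp add: flat_exp_def)
  qed
  have "(\<lambda>n. \<Prod>i\<in>UNIV. flat_exp (real (Suc n) * (x $ i - a $ i)) * flat_exp (real (Suc n) * (b $ i - x $ i)))
      \<longlonglongrightarrow> (\<Prod>i\<in>(UNIV::'a set). 1 * 1)"
    using True by (intro tendsto_prod tendsto_mult l) (auto simp: mem_box_cart)
  then show ?thesis using True unfolding box_bump_def by (simp add: algebra_simps)
next
  case False
  then have "box_bump a b (real (Suc n)) x = 0" for n
    using box_bump_nonzero_iff[of "real (Suc n)" a b x] by simp
  then show ?thesis using False by simp
qed

lemma test_function_facts:
  assumes "test_function \<phi>"
  shows test_function_continuous: "continuous_on UNIV \<phi>"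
    and test_function_measurable: "\<phi> \<in> borel_measurable borel"
    and test_function_support: "\<exists>R>0. \<forall>x. norm x \<ge> R \<longrightarrow> \<phi> x = 0"
    and test_function_bounded: "\<exists>C>0. \<forall>x. \<bar>\<phi> x\<bar> \<le> C"
    and test_function_differentiable: "\<phi> differentiable at x"
    and test_function_partial: "test_function (partial i \<phi>)"
proof -
  have C: "C_k k \<phi>" for k using assms by (simp add: test_function_def)
  have S: "compact (closure {x. \<phi> x \<noteq> 0})" using assms by (simp add: test_function_def)
  show c: "continuous_on UNIV \<phi>" using C[of 0] by simp
  then show "\<phi> \<in> borel_measurable borel" by (rule borel_measurable_continuous_onI)
  obtain R where R: "R > 0" "\<And>x. x \<in> closure {x. \<phi> x \<noteq> 0} \<Longrightarrow> norm x < R"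
    using compact_imp_bounded[OF S] by (meson bounded_pos_less)
  then show "\<exists>R>0. \<forall>x. norm x \<ge> R \<longrightarrow> \<phi> x = 0"
    using closure_subset by (metis (mono_tags, lifting) in_mono mem_Collect_eq not_le)
  have "compact (\<phi> ` closure {x. \<phi> x \<noteq> 0})"
    using S c by (intro compact_continuous_image) (auto intro: continuous_on_subset)
  then obtain C where "C > 0" "\<And>y. y \<in> \<phi> ` closure {x. \<phi> x \<noteq> 0} \<Longrightarrow> \<bar>y\<bar> \<le> C"
    using compact_imp_bounded by (metis bounded_pos real_norm_def)
  then show "\<exists>C>0. \<forall>x. \<bar>\<phi> x\<bar> \<le> C"
    using closure_subset[of "{x. \<phi> x \<noteq> 0}"] by (intro exI[of _ C]) (smt (verit) image_eqI in_mono mem_Collect_eq)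
  show "\<phi> differentiable at x" using C[of 1] by (auto simp: differentiable_on_def)
  have "partial i \<phi> x = 0" if "x \<notin> closure {x. \<phi> x \<noteq> 0}" for x
  proof -
    have "((\<lambda>x. 0) has_derivative (\<lambda>h. 0)) (at x)" by simp
    then have "(\<phi> has_derivative (\<lambda>h. 0)) (at x)"
      by (rule has_derivative_transform_within_open[of _ _ _ _ "- closure {x. \<phi> x \<noteq> 0}"])
         (use that closure_subset[of "{x. \<phi> x \<noteq> 0}"] in auto)
    then show ?thesis by (simp add: partial_eq)
  qed
  then have "{x. partial i \<phi> x \<noteq> 0} \<subseteq> closure {x. \<phi> x \<noteq> 0}" by blast
  then have "closure {x. partial i \<phi> x \<noteq> 0} \<subseteq> closure {x. \<phi> x \<noteq> 0}"
    by (simp add: closure_minimal)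
  then have "compact (closure {x. partial i \<phi> x \<noteq> 0})"
    using S compact_closure bounded_subset by (metis closed_closure compact_eq_bounded_closed)
  then show "test_function (partial i \<phi>)" using C[of "Suc _"] by (auto simp: test_function_def)
qed

section \<open>Uniqueness of representing measures\<close>

lemma measure_eq_boxes:
  assumes M: "finite_on_bounded M" and N: "finite_on_bounded N"
    and eq: "\<And>a b. emeasure M (box a b) = emeasure N (box a b)"
  shows "M = N"
proof (rule measure_eqI_generator_eq[where \<Omega>=UNIV and E="range (\<lambda>(a, b). box a b)"
      and A="\<lambda>i. box (- real i *\<^sub>R One) (real i *\<^sub>R One)"])
  show "Int_stable (range (\<lambda>(a, b). box a b :: 'a set))"
    by (auto simp: Int_stable_def box_Int_box)
  have "sets borel = sigma_sets UNIV (range (\<lambda>(a, b). box a b :: 'a set))"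
    by (subst borel_eq_box) simp
  then show "sets M = sigma_sets UNIV (range (\<lambda>(a, b). box a b))"
    "sets N = sigma_sets UNIV (range (\<lambda>(a, b). box a b))"
    using finite_on_boundedD(1)[OF M] finite_on_boundedD(1)[OF N] by simp_all
  show "(\<Union>i. box (- real i *\<^sub>R One) (real i *\<^sub>R One)) = (UNIV :: 'a set)"
    using UN_box_eq_UNIV by simp
  show "emeasure M (box (- real i *\<^sub>R One) (real i *\<^sub>R One)) \<noteq> \<infinity>" for i
    using finite_on_boundedD(3)[OF M, of "box (- real i *\<^sub>R One) (real i *\<^sub>R One)"]
    by (simp add: bounded_box)
qed (use eq in auto)

lemma integrable_bounded_support:
  fixes f :: "'a::euclidean_space \<Rightarrow> 'b::{banach, second_countable_topology}"
  assumes M: "finite_on_bounded M" and f: "f \<in> borel_measurable borel"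
    and C: "\<And>x. norm (f x) \<le> C" and R: "\<And>x. norm x \<ge> R \<Longrightarrow> f x = 0"
  shows "integrable M f"
proof (rule Bochner_Integration.integrable_bound[of _ "\<lambda>x. C * indicator (cball 0 R) x"])
  show "integrable M (\<lambda>x. C * indicator (cball 0 R) x :: real)"
    using finite_on_boundedD[OF M] by (intro integrable_mult_right integrable_real_indicator) auto
  show "f \<in> borel_measurable M" using f finite_on_boundedD(1)[OF M] by (simp cong: measurable_cong_sets)
  show "AE x in M. norm (f x) \<le> norm (C * indicator (cball 0 R) x)"
    using C R by (intro AE_I2) (auto simp: indicator_def intro: order_trans[OF _ abs_ge_self])
qed

text \<open>Box bumps are test functions that stay below the indicator of an open box and converge
  to it. Dominated convergence thus recovers the measures of boxes, which determine the
  measure.\<close>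

lemma measure_eq_test_functions:
  fixes M N :: "(real ^ 'n::finite) measure"
  assumes M: "finite_on_bounded M" and N: "finite_on_bounded N"
    and eq: "\<And>\<phi>. test_function \<phi> \<Longrightarrow> (LINT x|M. \<phi> x) = (LINT x|N. \<phi> x)"
  shows "M = N"
proof (rule measure_eq_boxes[OF M N])
  fix a b :: "real ^ 'n"
  have "(\<lambda>n. LINT x|M. box_bump a b (real (Suc n)) x) \<longlonglongrightarrow> (LINT x|M. indicator (box a b) x)"
    if M: "finite_on_bounded M" for M :: "(real ^ 'n) measure"
  proof (rule integral_dominated_convergence[where w="indicator (box a b)"])
    show "integrable M (indicator (box a b) :: _ \<Rightarrow> real)"
      using finite_on_boundedD[OF M] by (intro integrable_real_indicator) (auto simp: bounded_box)
    show "indicator (box a b) \<in> borel_measurable M"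
      using finite_on_boundedD(1)[OF M] by (simp cong: measurable_cong_sets)
    show "box_bump a b (real (Suc i)) \<in> borel_measurable M" for i
      using test_function_measurable[OF test_function_box_bump, of "real (Suc i)" a b]
        finite_on_boundedD(1)[OF M] by (simp cong: measurable_cong_sets)
    show "AE x in M. norm (box_bump a b (real (Suc i)) x) \<le> indicator (box a b) x" for i
    proof (rule AE_I2)
      fix x show "norm (box_bump a b (real (Suc i)) x) \<le> indicator (box a b) x"
        using box_bump_bounds[of a b "real (Suc i)" x] box_bump_nonzero_iff[of "real (Suc i)" a b x]
        by (cases "x \<in> box a b") auto
    qed
  qed (rule AE_I2[OF box_bump_tendsto_indicator])
  note lim = this
  have "(LINT x|M. box_bump a b (real (Suc n)) x) = (LINT x|N. box_bump a b (real (Suc n)) x)" for n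
    by (intro eq test_function_box_bump) simp
  then have "(LINT x|M. indicator (box a b) x) = (LINT x|N. indicator (box a b) x :: real)"
    using lim[OF M] lim[OF N] LIMSEQ_unique by simp
  then have "measure M (box a b) = measure N (box a b)"
    using finite_on_boundedD(2)[OF M] finite_on_boundedD(2)[OF N] by simp
  then show "emeasure M (box a b) = emeasure N (box a b)"
    using finite_on_boundedD(3)[OF M, of "box a b"] finite_on_boundedD(3)[OF N, of "box a b"]
    by (simp add: emeasure_eq_ennreal_measure bounded_box less_top)
qed

text \<open>Sums turn an identity P - N = P' - N' on bounded sets into P + N' = P' + N between
  positive measures, to which the uniqueness theorems for positive measures apply.\<close>

definition add_measure :: "'a::euclidean_space measure \<Rightarrow> 'a measure \<Rightarrow> 'a measure" where
  "add_measure M N = measure_of UNIV (sets borel) (\<lambda>E. emeasure M E + emeasure N E)"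

context
  fixes M N :: "'a::euclidean_space measure"
  assumes M: "finite_on_bounded M" and N: "finite_on_bounded N"
begin

lemma sets_add_measure: "sets (add_measure M N) = sets borel"
  unfolding add_measure_def using sets.sigma_sets_eq[of "borel :: 'a measure"] by simp

lemma emeasure_add_measure:
  assumes "E \<in> sets borel"
  shows "emeasure (add_measure M N) E = emeasure M E + emeasure N E"
  unfolding add_measure_def
proof (rule emeasure_measure_of_sigma)
  show "sigma_algebra UNIV (sets (borel :: 'a measure))"
    using sets.sigma_algebra_axioms[of borel] by simp
  show "countably_additive (sets borel) (\<lambda>E. emeasure M E + emeasure N E)"
  proof (rule countably_additiveI)
    fix A :: "nat \<Rightarrow> 'a set" assume A: "range A \<subseteq> sets borel" "disjoint_family A"
    then have "(\<Sum>i. emeasure M (A i)) = emeasure M (\<Union>i. A i)" "(\<Sum>i. emeasure N (A i)) = emeasure N (\<Union>i. A i)"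
      using finite_on_boundedD(1)[OF M] finite_on_boundedD(1)[OF N] by (auto intro!: suminf_emeasure)
    then show "(\<Sum>i. emeasure M (A i) + emeasure N (A i)) = emeasure M (\<Union>i. A i) + emeasure N (\<Union>i. A i)"
      by (simp add: suminf_add[symmetric] summableI)
  qed
qed (use assms in \<open>auto simp: positive_def\<close>)

lemma finite_on_bounded_add_measure: "finite_on_bounded (add_measure M N)"
  unfolding finite_on_bounded_def
  using finite_on_boundedD(3)[OF M] finite_on_boundedD(3)[OF N]
  by (auto simp: sets_add_measure emeasure_add_measure)

lemma measure_add_measure:
  "E \<in> sets borel \<Longrightarrow> bounded E \<Longrightarrow> measure (add_measure M N) E = measure M E + measure N E"
  using finite_on_boundedD(3)[OF M, of E] finite_on_boundedD(3)[OF N, of E]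
  by (simp add: measure_def emeasure_add_measure enn2real_plus)

lemma nn_integral_add_measure:
  assumes "f \<in> borel_measurable borel"
  shows "(\<integral>\<^sup>+x. f x \<partial>add_measure M N) = (\<integral>\<^sup>+x. f x \<partial>M) + (\<integral>\<^sup>+x. f x \<partial>N)"
proof -
  have ms: "borel_measurable (add_measure M N) = borel_measurable borel"
    "borel_measurable M = borel_measurable borel" "borel_measurable N = borel_measurable borel"
    using finite_on_boundedD(1)[OF M] finite_on_boundedD(1)[OF N] sets_add_measure
    by (auto intro!: measurable_cong_sets)
  show ?thesis using assms
  proof (induction rule: borel_measurable_induct)
    case (cong f g)
    then show ?case by (metis space_borel ext UNIV_I)
  next
    case (set A)
    then show ?case
      using finite_on_boundedD(1)[OF M] finite_on_boundedD(1)[OF N] sets_add_measure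
      by (simp add: emeasure_add_measure)
  next
    case (mult u c)
    then show ?case by (simp add: nn_integral_cmult ms distrib_left)
  next
    case (add u v)
    then show ?case by (simp add: nn_integral_add ms ac_simps)
  next
    case (seq U)
    have inc: "incseq (\<lambda>i. \<integral>\<^sup>+x. U i x \<partial>K)" for K
      using seq(3) by (auto simp: incseq_def le_fun_def intro!: nn_integral_mono)
    have e: "Sup (range U) = (\<lambda>x. SUP i. U i x)" by (simp add: fun_eq_iff SUP_apply image_comp)
    show ?case using seq unfolding e
      by (simp add: nn_integral_monotone_convergence_SUP ms ennreal_SUP_add[OF inc inc])
  qed
qed

lemma integral_add_measure:
  fixes f :: "'a \<Rightarrow> real"
  assumes f: "f \<in> borel_measurable borel"
    and C: "\<And>x. \<bar>f x\<bar> \<le> C" and R: "\<And>x. norm x \<ge> R \<Longrightarrow> f x = 0"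
  shows "(LINT x|add_measure M N. f x) = (LINT x|M. f x) + (LINT x|N. f x)"
proof -
  have i: "integrable K f" if "finite_on_bounded K" for K
    using integrable_bounded_support[OF that f, of C R] C R by simp
  have fin: "(\<integral>\<^sup>+x. ennreal (f x) \<partial>K) < \<infinity>" "(\<integral>\<^sup>+x. ennreal (- f x) \<partial>K) < \<infinity>" if "finite_on_bounded K" for K
    using i[OF that] unfolding real_integrable_def by (auto simp: top.not_eq_extremum)
  note sums = i[OF finite_on_bounded_add_measure] i[OF M] i[OF N]
  show ?thesis
    using fin[OF M] fin[OF N] f
    by (simp add: real_lebesgue_integral_def sums nn_integral_add_measure enn2real_plus)
qed

end

text \<open>\<open>scalar_integral\<close> is tied to the Jordan parts, which are inconvenient to
  compute. Cross-addition shows that any other pair of positive Radon measures with the same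
  difference yields the same integral.\<close>

lemma scalar_integral_eq:
  fixes \<phi> :: "'a::euclidean_space \<Rightarrow> real"
  assumes \<nu>: "radon_measure \<nu>" and P: "finite_on_bounded P" and N: "finite_on_bounded N"
    and eq: "\<And>E. E \<in> sets borel \<Longrightarrow> bounded E \<Longrightarrow> \<nu> E = measure P E - measure N E"
    and f: "\<phi> \<in> borel_measurable borel"
    and C: "\<And>x. \<bar>\<phi> x\<bar> \<le> C" and R: "\<And>x. norm x \<ge> R \<Longrightarrow> \<phi> x = 0"
  shows "scalar_integral \<nu> \<phi> = (LINT x|P. \<phi> x) - (LINT x|N. \<phi> x)"
proof -
  let ?P = "jordan_pos \<nu>" and ?N = "jordan_pos (\<lambda>E. - \<nu> E)"
  have P': "finite_on_bounded ?P" and N': "finite_on_bounded ?N"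
    using \<nu> by (auto intro: finite_on_bounded_jordan_pos radon_measure_uminus)
  have "add_measure ?P N = add_measure P ?N"
  proof (rule measure_eq_boxes)
    fix a b :: 'a
    have "measure (add_measure ?P N) (box a b) = measure (add_measure P ?N) (box a b)"
      using jordan_decomposition[OF \<nu>, of "box a b"] eq[of "box a b"]
      by (simp add: measure_add_measure P' N P N' bounded_box)
    moreover have "emeasure (add_measure ?P N) (box a b) < \<infinity>" "emeasure (add_measure P ?N) (box a b) < \<infinity>"
      using finite_on_boundedD(3)[OF finite_on_bounded_add_measure[OF P' N], of "box a b"]
        finite_on_boundedD(3)[OF finite_on_bounded_add_measure[OF P N'], of "box a b"]
      by (simp_all add: bounded_box)
    ultimately show "emeasure (add_measure ?P N) (box a b) = emeasure (add_measure P ?N) (box a b)"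
      by (simp add: emeasure_eq_ennreal_measure less_top)
  qed (use P N P' N' in \<open>auto intro: finite_on_bounded_add_measure\<close>)
  then have "(LINT x|?P. \<phi> x) + (LINT x|N. \<phi> x) = (LINT x|P. \<phi> x) + (LINT x|?N. \<phi> x)"
    using integral_add_measure[OF P' N f C R] integral_add_measure[OF P N' f C R] by simp
  then show ?thesis unfolding scalar_integral_def by simp
qed

text \<open>Cross-addition of the four Jordan parts again: the two sums are positive and have equal
  integrals of test functions, so they coincide, and the Jordan decomposition gives back the signed
  values.\<close>

lemma radon_measure_unique:
  fixes \<nu>1 \<nu>2 :: "(real ^ 'n::finite) set \<Rightarrow> real"
  assumes 1: "radon_measure \<nu>1" and 2: "radon_measure \<nu>2"
    and eq: "\<And>\<phi>. test_function \<phi> \<Longrightarrow> scalar_integral \<nu>1 \<phi> = scalar_integral \<nu>2 \<phi>"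
    and E: "E \<in> sets borel" "bounded E"
  shows "\<nu>1 E = \<nu>2 E"
proof -
  let ?P1 = "jordan_pos \<nu>1" and ?N1 = "jordan_pos (\<lambda>E. - \<nu>1 E)"
  let ?P2 = "jordan_pos \<nu>2" and ?N2 = "jordan_pos (\<lambda>E. - \<nu>2 E)"
  have f: "finite_on_bounded ?P1" "finite_on_bounded ?N1" "finite_on_bounded ?P2" "finite_on_bounded ?N2"
    using 1 2 by (auto intro: finite_on_bounded_jordan_pos radon_measure_uminus)
  have "add_measure ?P1 ?N2 = add_measure ?P2 ?N1"
  proof (rule measure_eq_test_functions)
    fix \<phi> :: "real ^ 'n \<Rightarrow> real" assume t: "test_function \<phi>"
    obtain C R where CR: "\<And>x. \<bar>\<phi> x\<bar> \<le> C" "\<And>x. norm x \<ge> R \<Longrightarrow> \<phi> x = 0"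
      using test_function_support[OF t] test_function_bounded[OF t] by metis
    note ia = integral_add_measure[OF _ _ test_function_measurable[OF t] CR]
    show "(LINT x|add_measure ?P1 ?N2. \<phi> x) = (LINT x|add_measure ?P2 ?N1. \<phi> x)"
      using eq[OF t] by (simp add: ia f scalar_integral_def)
  qed (use f in \<open>auto intro: finite_on_bounded_add_measure\<close>)
  then have "measure (add_measure ?P1 ?N2) E = measure (add_measure ?P2 ?N1) E" by simp
  then show ?thesis
    using jordan_decomposition[OF 1 E] jordan_decomposition[OF 2 E]
    by (simp add: measure_add_measure f E)
qed

lemma radon_measure_vector_unique:
  fixes \<mu>1 \<mu>2 :: "(real ^ 'n::finite) set \<Rightarrow> 'w::euclidean_space"
  assumes 1: "radon_measure \<mu>1" and 2: "radon_measure \<mu>2"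
    and eq: "\<And>\<phi>. test_function \<phi> \<Longrightarrow> vector_integral \<mu>1 \<phi> = vector_integral \<mu>2 \<phi>"
    and E: "E \<in> sets borel" "bounded E"
  shows "\<mu>1 E = \<mu>2 E"
proof (rule euclidean_eqI)
  fix b :: 'w assume b: "b \<in> Basis"
  have "scalar_integral (\<lambda>E. \<mu>1 E \<bullet> b) \<phi> = scalar_integral (\<lambda>E. \<mu>2 E \<bullet> b) \<phi>" if "test_function \<phi>" for \<phi>
    using arg_cong[OF eq[OF that], of "\<lambda>v. v \<bullet> b"] b
    by (simp only: vector_integral_def inner_sum_left_Basis)
  then show "\<mu>1 E \<bullet> b = \<mu>2 E \<bullet> b"
    by (rule radon_measure_unique[OF radon_measure_inner[OF 1] radon_measure_inner[OF 2] _ E])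
qed

lemma radon_measure_scaled:
  fixes w :: "'w::euclidean_space" and P N :: "'a::euclidean_space measure"
  assumes P: "finite_on_bounded P" and N: "finite_on_bounded N"
  shows "radon_measure (\<lambda>E. (measure P E - measure N E) *\<^sub>R w)"
  unfolding radon_measure_def
proof (intro allI impI)
  fix A :: "nat \<Rightarrow> 'a set"
  assume A: "range A \<subseteq> sets borel" "disjoint_family A" "bounded (\<Union>i. A i)"
  have "(\<lambda>i. measure M (A i)) sums measure M (\<Union>i. A i)" if M: "finite_on_bounded M" for M
    using finite_on_boundedD[OF M] A
    by (intro measure_UNION) (auto simp: less_top image_subset_iff)
  then show "(\<lambda>i. (measure P (A i) - measure N (A i)) *\<^sub>R w) sums
      ((measure P (\<Union>i. A i) - measure N (\<Union>i. A i)) *\<^sub>R w)"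
    using P N by (intro sums_scaleR_left sums_diff)
qed

text \<open>The component along \<open>b\<close> is the signed measure P - N times
  \<open>w \<bullet> b\<close>. Measures can only be scaled by nonnegative numbers, so P and N
  exchange their roles when \<open>w \<bullet> b\<close> is negative.\<close>

lemma vector_integral_scaled:
  fixes w :: "'w::euclidean_space" and P N :: "(real ^ 'n::finite) measure"
  assumes P: "finite_on_bounded P" and N: "finite_on_bounded N"
    and \<phi>: "test_function \<phi>"
  shows "vector_integral (\<lambda>E. (measure P E - measure N E) *\<^sub>R w) \<phi> =
    ((LINT x|P. \<phi> x) - (LINT x|N. \<phi> x)) *\<^sub>R w"
proof -
  note r = radon_measure_scaled[OF P N, of w]
  obtain C R where CR: "\<And>x. \<bar>\<phi> x\<bar> \<le> C" "\<And>x. norm x \<ge> R \<Longrightarrow> \<phi> x = 0"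
    using test_function_support[OF \<phi>] test_function_bounded[OF \<phi>] by metis
  have fs: "finite_on_bounded (scale_measure (ennreal c) M)" if "finite_on_bounded M" for c and M :: "(real ^ 'n) measure"
    using that by (auto simp: finite_on_bounded_def ennreal_mult_less_top)
  have ms: "measure (scale_measure (ennreal c) M) E = c * measure M E" if "c \<ge> 0" for c E and M :: "(real ^ 'n) measure"
    using that by (simp add: measure_def enn2real_mult)
  have iss: "(LINT x|scale_measure (ennreal c) M. \<phi> x) = c * (LINT x|M. \<phi> x)"
    if c: "c \<ge> 0" and M: "finite_on_bounded M" for c M
  proof -
    have i: "integrable M \<phi>" "integrable (scale_measure (ennreal c) M) \<phi>"
      using integrable_bounded_support[OF _ test_function_measurable[OF \<phi>], of _ C R] CR M fs[OF M] by auto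
    have "\<phi> \<in> borel_measurable M" using i(1) by simp
    then show ?thesis using c
      by (simp add: real_lebesgue_integral_def i nn_integral_scale_measure enn2real_mult right_diff_distrib)
  qed
  have "scalar_integral (\<lambda>E. ((measure P E - measure N E) *\<^sub>R w) \<bullet> b) \<phi> =
      ((LINT x|P. \<phi> x) - (LINT x|N. \<phi> x)) * (w \<bullet> b)" for b
  proof (cases "w \<bullet> b \<ge> 0")
    case True
    have "scalar_integral (\<lambda>E. ((measure P E - measure N E) *\<^sub>R w) \<bullet> b) \<phi> =
      (LINT x|scale_measure (ennreal (w \<bullet> b)) P. \<phi> x) - (LINT x|scale_measure (ennreal (w \<bullet> b)) N. \<phi> x)"
      by (rule scalar_integral_eq[OF radon_measure_inner[OF r] fs[OF P] fs[OF N] _ test_function_measurable[OF \<phi>] CR])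
         (use True in \<open>auto simp: ms algebra_simps\<close>)
    then show ?thesis using True P N by (simp add: iss algebra_simps)
  next
    case False
    have "scalar_integral (\<lambda>E. ((measure P E - measure N E) *\<^sub>R w) \<bullet> b) \<phi> =
      (LINT x|scale_measure (ennreal (- (w \<bullet> b))) N. \<phi> x) - (LINT x|scale_measure (ennreal (- (w \<bullet> b))) P. \<phi> x)"
      by (rule scalar_integral_eq[OF radon_measure_inner[OF r] fs[OF N] fs[OF P] _ test_function_measurable[OF \<phi>] CR])
         (use False in \<open>auto simp: ms algebra_simps\<close>)
    then show ?thesis using False P N by (simp add: iss algebra_simps)
  qed
  then show ?thesis
    by (simp only: vector_integral_def scaleR_scaleR[symmetric] scaleR_sum_right[symmetric] euclidean_representation)
qed

section \<open>Weak derivatives and total variation\<close>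

lemma L1_loc_test_integrable:
  assumes g: "L1_loc g" and \<phi>: "test_function \<phi>"
  shows "integrable lebesgue (\<lambda>x. \<phi> x *\<^sub>R g x)"
proof -
  obtain C R where CR: "\<And>x. \<bar>\<phi> x\<bar> \<le> C" "\<And>x. norm x \<ge> R \<Longrightarrow> \<phi> x = 0"
    using test_function_support[OF \<phi>] test_function_bounded[OF \<phi>] by metis
  have i: "integrable lebesgue (\<lambda>x. indicator (cball 0 R) x *\<^sub>R g x)"
    using g compact_cball[of 0 R] unfolding L1_loc_def set_integrable_def by blast
  have eq: "(\<lambda>x. \<phi> x *\<^sub>R g x) = (\<lambda>x. \<phi> x *\<^sub>R (indicator (cball 0 R) x *\<^sub>R g x))"
  proof
    show "\<phi> x *\<^sub>R g x = \<phi> x *\<^sub>R (indicator (cball 0 R) x *\<^sub>R g x)" for x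
      using CR(2)[of x] by (cases "norm x \<le> R") auto
  qed
  have "integrable lebesgue (\<lambda>x. \<phi> x *\<^sub>R (indicator (cball 0 R) x *\<^sub>R g x))"
  proof (rule Bochner_Integration.integrable_bound)
    show "integrable lebesgue (\<lambda>x. C *\<^sub>R (indicator (cball 0 R) x *\<^sub>R g x))"
      using i by (intro integrable_scaleR_right)
    have "\<phi> \<in> borel_measurable lebesgue"
      using test_function_measurable[OF \<phi>] by (simp add: measurable_completion)
    then show "(\<lambda>x. \<phi> x *\<^sub>R (indicator (cball 0 R) x *\<^sub>R g x)) \<in> borel_measurable lebesgue"
      using borel_measurable_integrable[OF i] by (rule borel_measurable_scaleR)
    show "AE x in lebesgue. norm (\<phi> x *\<^sub>R indicator (cball 0 R) x *\<^sub>R g x)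
        \<le> norm (C *\<^sub>R indicator (cball 0 R) x *\<^sub>R g x)"
    proof (rule AE_I2)
      fix x
      have "\<bar>\<phi> x\<bar> \<le> \<bar>C\<bar>" using CR(1)[of x] by linarith
      then show "norm (\<phi> x *\<^sub>R indicator (cball 0 R) x *\<^sub>R g x)
        \<le> norm (C *\<^sub>R indicator (cball 0 R) x *\<^sub>R g x)"
        unfolding norm_scaleR by (rule mult_right_mono) simp
    qed
  qed
  then show ?thesis by (subst eq)
qed

text \<open>The fundamental lemma of the calculus of variations, proved without mollifiers: the
  positive and the negative part of \<open>h\<close> are densities of two Radon measures with equal
  integrals of test functions. The measures are equal, hence so are the two parts almost everywhere,
  and then both vanish.\<close>

lemma L1_loc_real_eq_0:
  fixes h :: "real ^ 'n::finite \<Rightarrow> real"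
  assumes h: "L1_loc h" and z: "\<And>\<phi>. test_function \<phi> \<Longrightarrow> (LINT x|lebesgue. \<phi> x * h x) = 0"
  shows "AE x in lebesgue. h x = 0"
proof -
  have hb: "set_integrable lebesgue (cball 0 R) h" for R
    using h compact_cball unfolding L1_loc_def by blast
  have "(\<lambda>n. indicator (cball 0 (real n)) x *\<^sub>R h x) \<longlonglongrightarrow> h x" for x
  proof (rule tendsto_eventually)
    obtain N where "norm x \<le> real N" using real_arch_simple by blast
    then show "\<forall>\<^sub>F n in sequentially. indicator (cball 0 (real n)) x *\<^sub>R h x = h x"
      unfolding eventually_sequentially by (intro exI[of _ N]) (auto simp: indicator_def)
  qed
  moreover have "(\<lambda>x. indicator (cball 0 (real n)) x *\<^sub>R h x) \<in> borel_measurable lebesgue" for n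
    using hb unfolding set_integrable_def by (rule borel_measurable_integrable)
  ultimately have "h \<in> borel_measurable lebesgue"
    by (rule borel_measurable_LIMSEQ_real)
  \<comment> \<open>\<open>h\<close> is only Lebesgue measurable, whereas the uniqueness theorem is
    about Borel measures; a Borel representative takes its place.\<close>
  then obtain g where g: "g \<in> borel_measurable lborel" and hg: "AE x in lborel. h x = g x"
    using completion_ex_borel_measurable_real by blast
  have g_meas: "g \<in> borel_measurable borel" using g by simp
  have hg': "AE x in lebesgue. h x = g x" by (rule AE_completion[OF hg])
  have gi: "integrable lborel (\<lambda>x. f x * g x)"
    if f: "f \<in> borel_measurable borel" and i: "integrable lebesgue (\<lambda>x. f x * h x)" for f
  proof -
    have "integrable lebesgue (\<lambda>x. f x * g x)"
      by (rule integrable_cong_AE_imp[OF i]) (use f g_meas hg' in \<open>auto simp: measurable_completion\<close>)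
    then show ?thesis by (subst (asm) integrable_completion) (use f g_meas in auto)
  qed
  have zg: "(LINT x|lborel. \<phi> x * g x) = 0" if \<phi>: "test_function \<phi>" for \<phi>
  proof -
    have m: "(\<lambda>x. \<phi> x * g x) \<in> borel_measurable borel"
      using test_function_measurable[OF \<phi>] g_meas by simp
    have "(LINT x|lborel. \<phi> x * g x) = (LINT x|lebesgue. \<phi> x * g x)"
      by (rule integral_completion[symmetric]) (use m in simp)
    also have "\<dots> = (LINT x|lebesgue. \<phi> x * h x)"
      by (rule integral_cong_AE)
         (use L1_loc_test_integrable[OF h \<phi>] hg' m in \<open>auto simp: measurable_completion\<close>)
    finally show ?thesis using z[OF \<phi>] by simp
  qed
  have fob: "finite_on_bounded (density lborel (\<lambda>x. ennreal (s * g x)))" if s: "\<bar>s\<bar> = 1" for s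
    unfolding finite_on_bounded_def
  proof (intro conjI ballI impI)
    fix E :: "(real ^ 'n) set" assume E: "E \<in> sets borel" "bounded E"
    obtain R where "\<forall>x\<in>E. norm x \<le> R" using E(2) unfolding bounded_iff by blast
    then have "E \<subseteq> cball 0 R" by auto
    have "E \<in> sets lborel" using E(1) by simp
    then have "E \<in> sets lebesgue" by (rule sets_completionI_sets)
    then have "set_integrable lebesgue E h"
      using set_integrable_subset[OF hb[of R]] \<open>E \<subseteq> cball 0 R\<close> by metis
    then have "integrable lborel (\<lambda>x. indicator E x * g x)"
      using E unfolding set_integrable_def by (intro gi) auto
    then have fin: "(\<integral>\<^sup>+x. ennreal (norm (indicator E x * g x)) \<partial>lborel) < \<infinity>"
      by (simp add: integrable_iff_bounded)
    have "emeasure (density lborel (\<lambda>x. ennreal (s * g x))) E =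
        (\<integral>\<^sup>+x. ennreal (s * g x) * indicator E x \<partial>lborel)"
      using E g_meas by (intro emeasure_density) auto
    also have "\<dots> \<le> (\<integral>\<^sup>+x. ennreal (norm (indicator E x * g x)) \<partial>lborel)"
    proof (rule nn_integral_mono)
      fix x
      have "s * g x \<le> \<bar>g x\<bar>" using s abs_ge_self[of "s * g x"] by (simp add: abs_mult)
      then show "ennreal (s * g x) * indicator E x \<le> ennreal (norm (indicator E x * g x))"
        by (cases "x \<in> E") (auto intro: ennreal_leI)
    qed
    finally show "emeasure (density lborel (\<lambda>x. ennreal (s * g x))) E < \<infinity>"
      using fin by (simp add: le_less_trans)
  qed simp
  \<comment> \<open>By truncation in \<open>ennreal\<close>, the signs 1 and -1 select the positive
    and the negative part of \<open>g\<close>.\<close>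
  have "density lborel (\<lambda>x. ennreal (1 * g x)) = density lborel (\<lambda>x. ennreal (-1 * g x))"
  proof (rule measure_eq_test_functions[OF fob fob])
    fix \<phi> :: "real ^ 'n \<Rightarrow> real" assume \<phi>: "test_function \<phi>"
    have e: "(LINT x|density lborel (\<lambda>x. ennreal (s * g x)). \<phi> x) = (LINT x|lborel. max 0 (s * g x) * \<phi> x)" for s
    proof -
      have "density lborel (\<lambda>x. ennreal (s * g x)) = density lborel (\<lambda>x. ennreal (max 0 (s * g x)))"
        by (intro arg_cong2[where f=density] refl ext) (simp add: max_def ennreal_neg)
      then show ?thesis
        using test_function_measurable[OF \<phi>] g_meas by (simp add: integral_density)
    qed
    have i: "integrable lborel (\<lambda>x. \<phi> x * g x)"
      using L1_loc_test_integrable[OF h \<phi>] by (intro gi test_function_measurable[OF \<phi>]) simp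
    have i': "integrable lborel (\<lambda>x. max 0 (s * g x) * \<phi> x)" if "\<bar>s\<bar> = 1" for s
    proof (rule Bochner_Integration.integrable_bound[OF i])
      show "AE x in lborel. norm (max 0 (s * g x) * \<phi> x) \<le> norm (\<phi> x * g x)"
      proof (rule AE_I2)
        fix x
        have "\<bar>max 0 (s * g x)\<bar> \<le> \<bar>g x\<bar>"
          using that abs_ge_self[of "s * g x"] by (simp add: abs_mult)
        then show "norm (max 0 (s * g x) * \<phi> x) \<le> norm (\<phi> x * g x)"
          by (simp add: abs_mult mult.commute mult_left_mono)
      qed
    qed (use g_meas test_function_measurable[OF \<phi>] in measurable)
    have "(LINT x|lborel. max 0 (1 * g x) * \<phi> x) - (LINT x|lborel. max 0 (-1 * g x) * \<phi> x) =
        (LINT x|lborel. max 0 (1 * g x) * \<phi> x - max 0 (-1 * g x) * \<phi> x)"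
      by (intro Bochner_Integration.integral_diff[symmetric] i') auto
    also have "\<dots> = (LINT x|lborel. \<phi> x * g x)"
      by (intro Bochner_Integration.integral_cong) (auto simp: max_def)
    finally show "(LINT x|density lborel (\<lambda>x. ennreal (1 * g x)). \<phi> x) =
        (LINT x|density lborel (\<lambda>x. ennreal (-1 * g x)). \<phi> x)"
      unfolding e zg[OF \<phi>] by simp
  qed auto
  then have "AE x in lborel. ennreal (1 * g x) = ennreal (-1 * g x)"
    using g_meas by (intro sigma_finite_measure.density_unique[OF sigma_finite_lborel]) auto
  then have "AE x in lborel. h x = 0"
    using hg
  proof eventually_elim
    case (elim x)
    then show ?case by (cases "g x \<ge> 0") (auto simp: ennreal_neg ennreal_eq_0_iff not_le)
  qed
  then show ?thesis by (rule AE_completion)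
qed

lemma weak_deriv_unique:
  fixes u :: "real ^ 'n::finite \<Rightarrow> 'v::euclidean_space"
  assumes 1: "is_weak_deriv \<beta> u g1" and 2: "is_weak_deriv \<beta> u g2"
  shows "AE x in lebesgue. g1 x = g2 x"
proof -
  have L: "L1_loc g1" "L1_loc g2" using 1 2 by (auto simp: is_weak_deriv_def)
  have "AE x in lebesgue. (g1 x - g2 x) \<bullet> b = 0" for b
  proof (rule L1_loc_real_eq_0)
    have s: "set_integrable lebesgue K (\<lambda>x. (g1 x - g2 x) \<bullet> b)" if "compact K" for K
    proof -
      have "integrable lebesgue (\<lambda>x. (indicator K x *\<^sub>R g1 x - indicator K x *\<^sub>R g2 x) \<bullet> b)"
        using L that unfolding L1_loc_def set_integrable_def
        by (intro integrable_inner_left Bochner_Integration.integrable_diff) auto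
      then show ?thesis by (simp add: set_integrable_def inner_diff_left right_diff_distrib)
    qed
    then show "L1_loc (\<lambda>x. (g1 x - g2 x) \<bullet> b)" by (simp add: L1_loc_def)
    fix \<phi> :: "real ^ 'n \<Rightarrow> real" assume \<phi>: "test_function \<phi>"
    note i = L1_loc_test_integrable[OF L(1) \<phi>] L1_loc_test_integrable[OF L(2) \<phi>]
    have "(-1) ^ mi_order \<beta> *\<^sub>R (LINT x|lebesgue. \<phi> x *\<^sub>R g1 x) = (-1) ^ mi_order \<beta> *\<^sub>R (LINT x|lebesgue. \<phi> x *\<^sub>R g2 x)"
      using 1[unfolded is_weak_deriv_def, THEN conjunct2, rule_format, OF \<phi>]
        2[unfolded is_weak_deriv_def, THEN conjunct2, rule_format, OF \<phi>] by (rule trans[OF sym])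
    then have e: "(LINT x|lebesgue. \<phi> x *\<^sub>R g1 x) = (LINT x|lebesgue. \<phi> x *\<^sub>R g2 x)"
      by (simp only: scaleR_cancel_left) simp
    have "(LINT x|lebesgue. \<phi> x * ((g1 x - g2 x) \<bullet> b)) =
        (LINT x|lebesgue. (\<phi> x *\<^sub>R g1 x - \<phi> x *\<^sub>R g2 x) \<bullet> b)"
      by (simp add: scaleR_diff_right[symmetric])
    also have "\<dots> = (LINT x|lebesgue. \<phi> x *\<^sub>R g1 x - \<phi> x *\<^sub>R g2 x) \<bullet> b"
      using i by (intro integral_inner_left) auto
    also have "\<dots> = 0" using i e by simp
    finally show "(LINT x|lebesgue. \<phi> x * ((g1 x - g2 x) \<bullet> b)) = 0" .
  qed
  then have "AE x in lebesgue. \<forall>b\<in>Basis. (g1 x - g2 x) \<bullet> b = 0"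
    by (intro AE_finite_allI) auto
  then show ?thesis
  proof eventually_elim
    case (elim x)
    then show ?case by (auto intro: euclidean_eqI[of "g1 x"] simp: inner_diff_left)
  qed
qed

lemma weak_deriv_AE:
  assumes "is_weak_deriv \<beta> u g"
  shows "AE x in lebesgue. weak_deriv \<beta> u x = g x"
  unfolding weak_deriv_def using weak_deriv_unique[OF someI[of "is_weak_deriv \<beta> u", OF assms] assms] .

text \<open>Here \<open>\<sigma>\<close> is the candidate for the variation of \<open>\<nu>\<close>
  and \<open>P\<close> is the positive set of a Hahn decomposition. Domination bounds every
  partition from above, and the partition of \<open>E\<close> into its parts inside and outside
  \<open>P\<close> attains the bound.\<close>

lemma total_variation_scaled:
  fixes w :: "'w::euclidean_space" and \<nu> :: "'a::euclidean_space set \<Rightarrow> real"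
  assumes \<sigma>: "sets \<sigma> = sets borel" and E: "E \<in> sets borel" and P: "P \<in> sets borel"
    and le: "\<And>A. A \<in> sets borel \<Longrightarrow> A \<subseteq> E \<Longrightarrow> ennreal \<bar>\<nu> A\<bar> \<le> emeasure \<sigma> A"
    and eq: "ennreal \<bar>\<nu> (E \<inter> P)\<bar> = emeasure \<sigma> (E \<inter> P)" "ennreal \<bar>\<nu> (E - P)\<bar> = emeasure \<sigma> (E - P)"
  shows "total_variation (\<lambda>A. \<nu> A *\<^sub>R w) E = ennreal (norm w) * emeasure \<sigma> E"
proof (rule antisym)
  show "total_variation (\<lambda>A. \<nu> A *\<^sub>R w) E \<le> ennreal (norm w) * emeasure \<sigma> E"
    unfolding total_variation_def
  proof (rule SUP_least, clarify)
    fix A :: "nat \<Rightarrow> 'a set" assume A: "range A \<subseteq> sets borel" "disjoint_family A" "E = (\<Union>i. A i)"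
    have "(\<Sum>i. ennreal (norm (\<nu> (A i) *\<^sub>R w))) = (\<Sum>i. ennreal (norm w) * ennreal \<bar>\<nu> (A i)\<bar>)"
      by (simp add: ennreal_mult' mult.commute)
    also have "\<dots> \<le> (\<Sum>i. ennreal (norm w) * emeasure \<sigma> (A i))"
      using A by (intro suminf_le summableI mult_left_mono le) auto
    also have "\<dots> = ennreal (norm w) * (\<Sum>i. emeasure \<sigma> (A i))" by simp
    also have "(\<Sum>i. emeasure \<sigma> (A i)) = emeasure \<sigma> (\<Union>i. A i)"
      using A \<sigma> by (intro suminf_emeasure) auto
    finally show "(\<Sum>i. ennreal (norm (\<nu> (A i) *\<^sub>R w))) \<le> ennreal (norm w) * emeasure \<sigma> (\<Union>i. A i)" .
  qed
  let ?A = "\<lambda>i::nat. if i = 0 then E \<inter> P else if i = 1 then E - P else {}"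
  have "ennreal (norm w) * emeasure \<sigma> E = ennreal (norm w) * emeasure \<sigma> (E \<inter> P) + ennreal (norm w) * emeasure \<sigma> (E - P)"
    using E P \<sigma> by (subst distrib_left[symmetric], subst plus_emeasure)
      (auto intro!: arg_cong2[where f="(*)"] arg_cong2[where f=emeasure])
  also have "\<dots> = ennreal (norm (\<nu> (E \<inter> P) *\<^sub>R w)) + ennreal (norm (\<nu> (E - P) *\<^sub>R w))"
    by (simp add: eq[symmetric] ennreal_mult' mult.commute)
  also have "\<dots> = (\<Sum>i<2. ennreal (norm (\<nu> (?A i) *\<^sub>R w)))" by (simp add: numeral_2_eq_2)
  also have "\<dots> \<le> (\<Sum>i. ennreal (norm (\<nu> (?A i) *\<^sub>R w)))" by (rule sum_le_suminf) auto
  also have "\<dots> \<le> total_variation (\<lambda>A. \<nu> A *\<^sub>R w) E"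
    unfolding total_variation_def
    by (rule SUP_upper) (use E P in \<open>auto simp: disjoint_family_on_def split: if_splits\<close>)
  finally show "ennreal (norm w) * emeasure \<sigma> E \<le> total_variation (\<lambda>A. \<nu> A *\<^sub>R w) E" .
qed

text \<open>The measure chosen by \<open>SOME\<close> agrees with \<open>\<mu>\<close> on bounded
  Borel sets, and every partition of a bounded set consists of such sets.\<close>

lemma op_variation_eq:
  assumes \<mu>: "represents B u \<mu>" and E: "bounded E"
  shows "op_variation B u E = total_variation \<mu> E"
proof -
  let ?\<mu> = "SOME \<mu>. represents B u \<mu>"
  have s: "represents B u ?\<mu>" by (rule someI[of "represents B u", OF \<mu>])
  have eq: "?\<mu> A = \<mu> A" if "A \<in> sets borel" "bounded A" for A
    by (rule radon_measure_vector_unique[OF _ _ _ that]) (use \<mu> s in \<open>auto simp: represents_def\<close>)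
  show ?thesis
    unfolding op_variation_def total_variation_def
  proof (intro SUP_cong refl)
    fix A :: "nat \<Rightarrow> _ set"
    assume "A \<in> {A. range A \<subseteq> sets borel \<and> disjoint_family A \<and> (\<Union>i. A i) = E}"
    then have A: "range A \<subseteq> sets borel" "(\<Union>i. A i) = E" by auto
    then have "A i \<in> sets borel" "bounded (A i)" for i using E by (auto intro: bounded_subset)
    then show "(\<Sum>i. ennreal (norm (?\<mu> (A i)))) = (\<Sum>i. ennreal (norm (\<mu> (A i))))"
      by (simp add: eq)
  qed
qed

section \<open>Integration by parts\<close>

text \<open>Translation invariance gives 0 as the integral of F(x + e) - F(x). By the fundamental
  theorem of calculus on the segment from x to x + e, Fubini, and translation invariance again, the
  same quantity is the integral of \<open>G\<close>. No decay of \<open>F\<close> enters beyond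
  integrability.\<close>

lemma integral_directional_derivative_eq_0:
  fixes F G :: "'a::euclidean_space \<Rightarrow> 'b::euclidean_space"
  assumes F: "integrable lborel F" and G: "integrable lborel G" and c: "continuous_on UNIV G"
    and d: "\<And>x. ((\<lambda>t. F (x + t *\<^sub>R e)) has_vector_derivative G x) (at 0)"
  shows "(LINT x|lborel. G x) = 0"
proof -
  have d': "((\<lambda>t. F (x + t *\<^sub>R e)) has_vector_derivative G (x + t *\<^sub>R e)) (at t within S)" for x t S
  proof -
    have "((\<lambda>s. F ((x + t *\<^sub>R e) + s *\<^sub>R e)) \<circ> (\<lambda>s. s - t) has_vector_derivative 1 *\<^sub>R G (x + t *\<^sub>R e)) (at t)"
      by (rule vector_diff_chain_at) (use d in \<open>auto intro!: derivative_eq_intros\<close>)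
    moreover have "(\<lambda>s. F ((x + t *\<^sub>R e) + s *\<^sub>R e)) \<circ> (\<lambda>s. s - t) = (\<lambda>t. F (x + t *\<^sub>R e))"
      by (auto simp: scaleR_diff_left)
    ultimately show ?thesis by (auto intro: has_vector_derivative_at_within)
  qed
  have ftc: "(LINT t|lborel. indicator {0..1} t *\<^sub>R G (x + t *\<^sub>R e)) = F (x + e) - F x" for x
  proof -
    have "continuous_on {0..1} (\<lambda>t. G (x + t *\<^sub>R e))"
      by (rule continuous_on_compose2[OF c]) (auto intro!: continuous_intros)
    then show ?thesis
      using integral_FTC_Icc[of 0 1 "\<lambda>t. F (x + t *\<^sub>R e)" "\<lambda>t. G (x + t *\<^sub>R e)"] d' by simp
  qed
  have trans: "integrable lborel (\<lambda>x. f (x + v)) \<and> (LINT x|lborel. f (x + v)) = (LINT x|lborel. f x)"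
    if f: "integrable lborel f" for v and f :: "'a \<Rightarrow> 'c::euclidean_space"
  proof -
    have "f \<in> borel_measurable borel" using f by auto
    then show ?thesis
      using f integrable_distr_eq[of "(+) v" lborel borel f] integral_distr[of "(+) v" lborel borel f]
      by (simp add: lborel_distr_plus add.commute)
  qed
  have Gm: "G \<in> borel_measurable borel" using G by auto
  let ?f = "\<lambda>t x. indicator {0..1::real} t *\<^sub>R G (x + t *\<^sub>R e)"
  have int: "integrable (lborel \<Otimes>\<^sub>M lborel) (case_prod ?f)"
  proof (rule lborel_pair.Fubini_integrable)
    have "(\<lambda>p::real \<times> 'a. snd p + fst p *\<^sub>R e) \<in> borel_measurable (lborel \<Otimes>\<^sub>M lborel)" by measurable
    from measurable_compose[OF this Gm]
    show "case_prod ?f \<in> borel_measurable (lborel \<Otimes>\<^sub>M lborel)"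
      unfolding split_beta by measurable
    have "(\<lambda>t. LINT x|lborel. norm (case (t, x) of (t, x) \<Rightarrow> ?f t x)) =
        (\<lambda>t. indicator {0..1} t * (LINT x|lborel. norm (G x)))"
      using trans[OF integrable_norm[OF G]] by (simp add: fun_eq_iff)
    then show "integrable lborel (\<lambda>t. LINT x|lborel. norm (case (t, x) of (t, x) \<Rightarrow> ?f t x))"
      by simp
    show "AE t in lborel. integrable lborel (\<lambda>x. case (t, x) of (t, x) \<Rightarrow> ?f t x)"
      using trans[OF G] by simp
  qed
  have "0 = (LINT x|lborel. F (x + e) - F x)"
    using F trans[OF F, of e] by simp
  also have "\<dots> = (LINT x|lborel. LINT t|lborel. ?f t x)" by (simp add: ftc)
  also have "\<dots> = (LINT t|lborel. LINT x|lborel. ?f t x)" by (rule lborel_pair.Fubini_integral[OF int])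
  also have "\<dots> = (LINT t|lborel. indicator {0..1::real} t *\<^sub>R (LINT x|lborel. G x))"
    using trans[OF G] by simp
  also have "\<dots> = (LINT x|lborel. G x)" by simp
  finally show ?thesis by simp
qed

lemma has_vector_derivative_partial:
  assumes "f differentiable at (x :: real ^ 'n::finite)"
  shows "((\<lambda>t. f (x + t *\<^sub>R axis i 1)) has_vector_derivative partial i f x) (at 0)"
proof -
  obtain f' where f': "(f has_derivative f') (at x)" using assms by (auto simp: differentiable_def)
  have "((\<lambda>t. x + t *\<^sub>R axis i 1) has_derivative (\<lambda>t. t *\<^sub>R axis i 1)) (at (0::real))"
    by (auto intro!: derivative_eq_intros)
  from has_derivative_compose[OF this, of f f'] f'
  have "((\<lambda>t. f (x + t *\<^sub>R axis i 1)) has_derivative (\<lambda>t. f' (t *\<^sub>R axis i 1))) (at 0)" by simp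
  then show ?thesis
    using linear_cmul[OF has_derivative_linear[OF f']]
    by (simp add: has_vector_derivative_def partial_eq[OF f'])
qed

text \<open>The real part of i^l exp(i t): multiplication by i becomes a step in \<open>l\<close>,
  and so does differentiation. The index is real so that it can also be lowered below 0.\<close>

definition cosine_shift :: "real \<Rightarrow> real \<Rightarrow> real" where
  "cosine_shift l t = cos (t + l * pi / 2)"

lemma cosine_shift_derivative:
  "(cosine_shift l has_real_derivative cosine_shift (l + 1) t) (at t)"
proof -
  have "cos (t + (l + 1) * pi / 2) = - sin (t + l * pi / 2)"
    by (simp add: distrib_right add_divide_distrib cos_add sin_add algebra_simps)
  then show ?thesis
    unfolding cosine_shift_def by (auto intro!: derivative_eq_intros)
qed

lemma cosine_shift_bound: "\<bar>cosine_shift l t\<bar> \<le> 1"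
  by (simp add: cosine_shift_def)

lemma cosine_shift_continuous [continuous_intros]:
  fixes f :: "'a::t2_space \<Rightarrow> real"
  shows "continuous_on S f \<Longrightarrow> continuous_on S (\<lambda>x. cosine_shift l (f x))"
  unfolding cosine_shift_def by (auto intro!: continuous_intros)

lemma cosine_shift_measurable [measurable]: "cosine_shift l \<in> borel_measurable borel"
  by (intro borel_measurable_continuous_onI continuous_intros)

lemma plane_wave_derivative:
  "((\<lambda>t. cosine_shift l (a * ((\<xi> + t *\<^sub>R e) \<bullet> x))) has_vector_derivative
      (a * (e \<bullet> x)) * cosine_shift (l + 1) (a * (\<xi> \<bullet> x))) (at 0)"
proof -
  have "((\<lambda>t. a * ((\<xi> + t *\<^sub>R e) \<bullet> x)) has_real_derivative a * (e \<bullet> x)) (at 0)"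
    by (auto intro!: derivative_eq_intros simp: inner_add_left)
  from DERIV_chain2[OF cosine_shift_derivative this]
  show ?thesis by (simp add: has_real_derivative_iff_has_vector_derivative mult.commute)
qed

lemma finite_on_bounded_lborel: "finite_on_bounded lborel"
  unfolding finite_on_bounded_def using emeasure_bounded_finite by (auto simp: less_top)

lemma test_function_integral_by_parts:
  fixes \<phi> :: "real ^ 'n::finite \<Rightarrow> real"
  assumes \<phi>: "test_function \<phi>"
  shows "(LINT x|lborel. partial i \<phi> x * cosine_shift l (a * (x \<bullet> \<xi>))) =
    - (a * \<xi> $ i) * (LINT x|lborel. \<phi> x * cosine_shift (l + 1) (a * (x \<bullet> \<xi>)))"
proof -
  have int: "integrable lborel (\<lambda>x. \<psi> x * cosine_shift k (a * (x \<bullet> \<xi>)))"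
    if \<psi>: "test_function \<psi>" for \<psi> and k :: real
  proof -
    obtain C R where CR: "\<And>x. \<bar>\<psi> x\<bar> \<le> C" "\<And>x. norm x \<ge> R \<Longrightarrow> \<psi> x = 0"
      using test_function_support[OF \<psi>] test_function_bounded[OF \<psi>] by metis
    show ?thesis
    proof (rule integrable_bounded_support[OF finite_on_bounded_lborel, of _ C R])
      show "norm (\<psi> x * cosine_shift k (a * (x \<bullet> \<xi>))) \<le> C" for x
        using mult_mono[OF CR(1)[of x] cosine_shift_bound[of k "a * (x \<bullet> \<xi>)"]] CR(1)[of x]
        by (simp add: abs_mult)
    qed (use CR(2) test_function_measurable[OF \<psi>] in auto)
  qed
  let ?F = "\<lambda>x. \<phi> x * cosine_shift l (a * (x \<bullet> \<xi>))"
  let ?G = "\<lambda>x. \<phi> x * ((a * \<xi> $ i) * cosine_shift (l + 1) (a * (x \<bullet> \<xi>))) + partial i \<phi> x * cosine_shift l (a * (x \<bullet> \<xi>))"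
  note p = test_function_partial[OF \<phi>, of i]
  have i2: "integrable lborel (\<lambda>x. \<phi> x * ((a * \<xi> $ i) * cosine_shift (l + 1) (a * (x \<bullet> \<xi>))))"
    using integrable_mult_right[OF int[OF \<phi>], of "a * \<xi> $ i" "l + 1"] by (simp add: ac_simps)
  have "(LINT x|lborel. ?G x) = 0"
  proof (rule integral_directional_derivative_eq_0[of ?F])
    show "integrable lborel ?F" by (rule int[OF \<phi>])
    show "integrable lborel ?G" using i2 int[OF p] by (rule Bochner_Integration.integrable_add)
    show "continuous_on UNIV ?G"
      using test_function_continuous[OF \<phi>] test_function_continuous[OF p] by (intro continuous_intros)
    show "((\<lambda>t. ?F (x + t *\<^sub>R axis i 1)) has_vector_derivative ?G x) (at 0)" for x
      using has_vector_derivative_mult[OF has_vector_derivative_partial[OF test_function_differentiable[OF \<phi>]]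
          plane_wave_derivative[of l a x "axis i 1" \<xi>]]
      by (simp add: inner_axis' mult.commute)
  qed
  moreover have "(LINT x|lborel. ?G x) = (a * \<xi> $ i) * (LINT x|lborel. \<phi> x * cosine_shift (l + 1) (a * (x \<bullet> \<xi>))) +
      (LINT x|lborel. partial i \<phi> x * cosine_shift l (a * (x \<bullet> \<xi>)))"
    using i2 int[OF p] by (simp add: mult.left_commute[of "\<phi> _"])
  ultimately show ?thesis by simp
qed

text \<open>\<open>mi_deriv\<close> differentiates along a list picked by \<open>SOME\<close>, so
  such a list has to exist. It enumerates the multiset with multiplicities \<open>\<beta>\<close>,
  which is finite because the index type is.\<close>

lemma ex_list_with_counts:
  fixes \<beta> :: "'n::finite multi_index"
  shows "\<exists>is. \<forall>i. count_list is i = \<beta> i"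
proof -
  have c: "count (Abs_multiset \<beta>) = \<beta>" by (rule count_Abs_multiset) simp
  obtain xs where "mset xs = Abs_multiset \<beta>" using ex_mset by blast
  then show ?thesis using c by (intro exI[of _ xs]) (metis count_mset)
qed

definition monomial :: "'n::finite multi_index \<Rightarrow> real ^ 'n \<Rightarrow> real" where
  "monomial \<beta> \<xi> = (\<Prod>i\<in>UNIV. (\<xi> $ i) ^ \<beta> i)"

text \<open>The formula is first proved for an arbitrary list of directions. Against a plane wave
  only the length of the list and the multiplicities survive, so the particular list behind
  \<open>mi_deriv\<close> does not matter and no symmetry of higher derivatives is invoked.\<close>

lemma mi_deriv_integral_by_parts:
  assumes \<phi>: "test_function \<phi>"
  shows "(LINT x|lborel. mi_deriv \<beta> \<phi> x * cosine_shift l (a * (x \<bullet> \<xi>))) =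
    (-1) ^ mi_order \<beta> * a ^ mi_order \<beta> * monomial \<beta> \<xi> *
      (LINT x|lborel. \<phi> x * cosine_shift (l + real (mi_order \<beta>)) (a * (x \<bullet> \<xi>)))"
    and test_function_mi_deriv: "test_function (mi_deriv \<beta> \<phi>)"
proof -
  define js where "js = (SOME is. \<forall>i. count_list is i = \<beta> i)"
  have c: "count_list js i = \<beta> i" for i
    using someI_ex[OF ex_list_with_counts[of \<beta>]] unfolding js_def by blast
  have t: "test_function (foldr partial xs \<phi>)" for xs
    by (induction xs) (auto simp: \<phi> intro: test_function_partial)
  show "test_function (mi_deriv \<beta> \<phi>)" unfolding mi_deriv_def using t .
  have ibp: "(LINT x|lborel. foldr partial xs \<phi> x * cosine_shift l (a * (x \<bullet> \<xi>))) =
    (-1) ^ length xs * a ^ length xs * (\<Prod>i\<leftarrow>xs. \<xi> $ i) *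
      (LINT x|lborel. \<phi> x * cosine_shift (l + real (length xs)) (a * (x \<bullet> \<xi>)))" for xs l
    by (induction xs arbitrary: l) (auto simp: test_function_integral_by_parts[OF t] ac_simps)
  have len: "length js = mi_order \<beta>"
    unfolding mi_order_def c[symmetric] using sum_count_set[of js UNIV] by simp
  have pl: "(\<Prod>i\<leftarrow>xs. \<xi> $ i) = (\<Prod>i\<in>UNIV. (\<xi> $ i) ^ count_list xs i)" for xs
  proof (induction xs)
    case (Cons y xs)
    have "(\<Prod>i\<in>UNIV. (\<xi> $ i) ^ count_list (y # xs) i) =
        (\<Prod>i\<in>UNIV. (if i = y then \<xi> $ i else 1) * (\<xi> $ i) ^ count_list xs i)"
      by (intro prod.cong) auto
    also have "\<dots> = \<xi> $ y * (\<Prod>i\<in>UNIV. (\<xi> $ i) ^ count_list xs i)"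
      by (simp add: prod.distrib)
    finally show ?case using Cons by simp
  qed simp
  show "(LINT x|lborel. mi_deriv \<beta> \<phi> x * cosine_shift l (a * (x \<bullet> \<xi>))) =
    (-1) ^ mi_order \<beta> * a ^ mi_order \<beta> * monomial \<beta> \<xi> *
      (LINT x|lborel. \<phi> x * cosine_shift (l + real (mi_order \<beta>)) (a * (x \<bullet> \<xi>)))"
    unfolding mi_deriv_def js_def[symmetric] ibp monomial_def len pl c ..
qed

section \<open>Integrability and Gaussian integrals\<close>

lemma continuous_except_0_measurable:
  fixes f :: "'a::euclidean_space \<Rightarrow> 'b::euclidean_space"
  assumes "continuous_on (- {0}) f"
  shows "f \<in> borel_measurable borel"
proof -
  have "(\<lambda>x. indicator (- {0}) x *\<^sub>R f x) \<in> borel_measurable borel"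
    using assms by (intro borel_measurable_continuous_on_indicator) auto
  then have "(\<lambda>x. indicator (- {0}) x *\<^sub>R f x + indicator {0} x *\<^sub>R f 0) \<in> borel_measurable borel"
    by measurable
  moreover have "(\<lambda>x. indicator (- {0}) x *\<^sub>R f x + indicator {0} x *\<^sub>R f 0) = f"
    by (auto simp: fun_eq_iff indicator_def)
  ultimately show ?thesis by simp
qed

lemma lborel_prod_Basis:
  fixes f :: "'a::euclidean_space \<Rightarrow> real \<Rightarrow> 'c::{real_normed_field, banach, second_countable_topology}"
  assumes f: "\<And>b. b \<in> Basis \<Longrightarrow> integrable lborel (f b)"
  shows integrable_lborel_prod_Basis: "integrable lborel (\<lambda>x::'a. \<Prod>b\<in>Basis. f b (x \<bullet> b))"
    and integral_lborel_prod_Basis: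
      "(LINT x|lborel. (\<Prod>b\<in>Basis. f b ((x::'a) \<bullet> b))) = (\<Prod>b\<in>Basis. (LINT t|lborel. f b t))"
proof -
  interpret product_sigma_finite "\<lambda>_::'a. lborel :: real measure" ..
  have m: "(\<lambda>x::'a. \<Prod>b\<in>Basis. f b (x \<bullet> b)) \<in> borel_measurable borel"
  proof (rule borel_measurable_prod)
    fix b :: 'a assume "b \<in> Basis"
    then have "f b \<in> borel_measurable borel" using f by auto
    then show "(\<lambda>x. f b (x \<bullet> b)) \<in> borel_measurable borel"
      by (rule measurable_compose[rotated]) simp
  qed
  have T: "(\<lambda>g. \<Sum>b\<in>Basis. g b *\<^sub>R b) \<in> measurable (\<Pi>\<^sub>M b\<in>Basis. lborel) (borel :: 'a measure)"
    by measurable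
  have e: "(\<Prod>b\<in>Basis. f b ((\<Sum>c\<in>Basis. g c *\<^sub>R c) \<bullet> b)) = (\<Prod>b\<in>Basis. f b (g b))" for g
    by (intro prod.cong refl) simp
  show "integrable lborel (\<lambda>x::'a. \<Prod>b\<in>Basis. f b (x \<bullet> b))"
    unfolding lborel_eq[where 'a='a] integrable_distr_eq[OF T m] e
    by (rule product_integrable_prod[OF finite_Basis f])
  show "(LINT x|lborel. (\<Prod>b\<in>Basis. f b ((x::'a) \<bullet> b))) = (\<Prod>b\<in>Basis. (LINT t|lborel. f b t))"
    unfolding lborel_eq[where 'a='a] integral_distr[OF T m] e
    by (rule product_integral_prod[OF finite_Basis f])
qed

lemma lborel_scale:
  fixes f :: "'a::euclidean_space \<Rightarrow> 'b::euclidean_space"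
  assumes f: "integrable lborel f" and c: "c \<noteq> 0"
  shows integrable_lborel_scale: "integrable lborel (\<lambda>x. f (c *\<^sub>R x))"
    and integral_lborel_scale: "\<bar>c\<bar> ^ DIM('a) *\<^sub>R (LINT x|lborel. f (c *\<^sub>R x)) = (LINT x|lborel. f x)"
proof -
  have m: "f \<in> borel_measurable borel" using f by auto
  have T: "(\<lambda>x. 0 + c *\<^sub>R x) \<in> measurable lborel (borel :: 'a measure)" by simp
  let ?D = "density (distr lborel (borel :: 'a measure) (\<lambda>x. 0 + c *\<^sub>R x)) (\<lambda>_. ennreal (\<bar>c\<bar> ^ DIM('a)))"
  have D: "lborel = ?D" by (rule lborel_affine[OF c])
  have "integrable ?D f" by (subst D[symmetric]) (rule f)
  then have "integrable lborel (\<lambda>x. \<bar>c\<bar> ^ DIM('a) *\<^sub>R f (0 + c *\<^sub>R x))"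
    by (subst (asm) integrable_density; (subst (asm) integrable_distr_eq[OF T])?) (use m in auto)
  then have "integrable lborel (\<lambda>x. inverse (\<bar>c\<bar> ^ DIM('a)) *\<^sub>R (\<bar>c\<bar> ^ DIM('a) *\<^sub>R f (0 + c *\<^sub>R x)))"
    by (rule integrable_scaleR_right)
  then show "integrable lborel (\<lambda>x. f (c *\<^sub>R x))" using c by simp
  have "(LINT x|lborel. f x) = (LINT x|?D. f x)" by (subst D[symmetric]) (rule refl)
  also have "\<dots> = (LINT x|distr lborel borel (\<lambda>x. 0 + c *\<^sub>R x). \<bar>c\<bar> ^ DIM('a) *\<^sub>R f x)"
    by (rule integral_density) (use m in auto)
  also have "\<dots> = (LINT x|lborel. \<bar>c\<bar> ^ DIM('a) *\<^sub>R f (0 + c *\<^sub>R x))"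
    by (rule integral_distr[OF T]) (use m in auto)
  finally show "\<bar>c\<bar> ^ DIM('a) *\<^sub>R (LINT x|lborel. f (c *\<^sub>R x)) = (LINT x|lborel. f x)" by simp
qed

lemma integrable_powr_min:
  assumes a: "0 \<le> a" "a < 1"
  shows "integrable lborel (\<lambda>t::real. min (\<bar>t\<bar> powr - a) (\<bar>t\<bar> powr -2))"
proof -
  let ?h = "\<lambda>t::real. min (\<bar>t\<bar> powr - a) (\<bar>t\<bar> powr -2)"
  have pi: "integrable lborel (\<lambda>x. indicator S x * f x)"
    if "(f has_integral c) S" "\<And>x. x \<in> S \<Longrightarrow> 0 \<le> f x" "S \<in> sets borel" "f \<in> borel_measurable borel"
    for f :: "real \<Rightarrow> real" and c S
  proof -
    have "f absolutely_integrable_on S"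
      by (rule nonnegative_absolutely_integrable_1) (use that in auto)
    then have "integrable lebesgue (\<lambda>x. indicator S x * f x)" by (simp add: set_integrable_def)
    then show ?thesis by (subst (asm) integrable_completion) (use that in auto)
  qed
  have 1: "integrable lborel (\<lambda>x. indicator {0..1} x * (x powr - a))"
    by (rule pi[OF has_integral_powr_from_0]) (use a in auto)
  have 2: "integrable lborel (\<lambda>x::real. indicator {1..} x * (x powr -2))"
    by (rule pi[OF has_integral_powr_to_inf]) auto
  let ?g = "\<lambda>t::real. indicator {0..1} t * (t powr - a) + indicator {1..} t * (t powr -2)"
  have g: "integrable lborel ?g" by (rule Bochner_Integration.integrable_add[OF 1 2])
  have g': "integrable lborel (\<lambda>t. ?g (- t))"
    using lborel_integrable_real_affine[OF g, of "-1" 0] by simp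
  show ?thesis
  proof (rule Bochner_Integration.integrable_bound[OF Bochner_Integration.integrable_add[OF g g']])
    show "AE t in lborel. norm (?h t) \<le> norm (?g t + ?g (- t))"
    proof (rule AE_I2)
      fix t :: real
      have nn: "0 \<le> ?g s" for s by simp
      have "?h t \<le> ?g \<bar>t\<bar>" by (auto simp: indicator_def min_def)
      also have "?g \<bar>t\<bar> \<le> ?g t + ?g (- t)"
        using nn[of t] nn[of "- t"] by (cases "t \<ge> 0") (auto simp: abs_if)
      finally show "norm (?h t) \<le> norm (?g t + ?g (- t))"
        using nn[of t] nn[of "- t"] by simp
    qed
  qed simp
qed

text \<open>Comparison with a product of functions h of one coordinate, where h(t) = min(|t|^(-a),
  |t|^(-2)). Since h decreases in |t| and every coordinate is at most |x|, the product dominates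
  h(|x|)^n. This is the source of the decay exponent -2n in all later estimates.\<close>

lemma integrable_powr_bounds:
  fixes f :: "'a::euclidean_space \<Rightarrow> 'b::euclidean_space"
  assumes m: "f \<in> borel_measurable borel"
    and bp: "\<And>x. x \<noteq> 0 \<Longrightarrow> norm (f x) \<le> C * norm x powr p"
    and bq: "\<And>x. x \<noteq> 0 \<Longrightarrow> norm (f x) \<le> C * norm x powr q"
    and p: "p > - real DIM('a)" and q: "q \<le> - 2 * real DIM('a)"
  shows "integrable lborel f"
proof -
  let ?n = "real DIM('a)"
  \<comment> \<open>The singularity is distributed evenly over the n coordinates, so the condition p
    > -n becomes exactly a < 1, the one-dimensional integrability at 0.\<close>
  define a where "a = max 0 (- p) / ?n"
  have a: "0 \<le> a" "a < 1" using p by (auto simp: a_def)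
  have an: "- a * ?n \<le> p" "- a * ?n \<le> 0" by (auto simp: a_def)
  let ?h = "\<lambda>t::real. min (\<bar>t\<bar> powr - a) (\<bar>t\<bar> powr -2)"
  have i: "integrable lborel (\<lambda>x::'a. C * (\<Prod>b\<in>Basis. ?h (x \<bullet> b)))"
    by (intro integrable_mult_right integrable_lborel_prod_Basis integrable_powr_min a)
  \<comment> \<open>Since \<open>0 powr c = 0\<close>, the comparison product vanishes on the
    coordinate hyperplanes and dominates nothing there; these null sets are discarded.\<close>
  have "AE x in lborel. \<forall>b\<in>(Basis::'a set). x \<bullet> b \<noteq> 0"
  proof (rule AE_finite_allI)
    fix b :: 'a assume "b \<in> Basis"
    then have "negligible {x. x \<bullet> b = 0}" by (rule negligible_standard_hyperplane)
    then have "{x. x \<bullet> b = 0} \<in> null_sets lborel"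
      by (simp add: negligible_iff_null_sets null_sets_completion_iff)
    then show "AE x in lborel. x \<bullet> b \<noteq> 0" by (rule AE_I') auto
  qed simp
  then have "AE x in lborel. norm (f x) \<le> norm (C * (\<Prod>b\<in>Basis. ?h (x \<bullet> b)))"
  proof eventually_elim
    case (elim x)
    let ?r = "norm x"
    obtain b :: 'a where "b \<in> Basis" using nonempty_Basis by blast
    with elim have x: "x \<noteq> 0" by auto
    then have r: "?r > 0" by simp
    have "a * ?n \<le> 1 * ?n" using a by (intro mult_right_mono) auto
    then have q': "q \<le> - a * ?n" "q \<le> - 2 * ?n" using q by linarith+
    have C: "0 \<le> C"
    proof -
      have "0 \<le> C * ?r powr p" using bp[OF x] norm_ge_zero order_trans by blast
      then show ?thesis using r by (simp add: zero_le_mult_iff)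
    qed
    have pw: "(?r powr c) ^ DIM('a) = ?r powr (c * ?n)" for c
      using r by (simp add: powr_powr powr_realpow[symmetric])
    have "norm (f x) \<le> C * ?h ?r ^ DIM('a)"
    proof (cases "?r \<le> 1")
      case True
      have "?r powr p \<le> ?r powr (- a * ?n)" "?r powr p \<le> ?r powr (- 2 * ?n)"
        using True r an p by (auto intro!: powr_mono')
      then show ?thesis using bp[OF x] C by (auto simp: min_def pw intro: order_trans mult_left_mono)
    next
      case False
      have "?r powr q \<le> ?r powr (- a * ?n)" "?r powr q \<le> ?r powr (- 2 * ?n)"
        using False by (intro powr_mono q', simp)+
      then show ?thesis using bq[OF x] C by (auto simp: min_def pw intro: order_trans mult_left_mono)
    qed
    also have "?h ?r ^ DIM('a) = (\<Prod>b\<in>(Basis::'a set). ?h ?r)" by simp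
    also have "C * (\<Prod>b\<in>(Basis::'a set). ?h ?r) \<le> C * (\<Prod>b\<in>Basis. ?h (x \<bullet> b))"
    proof (intro mult_left_mono prod_mono conjI C)
      fix b :: 'a assume b: "b \<in> Basis"
      have "\<bar>x \<bullet> b\<bar> \<le> ?r" "\<bar>x \<bullet> b\<bar> > 0" using b elim by (auto simp: Basis_le_norm)
      then have "?r powr - a \<le> \<bar>x \<bullet> b\<bar> powr - a" "?r powr -2 \<le> \<bar>x \<bullet> b\<bar> powr -2"
        using a by (auto intro!: powr_mono2')
      then show "?h ?r \<le> ?h (x \<bullet> b)" by auto
    qed auto
    finally show ?case by simp
  qed
  then show ?thesis
    by (rule Bochner_Integration.integrable_bound[OF i, rotated]) (use m in simp)
qed

lemma powr_interpolate:
  fixes N C r :: real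
  assumes "N \<le> C * r powr a" "N \<le> C * r powr b" "b \<le> c" "c \<le> a" "r > 0" "C \<ge> 0"
  shows "N \<le> C * r powr c"
proof (cases "r \<le> 1")
  case True
  then have "C * r powr a \<le> C * r powr c" using assms by (intro mult_left_mono powr_mono') auto
  then show ?thesis using assms by linarith
next
  case False
  then have "C * r powr b \<le> C * r powr c" using assms by (intro mult_left_mono powr_mono) auto
  then show ?thesis using assms by linarith
qed

section \<open>The Fourier transform of the Gaussian\<close>

lemma gaussian_fourier_1d:
  "integrable lborel (\<lambda>t. complex_of_real (exp (- t\<^sup>2 / 2)) * iexp (s * t))"
  "(LINT t|lborel. complex_of_real (exp (- t\<^sup>2 / 2)) * iexp (s * t)) = complex_of_real (sqrt (2 * pi) * exp (- s\<^sup>2 / 2))"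
proof -
  have i: "integrable lborel (\<lambda>t::real. exp (- t\<^sup>2 / 2))"
    using integrable_mult_right[OF integrable_normal_density[of 1 0], of "sqrt (2 * pi)"]
    by (simp add: normal_density_def)
  show "integrable lborel (\<lambda>t. complex_of_real (exp (- t\<^sup>2 / 2)) * iexp (s * t))"
    by (rule Bochner_Integration.integrable_bound[OF i]) (auto simp: norm_mult)
  have "complex_of_real (exp (- s\<^sup>2 / 2)) = (LINT t|density lborel std_normal_density. iexp (s * t))"
    using char_std_normal_distribution by (simp add: char_def fun_eq_iff)
  also have "\<dots> = (LINT t|lborel. std_normal_density t *\<^sub>R iexp (s * t))"
    by (rule integral_density) auto
  also have "\<dots> = (LINT t|lborel. complex_of_real (1 / sqrt (2 * pi)) * (complex_of_real (exp (- t\<^sup>2 / 2)) * iexp (s * t)))"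
    by (intro Bochner_Integration.integral_cong) (auto simp: std_normal_density_def scaleR_conv_of_real)
  also have "\<dots> = complex_of_real (1 / sqrt (2 * pi)) * (LINT t|lborel. complex_of_real (exp (- t\<^sup>2 / 2)) * iexp (s * t))"
    by simp
  finally show "(LINT t|lborel. complex_of_real (exp (- t\<^sup>2 / 2)) * iexp (s * t)) = complex_of_real (sqrt (2 * pi) * exp (- s\<^sup>2 / 2))"
    by (simp add: field_simps)
qed

lemma gaussian_fourier:
  fixes x :: "'a::euclidean_space"
  shows "integrable lborel (\<lambda>\<xi>::'a. exp (- (norm \<xi>)\<^sup>2 / 2))"
    and "(LINT \<xi>|lborel. exp (- (norm \<xi>)\<^sup>2 / 2) * cos (\<xi> \<bullet> x)) = sqrt (2 * pi) ^ DIM('a) * exp (- (norm x)\<^sup>2 / 2)"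
proof -
  have np: "(\<Prod>b\<in>Basis. exp (- (y \<bullet> b)\<^sup>2 / 2)) = exp (- (norm y)\<^sup>2 / 2)" for y :: 'a
  proof -
    have "(norm y)\<^sup>2 = (\<Sum>b\<in>Basis. (y \<bullet> b)\<^sup>2)"
      unfolding power2_norm_eq_inner by (subst euclidean_inner) (simp add: power2_eq_square)
    then show ?thesis
      by (simp only: exp_sum[OF finite_Basis, symmetric] sum_negf sum_divide_distrib[symmetric])
  qed
  let ?f = "\<lambda>b t. complex_of_real (exp (- t\<^sup>2 / 2)) * iexp ((x \<bullet> b) * t)"
  have e: "(\<Prod>b\<in>Basis. ?f b (\<xi> \<bullet> b)) = complex_of_real (exp (- (norm \<xi>)\<^sup>2 / 2)) * iexp (\<xi> \<bullet> x)" for \<xi> :: 'a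
  proof -
    have "(\<Prod>b\<in>Basis. ?f b (\<xi> \<bullet> b)) = complex_of_real (\<Prod>b\<in>Basis. exp (- (\<xi> \<bullet> b)\<^sup>2 / 2)) *
        exp (\<Sum>b\<in>Basis. \<i> * complex_of_real ((x \<bullet> b) * (\<xi> \<bullet> b)))"
      by (simp only: prod.distrib of_real_prod exp_sum finite_Basis)
    also have "(\<Sum>b\<in>Basis. \<i> * complex_of_real ((x \<bullet> b) * (\<xi> \<bullet> b))) = \<i> * complex_of_real (\<xi> \<bullet> x)"
      by (simp only: sum_distrib_left[symmetric] of_real_sum[symmetric] euclidean_inner[of x \<xi>, symmetric]
          inner_commute[of x \<xi>])
    finally show ?thesis unfolding np .
  qed
  note I = integrable_lborel_prod_Basis[of ?f, OF gaussian_fourier_1d(1), unfolded e]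
  note J = integral_lborel_prod_Basis[of ?f, OF gaussian_fourier_1d(1), unfolded e]
  have "integrable lborel (\<lambda>\<xi>::'a. norm (complex_of_real (exp (- (norm \<xi>)\<^sup>2 / 2)) * iexp (\<xi> \<bullet> x)))"
    using I by (rule integrable_norm)
  then show "integrable lborel (\<lambda>\<xi>::'a. exp (- (norm \<xi>)\<^sup>2 / 2))" by (simp add: norm_mult)
  have "(LINT \<xi>|lborel. exp (- (norm \<xi>)\<^sup>2 / 2) * cos (\<xi> \<bullet> x)) =
      Re (LINT \<xi>|lborel. complex_of_real (exp (- (norm \<xi>)\<^sup>2 / 2)) * iexp (\<xi> \<bullet> x))"
    by (subst integral_Re[OF I, symmetric]) (simp add: Re_exp)
  also have "\<dots> = (\<Prod>b\<in>Basis. sqrt (2 * pi) * exp (- (x \<bullet> b)\<^sup>2 / 2))"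
    unfolding J gaussian_fourier_1d(2) of_real_prod[symmetric] by (rule Re_complex_of_real)
  also have "\<dots> = sqrt (2 * pi) ^ DIM('a) * exp (- (norm x)\<^sup>2 / 2)"
    by (simp only: prod.distrib np) simp
  finally show "(LINT \<xi>|lborel. exp (- (norm \<xi>)\<^sup>2 / 2) * cos (\<xi> \<bullet> x)) = sqrt (2 * pi) ^ DIM('a) * exp (- (norm x)\<^sup>2 / 2)" .
qed

section \<open>Integration by parts across a singularity\<close>

lemma powr_mult_flat_tendsto_0:
  assumes "\<kappa> > 0"
  shows "((\<lambda>r. r powr a * exp (- \<kappa> / r\<^sup>2)) \<longlongrightarrow> 0) (at_right (0::real))"
  using assms by real_asymp

text \<open>The cutoff absorbs any negative power. The bound r^2 is chosen because it yields both
  continuity and a vanishing derivative at the origin.\<close>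

lemma powr_mult_flat_le:
  fixes \<kappa> a :: real
  assumes "\<kappa> > 0"
  obtains \<delta> where "\<delta> > 0" "\<And>r. 0 < r \<Longrightarrow> r < \<delta> \<Longrightarrow> r powr a * exp (- \<kappa> / r\<^sup>2) \<le> r\<^sup>2"
proof -
  have "\<forall>\<^sub>F r in at_right 0. dist (r powr (a - 2) * exp (- \<kappa> / r\<^sup>2)) 0 < 1"
    by (rule tendstoD[OF powr_mult_flat_tendsto_0[OF assms]]) simp
  then obtain \<delta> where \<delta>: "\<delta> > 0" "\<And>r. 0 < r \<Longrightarrow> r < \<delta> \<Longrightarrow> \<bar>r powr (a - 2) * exp (- \<kappa> / r\<^sup>2)\<bar> < 1"
    unfolding eventually_at_right_field by auto
  show ?thesis
  proof (rule that[OF \<delta>(1)])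
    fix r :: real assume r: "0 < r" "r < \<delta>"
    have "r powr a * exp (- \<kappa> / r\<^sup>2) = r\<^sup>2 * (r powr (a - 2) * exp (- \<kappa> / r\<^sup>2))"
      using r by (simp add: powr_diff)
    also have "\<dots> \<le> r\<^sup>2 * 1" using \<delta>(2)[OF r] by (intro mult_left_mono) auto
    finally show "r powr a * exp (- \<kappa> / r\<^sup>2) \<le> r\<^sup>2" by simp
  qed
qed

lemma norm_square_directional_derivative:
  "((\<lambda>t. (norm (x + t *\<^sub>R e))\<^sup>2) has_real_derivative 2 * (x \<bullet> e)) (at 0)"
  unfolding power2_norm_eq_inner
  by (auto intro!: derivative_eq_intros has_derivative_imp_has_field_derivative simp: inner_commute algebra_simps)

text \<open>The singularity at the origin is removed by the flat cutoffs \<open>exp (- 1 / (k |x|\<^sup>2))\<close>.\<close>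

lemma integral_directional_derivative_singular_eq_0:
  fixes f g :: "'a::euclidean_space \<Rightarrow> 'b::euclidean_space"
  assumes e: "norm e = 1"
    and f: "continuous_on (- {0}) f" and g: "continuous_on (- {0}) g"
    and d: "\<And>x. x \<noteq> 0 \<Longrightarrow> ((\<lambda>t. f (x + t *\<^sub>R e)) has_vector_derivative g x) (at 0)"
    and fp: "\<And>x. x \<noteq> 0 \<Longrightarrow> norm (f x) \<le> C * norm x powr p"
    and fq: "\<And>x. x \<noteq> 0 \<Longrightarrow> norm (f x) \<le> C * norm x powr q"
    and gp: "\<And>x. x \<noteq> 0 \<Longrightarrow> norm (g x) \<le> C * norm x powr (p - 1)"
    and gq: "\<And>x. x \<noteq> 0 \<Longrightarrow> norm (g x) \<le> C * norm x powr q"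
    and p: "p - 1 > - real DIM('a)" and q: "q \<le> - 2 * real DIM('a)"
  shows "(LINT x|lborel. g x) = 0"
proof -
  have fm: "f \<in> borel_measurable borel" and gm: "g \<in> borel_measurable borel"
    using f g by (auto intro: continuous_except_0_measurable)
  have C: "C \<ge> 0"
  proof -
    have "0 \<le> C * norm e powr p" using fp[of e] e norm_ge_zero[of "f e"] by (metis norm_zero order_trans zero_neq_one)
    then show ?thesis using e by simp
  qed
  have fi: "integrable lborel f" by (rule integrable_powr_bounds[OF fm fp fq]) (use p q in auto)
  have gi: "integrable lborel g" by (rule integrable_powr_bounds[OF gm gp gq]) (use p q in auto)
  have fdi: "integrable lborel (\<lambda>x. norm (f x) / norm x)"
  proof (rule integrable_powr_bounds[of _ C "p - 1" q])
    show "(\<lambda>x. norm (f x) / norm x) \<in> borel_measurable borel" using fm by measurable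
    fix x :: 'a assume x: "x \<noteq> 0"
    have dv: "norm (norm (f x) / norm x) \<le> C * norm x powr (c - 1)" if "norm (f x) \<le> C * norm x powr c" for c
      using divide_right_mono[OF that, of "norm x"] x by (simp add: powr_diff)
    show p1: "norm (norm (f x) / norm x) \<le> C * norm x powr (p - 1)" by (rule dv[OF fp[OF x]])
    show "norm (norm (f x) / norm x) \<le> C * norm x powr q"
      by (rule powr_interpolate[OF p1 dv[OF fq[OF x]]]) (use p q x C in auto)
  qed (use p q in auto)
  define cut where "cut \<kappa> x = exp (- \<kappa> / (norm x)\<^sup>2)" for \<kappa> and x :: 'a
  \<comment> \<open>Away from the origin this is the derivative along \<open>e\<close> of
    \<open>cut \<kappa> x *\<^sub>R f x\<close>, the second summand coming from the cutoff.\<close>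
  define G where "G \<kappa> x = (if x = 0 then 0 else
      cut \<kappa> x *\<^sub>R g x + (2 * \<kappa> * (x \<bullet> e) / (norm x) ^ 4 * cut \<kappa> x) *\<^sub>R f x)" for \<kappa> x
  \<comment> \<open>A majorant independent of \<open>\<kappa>\<close>: with s = kappa/|x|^2 the
    cutoff contributes s exp(-s) <= 1 and one factor 1/|x|. Its price is the integrability of
    |f|/|x|, which \<open>p - 1 > - real DIM('a)\<close> provides.\<close>
  have Gb: "norm (G \<kappa> x) \<le> norm (g x) + 2 * (norm (f x) / norm x)" if \<kappa>: "\<kappa> > 0" for \<kappa> x
  proof (cases "x = 0")
    case False
    define s where "s = \<kappa> / (norm x)\<^sup>2"
    have s: "s > 0" using \<kappa> False by (simp add: s_def)
    have cs: "cut \<kappa> x = exp (- s)" by (simp add: cut_def s_def)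
    have "s \<le> exp s" using exp_ge_add_one_self[of s] by linarith
    then have "s * exp (- s) \<le> 1" by (simp add: exp_minus field_simps)
    have "\<bar>x \<bullet> e\<bar> \<le> norm x" using Cauchy_Schwarz_ineq2[of x e] e by simp
    have "norm ((2 * \<kappa> * (x \<bullet> e) / (norm x) ^ 4 * cut \<kappa> x) *\<^sub>R f x) =
        (s * exp (- s)) * (\<bar>x \<bullet> e\<bar> / norm x) * (2 * (norm (f x) / norm x))"
      using \<kappa> False by (simp add: cs abs_mult s_def power2_eq_square power4_eq_xxxx field_simps)
    also have "\<dots> \<le> 1 * 1 * (2 * (norm (f x) / norm x))"
      using \<open>s * exp (- s) \<le> 1\<close> \<open>\<bar>x \<bullet> e\<bar> \<le> norm x\<close> s False
      by (intro mult_right_mono mult_mono) (auto simp: divide_le_eq)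
    finally have 1: "norm ((2 * \<kappa> * (x \<bullet> e) / (norm x) ^ 4 * cut \<kappa> x) *\<^sub>R f x) \<le> 2 * (norm (f x) / norm x)"
      by simp
    have 2: "norm (cut \<kappa> x *\<^sub>R g x) \<le> norm (g x)"
      using s by (simp add: cs mult_left_le_one_le)
    show ?thesis using norm_triangle_mono[OF 2 1] False by (simp add: G_def)
  qed (simp add: G_def)
  have Gc0: "continuous_on (- {0}) (G \<kappa>)" for \<kappa>
  proof -
    have "continuous_on (- {0}) (\<lambda>x. cut \<kappa> x *\<^sub>R g x + (2 * \<kappa> * (x \<bullet> e) / (norm x) ^ 4 * cut \<kappa> x) *\<^sub>R f x)"
      unfolding cut_def by (intro continuous_intros f g) auto
    then show ?thesis by (rule continuous_on_eq) (auto simp: G_def)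
  qed
  have wi: "integrable lborel (\<lambda>x. norm (g x) + 2 * (norm (f x) / norm x))"
    using gi fdi by (intro Bochner_Integration.integrable_add integrable_norm integrable_mult_right)
  have Gm: "G \<kappa> \<in> borel_measurable borel" for \<kappa> by (rule continuous_except_0_measurable[OF Gc0])
  have Gi: "integrable lborel (G \<kappa>)" if "\<kappa> > 0" for \<kappa>
    by (rule Bochner_Integration.integrable_bound[OF wi]) (use Gm Gb[OF that] in \<open>auto intro: order_trans[OF _ abs_ge_self]\<close>)
  have Gz: "(LINT x|lborel. G \<kappa> x) = 0" if \<kappa>: "\<kappa> > 0" for \<kappa>
  proof -
    define F where "F x = (if x = 0 then 0 else cut \<kappa> x *\<^sub>R f x)" for x
    have Fb: "norm (F x) \<le> norm (f x)" for x
      using \<kappa> by (auto simp: F_def cut_def mult_left_le_one_le)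
    have Fc0: "continuous_on (- {0}) F"
    proof -
      have "continuous_on (- {0}) (\<lambda>x. cut \<kappa> x *\<^sub>R f x)"
        unfolding cut_def by (intro continuous_intros f) auto
      then show ?thesis by (rule continuous_on_eq) (auto simp: F_def)
    qed
    show ?thesis
    proof (rule integral_directional_derivative_eq_0[of F _ e])
      show "integrable lborel F"
        by (rule Bochner_Integration.integrable_bound[OF fi])
           (use continuous_except_0_measurable[OF Fc0] Fb in auto)
      show "integrable lborel (G \<kappa>)" by (rule Gi[OF \<kappa>])
      show "continuous_on UNIV (G \<kappa>)"
      proof -
        have "isCont (G \<kappa>) x" for x
        proof (cases "x = 0")
          case False
          then show ?thesis using Gc0[of \<kappa>] by (simp add: continuous_on_eq_continuous_at open_Compl)
        next
          case True
          \<comment> \<open>The worst term near the origin is kappa |x| / |x|^4 times |f|, of order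
            p - 3. The other term has order p - 1, which is smaller for |x| < 1.\<close>
          obtain \<delta> where \<delta>: "\<delta> > 0" "\<And>r. 0 < r \<Longrightarrow> r < \<delta> \<Longrightarrow> r powr (p - 3) * exp (- \<kappa> / r\<^sup>2) \<le> r\<^sup>2"
            using powr_mult_flat_le[OF \<kappa>] by blast
          define \<delta>' where "\<delta>' = min \<delta> 1"
          have "norm (G \<kappa> y) \<le> (C + 2 * \<kappa> * C) * (norm y)\<^sup>2" if y: "y \<noteq> 0" "norm y < \<delta>'" for y
          proof -
            let ?r = "norm y"
            have r: "0 < ?r" "?r < \<delta>" "?r < 1" using y by (auto simp: \<delta>'_def)
            have flat: "?r powr (p - 3) * cut \<kappa> y \<le> ?r\<^sup>2" unfolding cut_def by (rule \<delta>(2)[OF r(1,2)])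
            have "norm (cut \<kappa> y *\<^sub>R g y) \<le> cut \<kappa> y * (C * ?r powr (p - 1))"
              using gp[OF y(1)] by (simp add: cut_def)
            also have "\<dots> \<le> cut \<kappa> y * (C * ?r powr (p - 3))"
              using C r by (intro mult_left_mono powr_mono') (auto simp: cut_def)
            also have "\<dots> = C * (?r powr (p - 3) * cut \<kappa> y)" by simp
            also have "\<dots> \<le> C * ?r\<^sup>2" using C flat by (intro mult_left_mono)
            finally have 1: "norm (cut \<kappa> y *\<^sub>R g y) \<le> C * ?r\<^sup>2" .
            have "\<bar>y \<bullet> e\<bar> \<le> ?r" using Cauchy_Schwarz_ineq2[of y e] e by simp
            have "norm ((2 * \<kappa> * (y \<bullet> e) / ?r ^ 4 * cut \<kappa> y) *\<^sub>R f y) =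
                2 * \<kappa> * \<bar>y \<bullet> e\<bar> / ?r ^ 4 * cut \<kappa> y * norm (f y)"
              using \<kappa> by (simp add: abs_mult cut_def)
            also have "\<dots> \<le> 2 * \<kappa> * ?r / ?r ^ 4 * cut \<kappa> y * (C * ?r powr p)"
              using \<open>\<bar>y \<bullet> e\<bar> \<le> ?r\<close> fp[OF y(1)] \<kappa> C
              by (intro mult_mono divide_right_mono) (auto simp: cut_def)
            also have "\<dots> = 2 * \<kappa> * C * (?r powr (p - 3) * cut \<kappa> y)"
              using r by (simp add: powr_diff power4_eq_xxxx power3_eq_cube field_simps)
            also have "\<dots> \<le> 2 * \<kappa> * C * ?r\<^sup>2" using C \<kappa> flat by (intro mult_left_mono) auto
            finally have 2: "norm ((2 * \<kappa> * (y \<bullet> e) / ?r ^ 4 * cut \<kappa> y) *\<^sub>R f y) \<le> 2 * \<kappa> * C * ?r\<^sup>2" .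
            show ?thesis using norm_triangle_mono[OF 1 2] y by (simp add: G_def distrib_right)
          qed
          then have "\<forall>\<^sub>F y in at 0. norm (G \<kappa> y) \<le> (C + 2 * \<kappa> * C) * (norm y)\<^sup>2"
            unfolding eventually_at using \<delta>(1) by (intro exI[of _ \<delta>']) (auto simp: \<delta>'_def)
          moreover have "((\<lambda>y::'a. (C + 2 * \<kappa> * C) * (norm y)\<^sup>2) \<longlongrightarrow> 0) (at 0)"
            by (rule tendsto_eq_intros refl | simp)+
          ultimately have "(G \<kappa> \<longlongrightarrow> 0) (at 0)" by (rule Lim_null_comparison)
          then show ?thesis using True by (simp add: isCont_def G_def)
        qed
        then show ?thesis by (simp add: continuous_at_imp_continuous_on)
      qed
      show "((\<lambda>t. F (x + t *\<^sub>R e)) has_vector_derivative G \<kappa> x) (at 0)" for x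
      proof (cases "x = 0")
        case True
        obtain \<delta> where \<delta>: "\<delta> > 0" "\<And>r. 0 < r \<Longrightarrow> r < \<delta> \<Longrightarrow> r powr p * exp (- \<kappa> / r\<^sup>2) \<le> r\<^sup>2"
          using powr_mult_flat_le[OF \<kappa>] by blast
        have b: "norm (F (t *\<^sub>R e)) \<le> C * t\<^sup>2" if "t \<noteq> 0" "\<bar>t\<bar> < \<delta>" for t
        proof -
          have nt: "norm (t *\<^sub>R e) = \<bar>t\<bar>" and e0: "e \<noteq> 0" using e by auto
          have "norm (F (t *\<^sub>R e)) = exp (- \<kappa> / \<bar>t\<bar>\<^sup>2) * norm (f (t *\<^sub>R e))"
            using that e nt by (auto simp: F_def cut_def)
          also have "\<dots> \<le> exp (- \<kappa> / \<bar>t\<bar>\<^sup>2) * (C * \<bar>t\<bar> powr p)"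
            using fp[of "t *\<^sub>R e"] that(1) e0 nt by (intro mult_left_mono) auto
          also have "\<dots> = C * (\<bar>t\<bar> powr p * exp (- \<kappa> / \<bar>t\<bar>\<^sup>2))" by simp
          also have "\<dots> \<le> C * \<bar>t\<bar>\<^sup>2" using C \<delta>(2)[of "\<bar>t\<bar>"] that by (intro mult_left_mono) auto
          finally show ?thesis by simp
        qed
        have "((\<lambda>t. F (t *\<^sub>R e)) has_derivative (\<lambda>t. 0)) (at 0)"
          unfolding has_derivative_at'
        proof (intro conjI allI impI)
          fix \<epsilon> :: real assume \<epsilon>: "\<epsilon> > 0"
          show "\<exists>\<delta>>0. \<forall>t. 0 < norm (t - 0) \<and> norm (t - 0) < \<delta> \<longrightarrow>
              norm (F (t *\<^sub>R e) - F (0 *\<^sub>R e) - 0) / norm (t - 0) < \<epsilon>"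
          proof (intro exI[of _ "min \<delta> (\<epsilon> / (C + 1))"] conjI allI impI)
            show "0 < min \<delta> (\<epsilon> / (C + 1))" using \<delta>(1) \<epsilon> C by simp
            fix t :: real assume t: "0 < norm (t - 0) \<and> norm (t - 0) < min \<delta> (\<epsilon> / (C + 1))"
            have "norm (F (t *\<^sub>R e) - F (0 *\<^sub>R e) - 0) / norm (t - 0) \<le> C * t\<^sup>2 / \<bar>t\<bar>"
              using b[of t] t by (auto simp: F_def intro!: divide_right_mono)
            also have "\<dots> = C * \<bar>t\<bar>" using t by (simp add: power2_eq_square abs_if)
            also have "\<dots> \<le> (C + 1) * \<bar>t\<bar>" by (simp add: distrib_right)
            also have "\<dots> < \<epsilon>" using t C by (simp add: field_simps)
            finally show "norm (F (t *\<^sub>R e) - F (0 *\<^sub>R e) - 0) / norm (t - 0) < \<epsilon>" .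
          qed
        qed simp
        then show ?thesis using True by (simp add: has_vector_derivative_def G_def)
      next
        case False
        have "((\<lambda>t. exp (- \<kappa> / (norm (x + t *\<^sub>R e))\<^sup>2)) has_real_derivative
            2 * \<kappa> * (x \<bullet> e) / (norm x) ^ 4 * cut \<kappa> x) (at 0)"
        proof -
          define N where "N t = (norm (x + t *\<^sub>R e))\<^sup>2" for t
          have N0: "N 0 \<noteq> 0" "N 0 = (norm x)\<^sup>2" using False by (auto simp: N_def)
          have "((\<lambda>t. - \<kappa> / N t) has_real_derivative \<kappa> * (2 * (x \<bullet> e)) / (N 0)\<^sup>2) (at 0)"
            using DERIV_divide[OF DERIV_const norm_square_directional_derivative[of x e, folded N_def] N0(1), of "- \<kappa>"]
            by (simp add: power2_eq_square)
          from DERIV_chain2[OF DERIV_exp this]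
          show ?thesis by (simp add: N_def cut_def ac_simps)
        qed
        then have c: "((\<lambda>t. cut \<kappa> (x + t *\<^sub>R e)) has_vector_derivative
            2 * \<kappa> * (x \<bullet> e) / (norm x) ^ 4 * cut \<kappa> x) (at 0)"
          by (simp add: cut_def has_real_derivative_iff_has_vector_derivative)
        have "((\<lambda>t. cut \<kappa> (x + t *\<^sub>R e) *\<^sub>R f (x + t *\<^sub>R e)) has_vector_derivative G \<kappa> x) (at 0)"
          using has_vector_derivative_scaleR[OF c[folded has_real_derivative_iff_has_vector_derivative] d[OF False]] False
          by (simp add: G_def)
        moreover have "open {t::real. x + t *\<^sub>R e \<noteq> 0}"
          by (intro open_Collect_neq continuous_intros)
        ultimately show ?thesis
          using False by (elim has_vector_derivative_transform_within_open[of _ _ _ "{t. x + t *\<^sub>R e \<noteq> 0}"])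
            (auto simp: F_def)
      qed
    qed
  qed
  \<comment> \<open>As kappa = 1/(n+1) tends to 0, the cutoff tends to 1 and its derivative to 0 at
    every point other than the origin.\<close>
  have "(\<lambda>n. LINT x|lborel. G (1 / real (Suc n)) x) \<longlonglongrightarrow> (LINT x|lborel. g x)"
  proof (rule integral_dominated_convergence[OF _ _ wi])
    show "g \<in> borel_measurable lborel" "G (1 / real (Suc n)) \<in> borel_measurable lborel" for n
      using gm Gm by auto
    show "AE x in lborel. norm (G (1 / real (Suc n)) x) \<le> norm (g x) + 2 * (norm (f x) / norm x)" for n
      by (intro AE_I2 Gb) simp
    have "AE x in lborel. x \<noteq> (0::'a)" by (rule AE_lborel_singleton)
    then show "AE x in lborel. (\<lambda>n. G (1 / real (Suc n)) x) \<longlonglongrightarrow> g x"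
    proof eventually_elim
      case (elim x)
      have t0: "(\<lambda>n. 1 / real (Suc n)) \<longlonglongrightarrow> 0" by real_asymp
      have "(\<lambda>n. cut (1 / real (Suc n)) x *\<^sub>R g x +
          (2 * (1 / real (Suc n)) * (x \<bullet> e) / (norm x) ^ 4 * cut (1 / real (Suc n)) x) *\<^sub>R f x) \<longlonglongrightarrow>
          exp (- 0 / (norm x)\<^sup>2) *\<^sub>R g x + (2 * 0 * (x \<bullet> e) / (norm x) ^ 4 * exp (- 0 / (norm x)\<^sup>2)) *\<^sub>R f x"
        unfolding cut_def using elim by (intro tendsto_intros t0) auto
      then show ?case using elim by (simp add: G_def)
    qed
  qed
  then show ?thesis by (simp add: Gz LIMSEQ_const_iff)
qed

section \<open>Symbols and oscillatory integrals\<close>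

text \<open>Differentiability of a solution of B(xi) g(xi) = f(xi) will be obtained as convergence
  of its difference quotients, hence this form of the derivative.\<close>

lemma has_vector_derivative_at_0_iff:
  "(h has_vector_derivative d) (at 0) \<longleftrightarrow> ((\<lambda>t. inverse t *\<^sub>R (h t - h 0)) \<longlongrightarrow> d) (at 0)"
proof -
  have e: "norm (h t - h 0 - t *\<^sub>R d) / \<bar>t\<bar> = norm (inverse t *\<^sub>R (h t - h 0) - d)" if "t \<noteq> 0" for t
  proof -
    have "inverse t *\<^sub>R (h t - h 0) - d = inverse t *\<^sub>R (h t - h 0 - t *\<^sub>R d)"
      using that by (simp add: scaleR_diff_right)
    then show ?thesis by (simp add: divide_inverse mult.commute)
  qed
  have "(h has_vector_derivative d) (at 0) \<longleftrightarrow> ((\<lambda>t. norm (h t - h 0 - t *\<^sub>R d) / \<bar>t\<bar>) \<longlongrightarrow> 0) (at 0)"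
    by (simp add: has_vector_derivative_def has_derivative_at bounded_linear_scaleR_left)
  also have "\<dots> \<longleftrightarrow> ((\<lambda>t. norm (inverse t *\<^sub>R (h t - h 0) - d)) \<longlongrightarrow> 0) (at 0)"
    by (rule tendsto_cong) (simp add: eventually_at_filter e)
  also have "\<dots> \<longleftrightarrow> ((\<lambda>t. inverse t *\<^sub>R (h t - h 0)) \<longlongrightarrow> d) (at 0)"
    by (simp add: tendsto_norm_zero_iff LIM_zero_iff)
  finally show ?thesis .
qed

text \<open>The exponent \<open>p\<close> controls the singularity at \<open>0\<close>, the exponent \<open>q\<close> the decay at infinity;
  every derivative along \<open>e\<close> lowers both by one. The value of \<open>f\<close> at \<open>0\<close> plays no role.\<close>

fun symbol_class :: "'a::euclidean_space \<Rightarrow> nat \<Rightarrow> real \<Rightarrow> real \<Rightarrow> ('a \<Rightarrow> 'b::euclidean_space) \<Rightarrow> bool" where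
  "symbol_class e 0 p q f \<longleftrightarrow> continuous_on (- {0}) f \<and>
     (\<exists>C. \<forall>x. x \<noteq> 0 \<longrightarrow> norm (f x) \<le> C * norm x powr p \<and> norm (f x) \<le> C * norm x powr q)"
| "symbol_class e (Suc k) p q f \<longleftrightarrow> symbol_class e 0 p q f \<and>
     (\<exists>g. (\<forall>x. x \<noteq> 0 \<longrightarrow> ((\<lambda>t. f (x + t *\<^sub>R e)) has_vector_derivative g x) (at 0)) \<and>
       symbol_class e k (p - 1) (q - 1) g)"

lemma symbol_class_0: "symbol_class e k p q f \<Longrightarrow> symbol_class e 0 p q f"
  by (cases k) auto

lemma symbol_class_SucD: "symbol_class e (Suc k) p q f \<Longrightarrow> symbol_class e k p q f"
proof (induction k arbitrary: p q f)
  case (Suc k)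
  from Suc.prems obtain g where "symbol_class e 0 p q f"
    "\<forall>x. x \<noteq> 0 \<longrightarrow> ((\<lambda>t. f (x + t *\<^sub>R e)) has_vector_derivative g x) (at 0)"
    "symbol_class e (Suc k) (p - 1) (q - 1) g" by (auto simp del: symbol_class.simps(1))
  moreover from this(3) have "symbol_class e k (p - 1) (q - 1) g" by (rule Suc.IH)
  ultimately show ?case unfolding symbol_class.simps(2) by blast
qed simp

lemma symbol_class_bound:
  assumes "symbol_class e k p q f"
  obtains C where "C \<ge> 0" "\<And>x. x \<noteq> 0 \<Longrightarrow> norm (f x) \<le> C * norm x powr p"
    "\<And>x. x \<noteq> 0 \<Longrightarrow> norm (f x) \<le> C * norm x powr q"
proof -
  obtain C where C: "\<And>x. x \<noteq> 0 \<Longrightarrow> norm (f x) \<le> C * norm x powr p \<and> norm (f x) \<le> C * norm x powr q"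
    using symbol_class_0[OF assms] by auto
  have "norm (f x) \<le> max 0 C * norm x powr c" if "norm (f x) \<le> C * norm x powr c" for x c
    using that mult_right_mono[of C "max 0 C" "norm x powr c"] by simp
  with C show ?thesis by (intro that[of "max 0 C"]) auto
qed

lemma symbol_class_continuous: "symbol_class e k p q f \<Longrightarrow> continuous_on (- {0}) f"
  using symbol_class_0 by fastforce

lemma symbol_class_measurable: "symbol_class e k p q f \<Longrightarrow> f \<in> borel_measurable borel"
  using symbol_class_continuous continuous_except_0_measurable by blast

lemma symbol_class_add:
  "symbol_class e k p q f \<Longrightarrow> symbol_class e k p q g \<Longrightarrow> symbol_class e k p q (\<lambda>x. f x + g x)"
proof (induction k arbitrary: p q f g)
  case 0
  obtain C where C: "\<And>x. x \<noteq> 0 \<Longrightarrow> norm (f x) \<le> C * norm x powr p" "\<And>x. x \<noteq> 0 \<Longrightarrow> norm (f x) \<le> C * norm x powr q"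
    by (rule symbol_class_bound[OF 0(1)]) blast
  obtain D where D: "\<And>x. x \<noteq> 0 \<Longrightarrow> norm (g x) \<le> D * norm x powr p" "\<And>x. x \<noteq> 0 \<Longrightarrow> norm (g x) \<le> D * norm x powr q"
    by (rule symbol_class_bound[OF 0(2)]) blast
  have "norm (f x + g x) \<le> (C + D) * norm x powr p \<and> norm (f x + g x) \<le> (C + D) * norm x powr q" if "x \<noteq> 0" for x
    using norm_triangle_mono[OF C(1) D(1)] norm_triangle_mono[OF C(2) D(2)] that by (simp add: distrib_right)
  then show ?case using 0 by (auto intro!: continuous_intros)
next
  case (Suc k)
  from Suc.prems obtain f' g' where
    "\<forall>x. x \<noteq> 0 \<longrightarrow> ((\<lambda>t. f (x + t *\<^sub>R e)) has_vector_derivative f' x) (at 0)" "symbol_class e k (p - 1) (q - 1) f'"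
    "\<forall>x. x \<noteq> 0 \<longrightarrow> ((\<lambda>t. g (x + t *\<^sub>R e)) has_vector_derivative g' x) (at 0)" "symbol_class e k (p - 1) (q - 1) g'"
    by (auto simp del: symbol_class.simps(1))
  moreover have "symbol_class e 0 p q (\<lambda>x. f x + g x)"
    by (rule symbol_class_0[OF Suc.IH]) (use Suc.prems symbol_class_SucD in blast)+
  ultimately show ?case
    by (auto simp del: symbol_class.simps(1) intro!: exI[of _ "\<lambda>x. f' x + g' x"] has_vector_derivative_add Suc.IH)
qed

lemma symbol_class_0_fun: "symbol_class e k p q (\<lambda>x. 0)"
proof (induction k arbitrary: p q)
  case (Suc k)
  have "symbol_class e 0 p q (\<lambda>x. 0 :: 'b)" by (auto intro: exI[of _ 0])
  then show ?case using Suc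
    by (auto simp del: symbol_class.simps(1) intro!: exI[of _ "\<lambda>x. 0"])
qed (auto intro: exI[of _ 0])

lemma symbol_class_sum:
  "(\<And>i. i \<in> I \<Longrightarrow> symbol_class e k p q (f i)) \<Longrightarrow> symbol_class e k p q (\<lambda>x. \<Sum>i\<in>I. f i x)"
  by (induction I rule: infinite_finite_induct) (auto intro: symbol_class_0_fun symbol_class_add)

lemma symbol_class_const: "symbol_class e k 0 0 (\<lambda>x. c)"
proof (cases k)
  case 0
  then show ?thesis by (auto intro: exI[of _ "norm c"])
next
  case (Suc k)
  have "symbol_class e 0 0 0 (\<lambda>x. c)" by (auto intro: exI[of _ "norm c"])
  then show ?thesis unfolding Suc
    by (auto simp del: symbol_class.simps(1) intro!: exI[of _ "\<lambda>x. 0"] symbol_class_0_fun)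
qed

lemma symbol_class_linear:
  assumes L: "bounded_linear L"
  shows "symbol_class e k p q f \<Longrightarrow> symbol_class e k p q (\<lambda>x. L (f x))"
proof (induction k arbitrary: p q f)
  case 0
  obtain C where C: "\<And>x. x \<noteq> 0 \<Longrightarrow> norm (f x) \<le> C * norm x powr p" "\<And>x. x \<noteq> 0 \<Longrightarrow> norm (f x) \<le> C * norm x powr q"
    by (rule symbol_class_bound[OF 0]) blast
  obtain K where K: "K \<ge> 0" "\<And>y. norm (L y) \<le> norm y * K" using bounded_linear.nonneg_bounded[OF L] by blast
  have "norm (L (f x)) \<le> (C * K) * norm x powr c" if "norm (f x) \<le> C * norm x powr c" for x c
    using mult_right_mono[OF that K(1)] K(2)[of "f x"] by (simp add: mult_ac)
  then have "norm (L (f x)) \<le> (C * K) * norm x powr p \<and> norm (L (f x)) \<le> (C * K) * norm x powr q" if "x \<noteq> 0" for x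
    using C that by blast
  then show ?case using 0 by (auto intro!: bounded_linear.continuous_on[OF L])
next
  case (Suc k)
  from Suc.prems obtain f' where
    "\<forall>x. x \<noteq> 0 \<longrightarrow> ((\<lambda>t. f (x + t *\<^sub>R e)) has_vector_derivative f' x) (at 0)" "symbol_class e k (p - 1) (q - 1) f'"
    by (auto simp del: symbol_class.simps(1))
  moreover have "symbol_class e 0 p q (\<lambda>x. L (f x))"
    by (rule symbol_class_0[OF Suc.IH]) (use Suc.prems symbol_class_SucD in blast)
  ultimately show ?case
    by (auto simp del: symbol_class.simps(1) intro!: exI[of _ "\<lambda>x. L (f' x)"] bounded_linear.has_vector_derivative[OF L] Suc.IH)
qed

lemma symbol_class_scaleR:
  fixes f :: "'a::euclidean_space \<Rightarrow> real" and g :: "'a \<Rightarrow> 'b::euclidean_space"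
  shows "symbol_class e k p q f \<Longrightarrow> symbol_class e k p' q' g \<Longrightarrow>
    symbol_class e k (p + p') (q + q') (\<lambda>x. f x *\<^sub>R g x)"
proof (induction k arbitrary: p q f p' q' g)
  case 0
  obtain C where C: "C \<ge> 0" "\<And>x. x \<noteq> 0 \<Longrightarrow> norm (f x) \<le> C * norm x powr p" "\<And>x. x \<noteq> 0 \<Longrightarrow> norm (f x) \<le> C * norm x powr q"
    by (rule symbol_class_bound[OF 0(1)]) blast
  obtain D where D: "D \<ge> 0" "\<And>x. x \<noteq> 0 \<Longrightarrow> norm (g x) \<le> D * norm x powr p'" "\<And>x. x \<noteq> 0 \<Longrightarrow> norm (g x) \<le> D * norm x powr q'"
    by (rule symbol_class_bound[OF 0(2)]) blast
  have "norm (f x *\<^sub>R g x) \<le> (C * D) * norm x powr (c + c')"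
    if "norm (f x) \<le> C * norm x powr c" "norm (g x) \<le> D * norm x powr c'" for x c c'
    using mult_mono[OF that] C(1) by (simp add: powr_add mult_ac)
  then have "norm (f x *\<^sub>R g x) \<le> (C * D) * norm x powr (p + p') \<and>
      norm (f x *\<^sub>R g x) \<le> (C * D) * norm x powr (q + q')" if "x \<noteq> 0" for x
    using C D that by blast
  then show ?case using 0 by (auto intro!: continuous_intros)
next
  case (Suc k)
  from Suc.prems obtain f' g' where *:
    "\<forall>x. x \<noteq> 0 \<longrightarrow> ((\<lambda>t. f (x + t *\<^sub>R e)) has_vector_derivative f' x) (at 0)" "symbol_class e k (p - 1) (q - 1) f'"
    "\<forall>x. x \<noteq> 0 \<longrightarrow> ((\<lambda>t. g (x + t *\<^sub>R e)) has_vector_derivative g' x) (at 0)" "symbol_class e k (p' - 1) (q' - 1) g'"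
    by (auto simp del: symbol_class.simps(1))
  have fg: "symbol_class e k p q f" "symbol_class e k p' q' g"
    using Suc.prems symbol_class_SucD by blast+
  have "symbol_class e k (p + p' - 1) (q + q' - 1) (\<lambda>x. f x *\<^sub>R g' x + f' x *\<^sub>R g x)"
    using symbol_class_add[OF Suc.IH[OF fg(1) *(4)]] Suc.IH[OF *(2) fg(2)] by (simp add: algebra_simps)
  moreover have "((\<lambda>t. f (x + t *\<^sub>R e) *\<^sub>R g (x + t *\<^sub>R e)) has_vector_derivative f x *\<^sub>R g' x + f' x *\<^sub>R g x) (at 0)"
    if "x \<noteq> 0" for x
    using has_vector_derivative_scaleR[of "\<lambda>t. f (x + t *\<^sub>R e)" "f' x" 0 UNIV "\<lambda>t. g (x + t *\<^sub>R e)" "g' x"] *(1,3) that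
    by (simp add: has_real_derivative_iff_has_vector_derivative)
  moreover have "symbol_class e 0 (p + p') (q + q') (\<lambda>x. f x *\<^sub>R g x)"
    by (rule symbol_class_0[OF Suc.IH[OF fg]])
  ultimately show ?case
    by (auto simp del: symbol_class.simps(1) intro!: exI[of _ "\<lambda>x. f x *\<^sub>R g' x + f' x *\<^sub>R g x"])
qed

lemma symbol_class_inner: "symbol_class e k 1 1 (\<lambda>x. x \<bullet> v)"
proof -
  have 0: "symbol_class e 0 1 1 (\<lambda>x. x \<bullet> v)"
    by (auto intro!: exI[of _ "norm v"] continuous_intros simp: mult.commute[of "norm v"] Cauchy_Schwarz_ineq2)
  show ?thesis
  proof (cases k)
    case (Suc k)
    have "((\<lambda>t. (x + t *\<^sub>R e) \<bullet> v) has_vector_derivative e \<bullet> v) (at 0)" for x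
      by (auto intro!: derivative_eq_intros simp: has_real_derivative_iff_has_vector_derivative[symmetric] inner_add_left)
    then show ?thesis unfolding Suc using 0
      by (auto simp del: symbol_class.simps(1) intro!: exI[of _ "\<lambda>x. e \<bullet> v"] symbol_class_const)
  qed (use 0 in simp)
qed

lemma symbol_class_monomial:
  fixes \<beta> :: "'n::finite multi_index"
  shows "symbol_class e k (mi_order \<beta>) (mi_order \<beta>) (monomial \<beta>)"
proof -
  have p: "symbol_class e k (real m) (real m) (\<lambda>x :: real ^ 'n. (x $ i) ^ m)" for m i
  proof (induction m)
    case (Suc m)
    show ?case
      using symbol_class_scaleR[OF symbol_class_inner[of e k "axis i 1"] Suc] by (simp add: inner_axis)
  qed (simp add: symbol_class_const)
  have "symbol_class e k (real (\<Sum>i\<in>I. \<beta> i)) (real (\<Sum>i\<in>I. \<beta> i)) (\<lambda>x. \<Prod>i\<in>I. (x $ i) ^ \<beta> i)" for I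
  proof (induction I rule: infinite_finite_induct)
    case (insert i I)
    then show ?case using symbol_class_scaleR[OF p[of "\<beta> i" i] insert.IH] by simp
  qed (auto simp: symbol_class_const)
  then show ?thesis unfolding monomial_def[abs_def] mi_order_def .
qed

lemma exp_minus_le_powr:
  fixes s c :: real
  assumes "s > 0" "c \<le> 0"
  shows "\<exists>C\<ge>0. \<forall>r>0. exp (- s * r\<^sup>2) \<le> C * r powr c"
proof -
  \<comment> \<open>For r > 1 the single term (s r^2)^m / m! of the exponential series gives decay
    r^(-2m), and m >= -c makes this at most r^c.\<close>
  obtain m :: nat where m: "- c \<le> real m" using real_arch_simple by blast
  have "exp (- s * r\<^sup>2) \<le> (1 + fact m / s ^ m) * r powr c" if r: "r > 0" for r :: real
  proof (cases "r \<le> 1")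
    case True
    have "exp (- s * r\<^sup>2) \<le> 1" using assms by simp
    also have "1 \<le> r powr c" using powr_mono'[of c 0 r] True r assms by simp
    also have "\<dots> \<le> (1 + fact m / s ^ m) * r powr c"
      using assms by (simp add: distrib_right)
    finally show ?thesis .
  next
    case False
    have "(s * r\<^sup>2) ^ m / fact m \<le> exp (s * r\<^sup>2)"
    proof -
      have "(\<Sum>k\<in>{m}. (s * r\<^sup>2) ^ k /\<^sub>R fact k) \<le> (\<Sum>k. (s * r\<^sup>2) ^ k /\<^sub>R fact k)"
        using assms summable_exp_generic[of "s * r\<^sup>2"] by (intro sum_le_suminf) auto
      then show ?thesis unfolding exp_def by (simp add: divide_inverse mult.commute)
    qed
    then have "exp (- s * r\<^sup>2) \<le> fact m / (s * r\<^sup>2) ^ m"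
      using assms r by (simp add: exp_minus field_simps)
    also have "\<dots> = fact m / s ^ m * r powr (- real (2 * m))"
    proof -
      have "r powr (- real (2 * m)) = inverse (r ^ (2 * m))" by (simp only: powr_minus powr_realpow[OF r])
      then show ?thesis by (simp only: power_mult_distrib power_mult divide_inverse inverse_mult_distrib mult.assoc)
    qed
    also have "\<dots> \<le> fact m / s ^ m * r powr c"
      using False m assms by (intro mult_left_mono powr_mono) auto
    also have "\<dots> \<le> (1 + fact m / s ^ m) * r powr c" by (simp add: distrib_right)
    finally show ?thesis .
  qed
  then show ?thesis using assms by (intro exI[of _ "1 + fact m / s ^ m"]) auto
qed

lemma gaussian_derivative:
  "((\<lambda>t. exp (- s * (norm (x + t *\<^sub>R e))\<^sup>2)) has_vector_derivative
     (x \<bullet> e) * ((- 2 * s) * exp (- s * (norm x)\<^sup>2))) (at 0)"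
  using DERIV_chain2[OF DERIV_exp DERIV_cmult[OF norm_square_directional_derivative, of "- s"]]
  by (simp add: has_real_derivative_iff_has_vector_derivative ac_simps)

lemma symbol_class_gaussian:
  assumes "s > 0"
  shows "p \<le> 0 \<Longrightarrow> q \<le> 0 \<Longrightarrow> symbol_class e k p q (\<lambda>x. exp (- s * (norm x)\<^sup>2))"
proof (induction k arbitrary: p q)
  case 0
  obtain C D where CD: "C \<ge> 0" "D \<ge> 0" "\<And>r. r > 0 \<Longrightarrow> exp (- s * r\<^sup>2) \<le> C * r powr p" "\<And>r. r > 0 \<Longrightarrow> exp (- s * r\<^sup>2) \<le> D * r powr q"
    using exp_minus_le_powr[OF assms 0(1)] exp_minus_le_powr[OF assms 0(2)] by blast
  have "norm (exp (- s * (norm x)\<^sup>2)) \<le> (C + D) * norm x powr p \<and> norm (exp (- s * (norm x)\<^sup>2)) \<le> (C + D) * norm x powr q"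
    if "x \<noteq> 0" for x :: 'a
    using CD(3)[of "norm x"] CD(4)[of "norm x"] that CD(1,2) by (auto simp: distrib_right intro: add_increasing add_increasing2)
  then show ?case by (auto intro!: continuous_intros)
next
  case (Suc k)
  \<comment> \<open>The factor \<open>x \<bullet> e\<close> raises both orders by 1, so the
    induction hypothesis is used with the orders lowered by 2 in order to land at p - 1 and q - 1.
    It admits all nonpositive orders.\<close>
  have "symbol_class e k (1 + (0 + (p - 2))) (1 + (0 + (q - 2))) (\<lambda>x. (x \<bullet> e) *\<^sub>R ((- 2 * s) *\<^sub>R exp (- s * (norm x)\<^sup>2)))"
    using Suc by (intro symbol_class_scaleR symbol_class_inner symbol_class_const) auto
  then have "symbol_class e k (p - 1) (q - 1) (\<lambda>x. (x \<bullet> e) * ((- 2 * s) * exp (- s * (norm x)\<^sup>2)))" by simp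
  moreover have "symbol_class e 0 p q (\<lambda>x. exp (- s * (norm x)\<^sup>2))"
    by (rule symbol_class_0[OF Suc.IH]) (use Suc.prems in auto)
  ultimately show ?case
    using gaussian_derivative[of s _ e]
    by (auto simp del: symbol_class.simps(1) intro!: exI[of _ "\<lambda>x. (x \<bullet> e) * ((- 2 * s) * exp (- s * (norm x)\<^sup>2))"])
qed

text \<open>The two terms are the unit Gaussian at xi/2 and at xi. On the other side of the Fourier
  transform this is a Gaussian dilated by 2 minus the Gaussian itself, that is, one telescoping
  step. The equal values at 0 leave a quadratic zero.\<close>

definition gauss_diff :: "'a::euclidean_space \<Rightarrow> real" where
  "gauss_diff x = exp (- (1/8) * (norm x)\<^sup>2) - exp (- (1/2) * (norm x)\<^sup>2)"

text \<open>Only the undifferentiated function needs the cancellation between the two Gaussians. Its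
  derivative is \<open>x \<bullet> e\<close> times a combination of Gaussians, and this factor
  already gives the order 1, so the combination can be estimated term by term.\<close>

lemma symbol_class_gauss_diff:
  assumes "q \<le> 0"
  shows "symbol_class e k 2 q gauss_diff"
proof -
  have 0: "symbol_class e 0 2 q gauss_diff"
  proof -
    obtain C where C: "C \<ge> 0" "\<And>r. r > 0 \<Longrightarrow> exp (- (1/8) * r\<^sup>2) \<le> C * r powr q"
      using exp_minus_le_powr[of "1/8" q] assms by auto
    have "norm (gauss_diff x) \<le> (1 + C) * norm x powr 2 \<and> norm (gauss_diff x) \<le> (1 + C) * norm x powr q"
      if x: "x \<noteq> 0" for x :: 'a
    proof -
      have mono: "exp (- (1/2) * (norm x)\<^sup>2) \<le> exp (- (1/8) * (norm x)\<^sup>2)" by simp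
      \<comment> \<open>1 - t <= exp(-t) with t = |x|^2/2 bounds the subtracted term from below,
        while the other one is at most 1.\<close>
      have "1 - (1/2) * (norm x)\<^sup>2 \<le> exp (- (1/2) * (norm x)\<^sup>2)"
        using exp_ge_add_one_self[of "- (1/2) * (norm x)\<^sup>2"] by linarith
      moreover have "exp (- (1/8) * (norm x)\<^sup>2) \<le> 1" by simp
      moreover have "(norm x)\<^sup>2 \<ge> 0" by simp
      ultimately have "norm (gauss_diff x) \<le> (norm x)\<^sup>2"
        using mono unfolding gauss_diff_def real_norm_def by linarith
      then have 1: "norm (gauss_diff x) \<le> norm x powr 2" using x by simp
      have 2: "norm (gauss_diff x) \<le> C * norm x powr q"
        using mono C(2)[of "norm x", OF zero_less_norm_iff[THEN iffD2, OF x]] exp_ge_zero[of "- (1/2) * (norm x)\<^sup>2"]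
        unfolding gauss_diff_def real_norm_def by linarith
      have "0 \<le> C * norm x powr 2" "0 \<le> norm x powr q" using C by auto
      then show ?thesis using 1 2 unfolding distrib_right mult_1 by linarith
    qed
    then show ?thesis unfolding gauss_diff_def[abs_def] by (auto intro!: continuous_intros)
  qed
  show ?thesis
  proof (cases k)
    case (Suc k)
    define g where "g = (\<lambda>x::'a. (- 2 * (1/8)) *\<^sub>R exp (- (1/8) * (norm x)\<^sup>2) + (2 * (1/2)) *\<^sub>R exp (- (1/2) * (norm x)\<^sup>2))"
    have "symbol_class e k (0 + 0) (0 + (q - 2)) g"
      unfolding g_def using assms
      by (intro symbol_class_add symbol_class_scaleR symbol_class_const symbol_class_gaussian) auto
    then have "symbol_class e k (1 + (0 + 0)) (1 + (0 + (q - 2))) (\<lambda>x. (x \<bullet> e) *\<^sub>R g x)"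
      by (intro symbol_class_scaleR symbol_class_inner)
    moreover have "((\<lambda>t. gauss_diff (x + t *\<^sub>R e)) has_vector_derivative (x \<bullet> e) *\<^sub>R g x) (at 0)" for x
      using has_vector_derivative_diff[OF gaussian_derivative[of "1/8" x e] gaussian_derivative[of "1/2" x e]]
      unfolding gauss_diff_def g_def by (simp add: algebra_simps)
    ultimately show ?thesis unfolding Suc using 0
      by (auto simp del: symbol_class.simps(1) intro!: exI[of _ "\<lambda>x. (x \<bullet> e) *\<^sub>R g x"])
  qed (use 0 in simp)
qed

section \<open>Ellipticity and the equation B(xi) g(xi) = f(xi)\<close>

lemma symbol_eq:
  "symbol (B :: ('n::finite, 'v::euclidean_space, 'w::euclidean_space) operator) \<xi> v =
    (\<Sum>\<beta> | mi_order \<beta> = CARD('n). monomial \<beta> \<xi> *\<^sub>R blinfun_apply (B \<beta>) v)"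
  by (simp add: symbol_def monomial_def)

lemma linear_symbol: "linear (symbol B \<xi>)"
  by (rule linearI) (auto simp: symbol_eq blinfun.bilinear_simps scaleR_add_right sum.distrib scaleR_sum_right
      intro!: sum.cong)

lemma monomial_scaleR: "monomial \<beta> (t *\<^sub>R \<xi>) = t ^ mi_order \<beta> * monomial \<beta> \<xi>"
  by (simp add: monomial_def mi_order_def power_mult_distrib prod.distrib power_sum)

lemma symbol_scaleR:
  "symbol (B :: ('n::finite, 'v::euclidean_space, 'w::euclidean_space) operator) (t *\<^sub>R \<xi>) v = t ^ CARD('n) *\<^sub>R symbol B \<xi> v"
  by (auto simp: symbol_eq monomial_scaleR scaleR_sum_right intro!: sum.cong)

lemma continuous_on_monomial [continuous_intros]:
  "continuous_on S f \<Longrightarrow> continuous_on S (\<lambda>x. monomial \<beta> (f x))"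
  unfolding monomial_def by (intro continuous_intros)

lemma continuous_on_symbol [continuous_intros]:
  "continuous_on S f \<Longrightarrow> continuous_on S g \<Longrightarrow> continuous_on S (\<lambda>x. symbol B (f x) (g x))"
  unfolding symbol_eq by (intro continuous_intros bounded_linear.continuous_on[OF blinfun.bounded_linear_right])

text \<open>The continuous function |B(xi) v| attains a positive minimum on the product of the two
  unit spheres. Homogeneity of degree n in xi and linearity in v extend the bound to all
  arguments.\<close>

lemma elliptic_lower_bound:
  fixes B :: "('n::finite, 'v::euclidean_space, 'w::euclidean_space) operator"
  assumes "elliptic B"
  shows "\<exists>c>0. \<forall>\<xi> v. c * norm \<xi> ^ CARD('n) * norm v \<le> norm (symbol B \<xi> v)"
proof -
  let ?S = "sphere (0 :: real ^ 'n) 1 \<times> sphere (0 :: 'v) 1"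
  obtain i :: 'n where True by simp
  obtain b :: 'v where "b \<in> Basis" using nonempty_Basis by blast
  then have ne: "(axis i 1, b) \<in> ?S" by simp
  have "compact ?S" by (intro compact_Times compact_sphere)
  moreover have "continuous_on ?S (\<lambda>z. norm (symbol B (fst z) (snd z)))" by (intro continuous_intros)
  ultimately obtain z where z: "z \<in> ?S" "\<And>y. y \<in> ?S \<Longrightarrow> norm (symbol B (fst z) (snd z)) \<le> norm (symbol B (fst y) (snd y))"
    using continuous_attains_inf[of ?S "\<lambda>z. norm (symbol B (fst z) (snd z))"] ne by blast
  define c where "c = norm (symbol B (fst z) (snd z))"
  have "fst z \<noteq> 0" "snd z \<noteq> 0" using z(1) by auto
  then have "symbol B (fst z) (snd z) \<noteq> 0" using assms by (auto simp: elliptic_def)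
  then have "c > 0" by (simp add: c_def)
  moreover have "c * norm \<xi> ^ CARD('n) * norm v \<le> norm (symbol B \<xi> v)" for \<xi> v
  proof (cases "\<xi> = 0 \<or> v = 0")
    case True
    then show ?thesis by (auto simp: zero_power[OF zero_less_card_finite])
  next
    case False
    let ?\<xi> = "inverse (norm \<xi>) *\<^sub>R \<xi>" and ?v = "inverse (norm v) *\<^sub>R v"
    have "c \<le> norm (symbol B ?\<xi> ?v)" using z(2)[of "(?\<xi>, ?v)"] False by (simp add: c_def)
    also have "symbol B ?\<xi> ?v = (inverse (norm \<xi>) ^ CARD('n) * inverse (norm v)) *\<^sub>R symbol B \<xi> v"
      by (simp add: symbol_scaleR linear_scale[OF linear_symbol])
    finally show ?thesis using False by (simp add: field_simps power_inverse)
  qed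
  ultimately show ?thesis by blast
qed

text \<open>Differentiating \<open>B(\<xi>) g(\<xi>) = f(\<xi>)\<close> along \<open>e\<close> shows that the derivative of \<open>g\<close> solves an equation
  of the same kind, so that no derivative of \<open>B\<^sup>\<dagger>\<close> is needed.\<close>

lemma symbol_class_solve:
  fixes B :: "('n::finite, 'v::euclidean_space, 'w::euclidean_space) operator"
  assumes B: "elliptic B"
  shows "symbol_class e k p q f \<Longrightarrow> (\<And>\<xi>. \<xi> \<noteq> 0 \<Longrightarrow> symbol B \<xi> (g \<xi>) = f \<xi>) \<Longrightarrow>
    symbol_class e k (p - CARD('n)) (q - CARD('n)) g"
proof (induction k arbitrary: p q f g)
  case 0
  obtain c where c: "c > 0" "\<And>\<xi> v. c * norm \<xi> ^ CARD('n) * norm v \<le> norm (symbol B \<xi> v)"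
    using elliptic_lower_bound[OF B] by blast
  obtain C where C: "C \<ge> 0" "\<And>x. x \<noteq> 0 \<Longrightarrow> norm (f x) \<le> C * norm x powr p" "\<And>x. x \<noteq> 0 \<Longrightarrow> norm (f x) \<le> C * norm x powr q"
    by (rule symbol_class_bound[OF 0(1)]) blast
  have "norm (g \<xi>) \<le> (C / c) * norm \<xi> powr (a - CARD('n))" if "\<xi> \<noteq> 0" "norm (f \<xi>) \<le> C * norm \<xi> powr a" for \<xi> a
  proof -
    have "c * norm \<xi> ^ CARD('n) * norm (g \<xi>) \<le> C * norm \<xi> powr a"
      using c(2)[of \<xi> "g \<xi>"] 0(2)[OF that(1)] that(2) by simp
    then show ?thesis using that(1) c(1) by (simp add: powr_diff powr_realpow field_simps)
  qed
  moreover have "isCont g \<xi>" if \<xi>: "\<xi> \<noteq> 0" for \<xi>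
  proof -
    have fc: "isCont f \<xi>"
      using symbol_class_continuous[OF 0(1)] \<xi> by (simp add: continuous_on_eq_continuous_at open_Compl)
    have "continuous_on UNIV (\<lambda>\<eta>. symbol B \<eta> (g \<xi>))" by (intro continuous_intros)
    then have sc: "isCont (\<lambda>\<eta>. symbol B \<eta> (g \<xi>)) \<xi>" by (simp add: continuous_on_eq_continuous_at)
    have "((\<lambda>\<eta>. norm (f \<eta> - symbol B \<eta> (g \<xi>)) / (c * norm \<eta> ^ CARD('n))) \<longlongrightarrow>
        norm (f \<xi> - symbol B \<xi> (g \<xi>)) / (c * norm \<xi> ^ CARD('n))) (at \<xi>)"
      using c(1) \<xi> fc sc by (intro tendsto_intros) (auto simp: isCont_def)
    then have "((\<lambda>\<eta>. norm (f \<eta> - symbol B \<eta> (g \<xi>)) / (c * norm \<eta> ^ CARD('n))) \<longlongrightarrow> 0) (at \<xi>)"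
      using 0(2)[OF \<xi>] by simp
    \<comment> \<open>The lower bound is applied to the increment, using B(eta)(g(eta) - g(xi)) =
      f(eta) - B(eta) g(xi). The right side is continuous in eta and vanishes at eta = xi.\<close>
    moreover have "\<forall>\<^sub>F \<eta> in at \<xi>. norm (g \<eta> - g \<xi>) \<le> norm (f \<eta> - symbol B \<eta> (g \<xi>)) / (c * norm \<eta> ^ CARD('n))"
    proof -
      have "\<forall>\<^sub>F \<eta> in at \<xi>. \<eta> \<noteq> 0" using \<xi> by (intro eventually_neq_at_within)
      then show ?thesis
      proof eventually_elim
        case (elim \<eta>)
        have "c * norm \<eta> ^ CARD('n) * norm (g \<eta> - g \<xi>) \<le> norm (f \<eta> - symbol B \<eta> (g \<xi>))"
          using c(2)[of \<eta> "g \<eta> - g \<xi>"] 0(2)[OF elim] by (simp add: linear_diff[OF linear_symbol])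
        then show ?case using c(1) elim by (simp add: field_simps)
      qed
    qed
    ultimately have "((\<lambda>\<eta>. g \<eta> - g \<xi>) \<longlongrightarrow> 0) (at \<xi>)" by (rule Lim_null_comparison[rotated])
    then show ?thesis by (simp add: isCont_def LIM_zero_iff)
  qed
  ultimately show ?case
    using C(2,3) by (auto simp: continuous_on_eq_continuous_at open_Compl intro!: exI[of _ "C / c"])
next
  case (Suc k)
  obtain c where c: "c > 0" "\<And>\<xi> v. c * norm \<xi> ^ CARD('n) * norm v \<le> norm (symbol B \<xi> v)"
    using elliptic_lower_bound[OF B] by blast
  obtain f' where f': "\<And>x. x \<noteq> 0 \<Longrightarrow> ((\<lambda>t. f (x + t *\<^sub>R e)) has_vector_derivative f' x) (at 0)"
    "symbol_class e k (p - 1) (q - 1) f'"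
    using Suc.prems(1) by (auto simp del: symbol_class.simps(1))
  have "\<exists>h. (\<forall>x. x \<noteq> 0 \<longrightarrow> ((\<lambda>t. monomial \<beta> (x + t *\<^sub>R e)) has_vector_derivative h x) (at 0)) \<and>
      symbol_class e k (real (mi_order \<beta>) - 1) (real (mi_order \<beta>) - 1) h" for \<beta> :: "'n multi_index"
    using symbol_class_monomial[of e "Suc k" \<beta>] by (auto simp del: symbol_class.simps(1))
  then obtain M where M: "\<And>\<beta> x. x \<noteq> 0 \<Longrightarrow> ((\<lambda>t. monomial \<beta> (x + t *\<^sub>R e)) has_vector_derivative M \<beta> x) (at 0)"
    "\<And>\<beta>. symbol_class e k (real (mi_order \<beta>) - 1) (real (mi_order \<beta>) - 1) (M \<beta>)" by metis
  have g: "symbol_class e k (p - CARD('n)) (q - CARD('n)) g"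
    using Suc.IH[OF symbol_class_SucD[OF Suc.prems(1)] Suc.prems(2)] by blast
  \<comment> \<open>The right side of the differentiated equation: B(xi) g' = f' - (derivative of B
    along e) g. The coefficients \<open>M \<beta>\<close> have order n - 1 and \<open>g\<close> has
    order p - n, so \<open>R\<close> has order p - 1, as \<open>f'\<close> does.\<close>
  define R where "R \<xi> = f' \<xi> - (\<Sum>\<beta> | mi_order \<beta> = CARD('n). M \<beta> \<xi> *\<^sub>R blinfun_apply (B \<beta>) (g \<xi>))" for \<xi>
  have R: "symbol_class e k (p - 1) (q - 1) R"
  proof -
    have "symbol_class e k (p - 1) (q - 1) (\<lambda>\<xi>. M \<beta> \<xi> *\<^sub>R blinfun_apply (B \<beta>) (g \<xi>))"
      if "mi_order \<beta> = CARD('n)" for \<beta>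
      using symbol_class_scaleR[OF M(2)[of \<beta>] symbol_class_linear[OF blinfun.bounded_linear_right g]] that
      by (simp add: algebra_simps)
    then have "symbol_class e k (p - 1) (q - 1) (\<lambda>\<xi>. f' \<xi> + (-1) *\<^sub>R (\<Sum>\<beta> | mi_order \<beta> = CARD('n). M \<beta> \<xi> *\<^sub>R blinfun_apply (B \<beta>) (g \<xi>)))"
      by (intro symbol_class_add f'(2) symbol_class_linear[OF bounded_linear_scaleR_right] symbol_class_sum) auto
    then show ?thesis by (simp add: R_def[abs_def])
  qed
  have "\<exists>d. symbol B \<xi> d = R \<xi> \<and> ((\<lambda>t. g (\<xi> + t *\<^sub>R e)) has_vector_derivative d) (at 0)" if \<xi>: "\<xi> \<noteq> 0" for \<xi>
  proof -
    let ?Q = "\<lambda>t. inverse t *\<^sub>R (g (\<xi> + t *\<^sub>R e) - g (\<xi> + 0 *\<^sub>R e))"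
    have "((\<lambda>t. \<xi> + t *\<^sub>R e) \<longlongrightarrow> \<xi> + 0 *\<^sub>R e) (at (0::real))" by (intro tendsto_intros)
    then have line: "((\<lambda>t. \<xi> + t *\<^sub>R e) \<longlongrightarrow> \<xi>) (at (0::real))" by simp
    have "isCont g \<xi>"
      using symbol_class_continuous[OF g] \<xi> by (simp add: continuous_on_eq_continuous_at open_Compl)
    then have gl: "((\<lambda>t. g (\<xi> + t *\<^sub>R e)) \<longlongrightarrow> g \<xi>) (at (0::real))" using line by (rule isCont_tendsto_compose)
    have ev: "\<forall>\<^sub>F t in at (0::real). \<xi> + t *\<^sub>R e \<noteq> 0" using line \<xi> by (rule tendsto_imp_eventually_ne)
    have lim: "((\<lambda>t. inverse t *\<^sub>R (f (\<xi> + t *\<^sub>R e) - f (\<xi> + 0 *\<^sub>R e)) -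
        (\<Sum>\<beta> | mi_order \<beta> = CARD('n). (inverse t *\<^sub>R (monomial \<beta> (\<xi> + t *\<^sub>R e) - monomial \<beta> (\<xi> + 0 *\<^sub>R e))) *\<^sub>R
          blinfun_apply (B \<beta>) (g (\<xi> + t *\<^sub>R e)))) \<longlongrightarrow> R \<xi>) (at 0)"
      unfolding R_def
      by (intro tendsto_intros gl f'(1)[OF \<xi>, unfolded has_vector_derivative_at_0_iff]
          M(1)[OF \<xi>, unfolded has_vector_derivative_at_0_iff])
    \<comment> \<open>The discrete product rule: B(xi) applied to the quotient of \<open>g\<close>
      equals the quotient of \<open>f\<close> minus the quotients of the monomials applied to the
      shifted \<open>g\<close>. It converges by continuity of \<open>g\<close> alone, before
      \<open>g\<close> is known to be differentiable.\<close>
    have BQ: "((\<lambda>t. symbol B \<xi> (?Q t)) \<longlongrightarrow> R \<xi>) (at 0)"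
    proof (rule Lim_transform_eventually[OF lim])
      show "\<forall>\<^sub>F t in at 0. inverse t *\<^sub>R (f (\<xi> + t *\<^sub>R e) - f (\<xi> + 0 *\<^sub>R e)) -
        (\<Sum>\<beta> | mi_order \<beta> = CARD('n). (inverse t *\<^sub>R (monomial \<beta> (\<xi> + t *\<^sub>R e) - monomial \<beta> (\<xi> + 0 *\<^sub>R e))) *\<^sub>R
          blinfun_apply (B \<beta>) (g (\<xi> + t *\<^sub>R e))) = symbol B \<xi> (?Q t)"
        using ev
      proof eventually_elim
        case (elim t)
        have "(\<Sum>\<beta> | mi_order \<beta> = CARD('n). (inverse t *\<^sub>R (monomial \<beta> (\<xi> + t *\<^sub>R e) - monomial \<beta> (\<xi> + 0 *\<^sub>R e))) *\<^sub>R
          blinfun_apply (B \<beta>) (g (\<xi> + t *\<^sub>R e))) =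
          inverse t *\<^sub>R (symbol B (\<xi> + t *\<^sub>R e) (g (\<xi> + t *\<^sub>R e)) - symbol B \<xi> (g (\<xi> + t *\<^sub>R e)))"
          by (simp add: symbol_eq sum_subtractf[symmetric] scaleR_sum_right scaleR_diff_left[symmetric])
        then show ?case using Suc.prems(2)[OF elim] Suc.prems(2)[OF \<xi>]
          by (simp add: linear_diff[OF linear_symbol] linear_scale[OF linear_symbol] scaleR_diff_right)
      qed
    qed
    \<comment> \<open>The limit stays in the range of B(xi), a closed subspace, so it is B(xi) d for
      some d. The lower bound then carries the convergence over to the quotients of \<open>g\<close>
      themselves.\<close>
    have "closed (range (symbol B \<xi>))"
      by (intro closed_subspace linear_subspace_image linear_symbol subspace_UNIV)
    then have "R \<xi> \<in> range (symbol B \<xi>)"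
      by (rule Lim_in_closed_set[OF _ _ _ BQ]) auto
    then obtain d where d: "symbol B \<xi> d = R \<xi>" by force
    have n0: "c * norm \<xi> ^ CARD('n) > 0" using c(1) \<xi> by simp
    have "((\<lambda>t. ?Q t - d) \<longlongrightarrow> 0) (at 0)"
    proof (rule Lim_null_comparison)
      show "\<forall>\<^sub>F t in at 0. norm (?Q t - d) \<le> norm (symbol B \<xi> (?Q t) - R \<xi>) / (c * norm \<xi> ^ CARD('n))"
        using c(2)[of \<xi> "?Q _ - d"] n0
        by (intro always_eventually allI) (simp add: linear_diff[OF linear_symbol] d pos_le_divide_eq mult.commute)
      have "((\<lambda>t. norm (symbol B \<xi> (?Q t) - R \<xi>) / (c * norm \<xi> ^ CARD('n))) \<longlongrightarrow>
          norm (R \<xi> - R \<xi>) / (c * norm \<xi> ^ CARD('n))) (at 0)"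
        by (intro tendsto_divide tendsto_norm tendsto_diff BQ tendsto_const less_imp_neq[OF n0, symmetric])
      then show "((\<lambda>t. norm (symbol B \<xi> (?Q t) - R \<xi>) / (c * norm \<xi> ^ CARD('n))) \<longlongrightarrow> 0) (at 0)"
        by simp
    qed
    then have "(?Q \<longlongrightarrow> d) (at 0)" by (simp only: LIM_zero_iff)
    then show ?thesis using d has_vector_derivative_at_0_iff[of "\<lambda>t. g (\<xi> + t *\<^sub>R e)" d] by auto
  qed
  then obtain g' where g': "\<And>\<xi>. \<xi> \<noteq> 0 \<Longrightarrow> symbol B \<xi> (g' \<xi>) = R \<xi>"
    "\<And>\<xi>. \<xi> \<noteq> 0 \<Longrightarrow> ((\<lambda>t. g (\<xi> + t *\<^sub>R e)) has_vector_derivative g' \<xi>) (at 0)" by metis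
  have "symbol_class e k (p - CARD('n) - 1) (q - CARD('n) - 1) g'"
    using Suc.IH[OF R g'(1)] by (simp add: algebra_simps)
  then show ?case using symbol_class_0[OF g] g'(2) by (auto simp del: symbol_class.simps(1))
qed

section \<open>Oscillatory integrals and their decay\<close>

definition osc :: "real \<Rightarrow> ('a::euclidean_space \<Rightarrow> 'b::euclidean_space) \<Rightarrow> 'a \<Rightarrow> 'b" where
  "osc l f x = (LINT \<xi>|lborel. cosine_shift l (\<xi> \<bullet> x) *\<^sub>R f \<xi>)"

lemma symbol_class_integrable:
  fixes f :: "'a::euclidean_space \<Rightarrow> 'b::euclidean_space"
  assumes f: "symbol_class e k p q f" and "p > - real DIM('a)" "q \<le> - 2 * real DIM('a)"
  shows "integrable lborel f"
proof -
  obtain C where "\<And>x. x \<noteq> 0 \<Longrightarrow> norm (f x) \<le> C * norm x powr p" "\<And>x. x \<noteq> 0 \<Longrightarrow> norm (f x) \<le> C * norm x powr q"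
    by (rule symbol_class_bound[OF f]) blast
  then show ?thesis by (rule integrable_powr_bounds[OF symbol_class_measurable[OF f]]) (use assms in auto)
qed

lemma osc_integrable:
  fixes f :: "'a::euclidean_space \<Rightarrow> 'b::euclidean_space"
  assumes f: "integrable lborel f"
  shows "integrable lborel (\<lambda>\<xi>. cosine_shift l (\<xi> \<bullet> x) *\<^sub>R f \<xi>)"
proof (rule Bochner_Integration.integrable_bound[OF f])
  have "(\<lambda>\<xi>. cosine_shift l (\<xi> \<bullet> x)) \<in> borel_measurable lborel"
    by (rule measurable_compose[OF _ cosine_shift_measurable]) simp
  then show "(\<lambda>\<xi>. cosine_shift l (\<xi> \<bullet> x) *\<^sub>R f \<xi>) \<in> borel_measurable lborel"
    using borel_measurable_integrable[OF f] by (rule borel_measurable_scaleR)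
qed (simp add: cosine_shift_bound mult_left_le_one_le)

lemma osc_bound:
  assumes "integrable lborel f"
  shows "norm (osc l f x) \<le> (LINT \<xi>|lborel. norm (f \<xi>))"
proof -
  have "norm (osc l f x) \<le> (LINT \<xi>|lborel. norm (cosine_shift l (\<xi> \<bullet> x) *\<^sub>R f \<xi>))"
    unfolding osc_def by (rule integral_norm_bound)
  also have "\<dots> \<le> (LINT \<xi>|lborel. norm (f \<xi>))"
    by (rule integral_mono[OF integrable_norm[OF osc_integrable[OF assms]] integrable_norm[OF assms]])
       (simp add: cosine_shift_bound mult_left_le_one_le)
  finally show ?thesis .
qed

text \<open>Each factor \<open>x \<bullet> e\<close> is traded for one derivative of
  \<open>f\<close> along \<open>e\<close>, and the phase \<open>l\<close> moves by one; the
  induction therefore needs a bound uniform in \<open>l\<close>. The condition on \<open>p\<close>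
  keeps the singularity integrable through all \<open>k\<close> steps.\<close>

lemma osc_decay_direction:
  fixes f :: "'a::euclidean_space \<Rightarrow> 'b::euclidean_space"
  assumes e: "norm e = 1"
  shows "symbol_class e k p q f \<Longrightarrow> p - real k > - real DIM('a) \<Longrightarrow> q \<le> - 2 * real DIM('a) \<Longrightarrow>
    \<exists>C. \<forall>l x. \<bar>x \<bullet> e\<bar> ^ k * norm (osc l f x) \<le> C"
proof (induction k arbitrary: p q f)
  case 0
  then have "integrable lborel f" by (intro symbol_class_integrable[OF 0(1)]) auto
  then show ?case using osc_bound by auto
next
  case (Suc k)
  obtain g where d: "\<And>x. x \<noteq> 0 \<Longrightarrow> ((\<lambda>t. f (x + t *\<^sub>R e)) has_vector_derivative g x) (at 0)"
    and g: "symbol_class e k (p - 1) (q - 1) g"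
    using Suc.prems(1) by (auto simp del: symbol_class.simps(1))
  note f = Suc.prems(1)
  have fi: "integrable lborel f" using Suc.prems by (intro symbol_class_integrable[OF f]) auto
  have gi: "integrable lborel g" using Suc.prems by (intro symbol_class_integrable[OF g]) auto
  obtain C where C: "C \<ge> 0" "\<And>x. x \<noteq> 0 \<Longrightarrow> norm (f x) \<le> C * norm x powr p" "\<And>x. x \<noteq> 0 \<Longrightarrow> norm (f x) \<le> C * norm x powr q"
    by (rule symbol_class_bound[OF f]) blast
  obtain D where D: "D \<ge> 0" "\<And>x. x \<noteq> 0 \<Longrightarrow> norm (g x) \<le> D * norm x powr (p - 1)" "\<And>x. x \<noteq> 0 \<Longrightarrow> norm (g x) \<le> D * norm x powr (q - 1)"
    by (rule symbol_class_bound[OF g]) blast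
  \<comment> \<open>The wave with phase \<open>l - 1\<close> is integrated by parts because its
    derivative has phase \<open>l\<close>.\<close>
  have ibp: "(x \<bullet> e) *\<^sub>R osc l f x = - osc (l - 1) g x" for l x
  proof -
    let ?F = "\<lambda>\<xi>. cosine_shift (l - 1) (\<xi> \<bullet> x) *\<^sub>R f \<xi>"
    let ?G = "\<lambda>\<xi>. cosine_shift (l - 1) (\<xi> \<bullet> x) *\<^sub>R g \<xi> + (x \<bullet> e) *\<^sub>R (cosine_shift l (\<xi> \<bullet> x) *\<^sub>R f \<xi>)"
    let ?C = "C + D + \<bar>x \<bullet> e\<bar> * C"
    have Fle: "norm (?F \<xi>) \<le> norm (f \<xi>)" for \<xi> by (simp add: cosine_shift_bound mult_left_le_one_le)
    have Gle: "norm (?G \<xi>) \<le> norm (g \<xi>) + \<bar>x \<bullet> e\<bar> * norm (f \<xi>)" for \<xi>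
    proof (rule norm_triangle_mono)
      show "norm (cosine_shift (l - 1) (\<xi> \<bullet> x) *\<^sub>R g \<xi>) \<le> norm (g \<xi>)"
        by (simp add: cosine_shift_bound mult_left_le_one_le)
      have "norm (cosine_shift l (\<xi> \<bullet> x) *\<^sub>R f \<xi>) \<le> norm (f \<xi>)"
        by (simp add: cosine_shift_bound mult_left_le_one_le)
      then show "norm ((x \<bullet> e) *\<^sub>R (cosine_shift l (\<xi> \<bullet> x) *\<^sub>R f \<xi>)) \<le> \<bar>x \<bullet> e\<bar> * norm (f \<xi>)"
        by (subst norm_scaleR) (rule mult_left_mono, auto)
    qed
    have CD: "C \<le> ?C" "D + \<bar>x \<bullet> e\<bar> * C \<le> ?C" using C(1) D(1) by auto
    have "(LINT \<xi>|lborel. ?G \<xi>) = 0"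
    proof (rule integral_directional_derivative_singular_eq_0[where f="?F" and C="?C" and p=p and q=q, OF e])
      show "continuous_on (- {0}) ?F" "continuous_on (- {0}) ?G"
        by (intro continuous_intros symbol_class_continuous[OF f] symbol_class_continuous[OF g])+
      fix \<xi> :: 'a assume \<xi>: "\<xi> \<noteq> 0"
      show "((\<lambda>t. ?F (\<xi> + t *\<^sub>R e)) has_vector_derivative ?G \<xi>) (at 0)"
        using has_vector_derivative_scaleR[OF plane_wave_derivative[of "l - 1" 1 \<xi> e x, folded has_real_derivative_iff_has_vector_derivative] d[OF \<xi>]]
        by (simp add: inner_commute)
      have m: "N \<le> ?C * norm \<xi> powr a" if "N \<le> K * norm \<xi> powr a" "K \<le> ?C" for N K a
        using that(1) mult_right_mono[OF that(2), of "norm \<xi> powr a"] by auto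
      show "norm (?F \<xi>) \<le> ?C * norm \<xi> powr p" "norm (?F \<xi>) \<le> ?C * norm \<xi> powr q"
        using order_trans[OF Fle] C(2,3)[OF \<xi>] by (auto intro!: m[OF _ CD(1)])
      have fp1: "norm (f \<xi>) \<le> C * norm \<xi> powr (p - 1)"
        by (rule powr_interpolate[OF C(2,3)[OF \<xi>]]) (use Suc.prems \<xi> C in auto)
      have gq: "norm (g \<xi>) \<le> D * norm \<xi> powr q"
        by (rule powr_interpolate[OF D(2,3)[OF \<xi>]]) (use Suc.prems \<xi> D in auto)
      have "norm (?G \<xi>) \<le> (D + \<bar>x \<bullet> e\<bar> * C) * norm \<xi> powr a"
        if "norm (f \<xi>) \<le> C * norm \<xi> powr a" "norm (g \<xi>) \<le> D * norm \<xi> powr a" for a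
        using Gle[of \<xi>] that(2) mult_left_mono[OF that(1), of "\<bar>x \<bullet> e\<bar>"] by (simp add: distrib_right mult.assoc)
      then show "norm (?G \<xi>) \<le> ?C * norm \<xi> powr (p - 1)" "norm (?G \<xi>) \<le> ?C * norm \<xi> powr q"
        using fp1 gq D(2)[OF \<xi>] C(3)[OF \<xi>] by (auto intro!: m[OF _ CD(2)])
    qed (use Suc.prems in auto)
    moreover have "(LINT \<xi>|lborel. ?G \<xi>) = osc (l - 1) g x + (x \<bullet> e) *\<^sub>R osc l f x"
    proof -
      have "integrable lborel (\<lambda>\<xi>. (x \<bullet> e) *\<^sub>R (cosine_shift l (\<xi> \<bullet> x) *\<^sub>R f \<xi>))"
        by (rule integrable_scaleR_right) (rule osc_integrable[OF fi])
      then show ?thesis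
        unfolding osc_def integral_scaleR_right[symmetric]
        by (rule Bochner_Integration.integral_add[OF osc_integrable[OF gi]])
    qed
    ultimately show ?thesis by (simp add: eq_neg_iff_add_eq_0 add.commute)
  qed
  obtain C' where C': "\<And>l x. \<bar>x \<bullet> e\<bar> ^ k * norm (osc l g x) \<le> C'"
    using Suc.IH[OF g] Suc.prems by force
  have "\<bar>x \<bullet> e\<bar> ^ Suc k * norm (osc l f x) \<le> C'" for l x
  proof -
    have "\<bar>x \<bullet> e\<bar> * norm (osc l f x) = norm (osc (l - 1) g x)"
      using arg_cong[OF ibp[of x l], of norm] by simp
    moreover have "\<bar>x \<bullet> e\<bar> ^ Suc k * norm (osc l f x) = \<bar>x \<bullet> e\<bar> ^ k * (\<bar>x \<bullet> e\<bar> * norm (osc l f x))"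
      by (simp only: power_Suc mult_ac)
    ultimately show ?thesis using C'[of x "l - 1"] by (simp only:)
  qed
  then show ?case by blast
qed

lemma osc_decay:
  fixes f :: "real ^ 'n::finite \<Rightarrow> 'b::euclidean_space"
  assumes f: "\<And>i. symbol_class (axis i 1) (Suc k) p q f"
    and p: "p - real (Suc k) > - real CARD('n)" and q: "q \<le> - 2 * real CARD('n)"
  shows "\<exists>C\<ge>0. \<forall>l x. x \<noteq> 0 \<longrightarrow> norm (osc l f x) \<le> C * norm x powr - (real k + 1 / 2)"
proof -
  have "\<exists>C. \<forall>l x. \<bar>x $ i\<bar> ^ Suc k * norm (osc l f x) \<le> C" for i
    using osc_decay_direction[OF _ f[of i]] p q by (simp add: inner_axis)
  then obtain C where C: "\<And>i l x. \<bar>x $ i\<bar> ^ Suc k * norm (osc l f x) \<le> C i" by metis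
  have fi: "integrable lborel f"
    using symbol_class_integrable[OF f] p q by force
  define D where "D = (LINT \<xi>|lborel. norm (f \<xi>))"
  have D: "norm (osc l f x) \<le> D" for l x unfolding D_def by (rule osc_bound[OF fi])
  have "D \<ge> 0" unfolding D_def by simp
  define E where "E = D + real CARD('n) ^ Suc k * (\<Sum>i\<in>UNIV. \<bar>C i\<bar>)"
  have E: "E \<ge> D" "E \<ge> 0" "real CARD('n) ^ Suc k * (\<Sum>i\<in>UNIV. \<bar>C i\<bar>) \<le> E"
    using \<open>D \<ge> 0\<close> by (auto simp: E_def sum_nonneg)
  have "norm (osc l f x) \<le> E * norm x powr - (real k + 1 / 2)" if x: "x \<noteq> 0" for l x
  \<comment> \<open>\<open>k + 1\<close> integrations by parts give the exponent -(k+1), boundedness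
    gives the exponent 0, and -(k+1/2) lies between them.\<close>
  proof (rule powr_interpolate[where a=0 and b="- real (Suc k)"])
    show "norm (osc l f x) \<le> E * norm x powr 0" using D[of l x] E x by simp
    \<comment> \<open>Decay is known only along the axes. Since |x| is at most the sum of the |x_i|,
      some coordinate carries at least the fraction 1/n of |x|.\<close>
    have "\<exists>i. norm x \<le> real CARD('n) * \<bar>x $ i\<bar>"
    proof (rule ccontr)
      assume "\<not> ?thesis"
      then have "\<bar>x $ i\<bar> < norm x / real CARD('n)" for i by (auto simp: not_le field_simps)
      then have "(\<Sum>i\<in>UNIV. \<bar>x $ i\<bar>) < (\<Sum>i\<in>(UNIV :: 'n set). norm x / real CARD('n))"
        by (intro sum_strict_mono) auto
      then show False using norm_le_l1_cart[of x] by simp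
    qed
    then obtain i where i: "norm x \<le> real CARD('n) * \<bar>x $ i\<bar>" by blast
    have "norm x ^ Suc k * norm (osc l f x) \<le> (real CARD('n) * \<bar>x $ i\<bar>) ^ Suc k * norm (osc l f x)"
      by (intro mult_right_mono power_mono i) auto
    also have "\<dots> = real CARD('n) ^ Suc k * (\<bar>x $ i\<bar> ^ Suc k * norm (osc l f x))"
      by (simp only: power_mult_distrib mult.assoc)
    also have "\<dots> \<le> real CARD('n) ^ Suc k * (\<Sum>i\<in>UNIV. \<bar>C i\<bar>)"
      using order_trans[OF C[where i=i] order_trans[OF abs_ge_self member_le_sum[of i UNIV "\<lambda>i. \<bar>C i\<bar>"]]]
      by (intro mult_left_mono) auto
    also have "\<dots> \<le> E" by (rule E)
    finally have "norm x ^ Suc k * norm (osc l f x) \<le> E" .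
    moreover have n: "norm x > 0" using x by simp
    moreover have "norm x ^ Suc k > 0" by (rule zero_less_power[OF n])
    ultimately have "norm (osc l f x) \<le> E * inverse (norm x ^ Suc k)"
      by (simp add: field_simps del: power_Suc)
    then show "norm (osc l f x) \<le> E * norm x powr - real (Suc k)"
      by (simp only: powr_minus powr_realpow[OF n])
  qed (use x E in auto)
  then show ?thesis using E by blast
qed

section \<open>The dyadic construction\<close>

lemma osc_continuous:
  fixes f :: "'a::euclidean_space \<Rightarrow> 'b::euclidean_space"
  assumes f: "integrable lborel f"
  shows "continuous_on UNIV (osc l f)"
proof -
  have "isCont (osc l f) x" for x
    unfolding continuous_at_sequentially comp_def
  proof (intro allI impI)
    fix X assume X: "X \<longlonglongrightarrow> x"
    show "(\<lambda>n. osc l f (X n)) \<longlonglongrightarrow> osc l f x"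
      unfolding osc_def
    proof (rule integral_dominated_convergence[OF _ _ integrable_norm[OF f]])
      have "isCont (cosine_shift l) t" for t
        using cosine_shift_derivative DERIV_isCont by blast
      then have "(\<lambda>n. cosine_shift l (\<xi> \<bullet> X n)) \<longlonglongrightarrow> cosine_shift l (\<xi> \<bullet> x)" for \<xi>
        by (rule isCont_tendsto_compose) (intro tendsto_intros X)
      then show "AE \<xi> in lborel. (\<lambda>n. cosine_shift l (\<xi> \<bullet> X n) *\<^sub>R f \<xi>) \<longlonglongrightarrow> cosine_shift l (\<xi> \<bullet> x) *\<^sub>R f \<xi>"
        by (intro AE_I2 tendsto_scaleR tendsto_const)
    qed (use osc_integrable[OF f] in \<open>auto simp: cosine_shift_bound mult_left_le_one_le\<close>)
  qed
  then show ?thesis by (simp add: continuous_at_imp_continuous_on)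
qed

lemma test_function_integrable: "test_function \<phi> \<Longrightarrow> integrable lborel \<phi>"
proof -
  assume \<phi>: "test_function \<phi>"
  obtain C R where CR: "\<And>x. \<bar>\<phi> x\<bar> \<le> C" "\<And>x. norm x \<ge> R \<Longrightarrow> \<phi> x = 0"
    using test_function_support[OF \<phi>] test_function_bounded[OF \<phi>] by metis
  then show ?thesis
    by (intro integrable_bounded_support[OF finite_on_bounded_lborel test_function_measurable[OF \<phi>], of C R]) auto
qed

text \<open>Fubini places the test function under the integral over xi, paired with a plane wave.
  Derivatives of the test function can then be turned into monomials in
  \<open>a *\<^sub>R \<xi>\<close>.\<close>

lemma osc_test_integral:
  fixes f :: "real ^ 'n::finite \<Rightarrow> 'b::euclidean_space"
  assumes \<phi>: "test_function \<phi>" and f: "integrable lborel f"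
  shows "(LINT x|lborel. \<phi> x *\<^sub>R osc l f (a *\<^sub>R x)) =
    (LINT \<xi>|lborel. (LINT x|lborel. \<phi> x * cosine_shift l (a * (x \<bullet> \<xi>))) *\<^sub>R f \<xi>)"
proof -
  note \<phi>i = test_function_integrable[OF \<phi>]
  have m: "\<phi> \<in> borel_measurable lborel" "f \<in> borel_measurable lborel" using \<phi>i f by auto
  let ?g = "\<lambda>x \<xi>. \<phi> x *\<^sub>R f \<xi>"
  let ?h = "\<lambda>x \<xi>. (\<phi> x * cosine_shift l (a * (x \<bullet> \<xi>))) *\<^sub>R f \<xi>"
  have gm: "(\<lambda>p. \<phi> (fst p)) \<in> borel_measurable (lborel \<Otimes>\<^sub>M lborel)" "(\<lambda>p. f (snd p)) \<in> borel_measurable (lborel \<Otimes>\<^sub>M lborel)"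
    using measurable_compose[OF measurable_fst m(1)] measurable_compose[OF measurable_snd m(2)] by auto
  have cm: "(\<lambda>p. cosine_shift l (a * (fst p \<bullet> snd p))) \<in> borel_measurable ((lborel :: (real ^ 'n) measure) \<Otimes>\<^sub>M lborel)"
    by (rule measurable_compose[OF _ cosine_shift_measurable]) measurable
  have gi: "integrable (lborel \<Otimes>\<^sub>M lborel) (case_prod ?g)"
  proof (rule lborel_pair.Fubini_integrable)
    show "case_prod ?g \<in> borel_measurable (lborel \<Otimes>\<^sub>M lborel)"
      unfolding split_beta using gm by (rule borel_measurable_scaleR)
  qed (use \<phi>i f in auto)
  have hi: "integrable (lborel \<Otimes>\<^sub>M lborel) (case_prod ?h)"
  proof (rule Bochner_Integration.integrable_bound[OF gi])
    show "case_prod ?h \<in> borel_measurable (lborel \<Otimes>\<^sub>M lborel)"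
      unfolding split_beta by (intro borel_measurable_scaleR borel_measurable_times gm cm)
    show "AE p in lborel \<Otimes>\<^sub>M lborel. norm (case_prod ?h p) \<le> norm (case_prod ?g p)"
      by (rule AE_I2) (auto simp: split_beta abs_mult cosine_shift_bound mult_left_le intro!: mult_right_mono)
  qed
  have "(LINT x|lborel. \<phi> x *\<^sub>R osc l f (a *\<^sub>R x)) = (LINT x|lborel. LINT \<xi>|lborel. ?h x \<xi>)"
    unfolding osc_def integral_scaleR_right[symmetric] by (simp add: inner_commute)
  also have "\<dots> = (LINT \<xi>|lborel. LINT x|lborel. ?h x \<xi>)"
    by (rule lborel_pair.Fubini_integral[OF hi, symmetric])
  also have "\<dots> = (LINT \<xi>|lborel. (LINT x|lborel. \<phi> x * cosine_shift l (a * (x \<bullet> \<xi>))) *\<^sub>R f \<xi>)"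
  proof (intro Bochner_Integration.integral_cong refl)
    fix \<xi> :: "real ^ 'n"
    have "integrable lborel (\<lambda>x. \<phi> x * cosine_shift l (a * (x \<bullet> \<xi>)))"
    proof (rule Bochner_Integration.integrable_bound[OF \<phi>i])
      have "(\<lambda>x. cosine_shift l (a * (x \<bullet> \<xi>))) \<in> borel_measurable lborel"
        by (rule measurable_compose[OF _ cosine_shift_measurable]) simp
      then show "(\<lambda>x. \<phi> x * cosine_shift l (a * (x \<bullet> \<xi>))) \<in> borel_measurable lborel"
        using m(1) by (intro borel_measurable_times)
    qed (simp add: abs_mult cosine_shift_bound mult_left_le)
    then show "(LINT x|lborel. ?h x \<xi>) = (LINT x|lborel. \<phi> x * cosine_shift l (a * (x \<bullet> \<xi>))) *\<^sub>R f \<xi>"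
      by (intro integral_scaleR_left)
  qed
  finally show ?thesis .
qed

text \<open>On the ball |x|^(-s) = |x|^(2n-s) |x|^(-2n) is at most R^(2n-s) |x|^(-2n), which
  supplies the decay bound required by \<open>integrable_powr_bounds\<close>; off the ball the
  function is 0.\<close>

lemma integrable_ball_powr:
  fixes s R :: real
  assumes s: "0 \<le> s" "s < real DIM('a::euclidean_space)" and R: "R > 0"
  shows "integrable lborel (\<lambda>x::'a. indicator (cball 0 R) x * norm x powr - s)"
proof (rule integrable_powr_bounds[where C="1 + R powr (2 * real DIM('a) - s)" and p="- s" and q="- 2 * real DIM('a)"])
  fix x :: 'a assume x: "x \<noteq> 0"
  show "norm (indicator (cball 0 R) x * norm x powr - s) \<le> (1 + R powr (2 * real DIM('a) - s)) * norm x powr - s"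
    by (auto simp: indicator_def distrib_right)
  show "norm (indicator (cball 0 R) x * norm x powr - s) \<le> (1 + R powr (2 * real DIM('a) - s)) * norm x powr (- 2 * real DIM('a))"
  proof (cases "norm x \<le> R")
    case True
    have "norm x powr - s = norm x powr (2 * real DIM('a) - s) * norm x powr (- 2 * real DIM('a))"
      by (subst powr_add[symmetric]) simp
    also have "\<dots> \<le> R powr (2 * real DIM('a) - s) * norm x powr (- 2 * real DIM('a))"
      using True s by (intro mult_right_mono powr_mono2) auto
    also have "\<dots> \<le> (1 + R powr (2 * real DIM('a) - s)) * norm x powr (- 2 * real DIM('a))"
      by (intro mult_right_mono) auto
    finally show ?thesis using True by simp
  qed (simp add: zero_le_mult_iff)
next
  have "(\<lambda>x::'a. norm x powr - s) \<in> borel_measurable borel" by measurable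
  moreover have "(indicator (cball 0 R) :: 'a \<Rightarrow> real) \<in> borel_measurable borel"
    by (rule borel_measurable_indicator) simp
  ultimately show "(\<lambda>x::'a. indicator (cball 0 R) x * norm x powr - s) \<in> borel_measurable borel"
    by (intro borel_measurable_times)
qed (use s in auto)

lemma AE_bound_imp_bound:
  fixes f :: "'a::euclidean_space \<Rightarrow> 'b::real_normed_vector"
  assumes c: "continuous_on UNIV f" and \<Omega>: "open \<Omega>"
    and AE: "AE x in lebesgue. x \<in> \<Omega> \<longrightarrow> norm (f x) \<le> \<epsilon>" and x: "x \<in> \<Omega>"
  shows "norm (f x) \<le> \<epsilon>"
proof (rule ccontr)
  assume "\<not> ?thesis"
  then have ne: "\<Omega> \<inter> {x. \<epsilon> < norm (f x)} \<noteq> {}" using x by auto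
  have o: "open (\<Omega> \<inter> {x. \<epsilon> < norm (f x)})"
    using c by (intro open_Int \<Omega> open_Collect_less continuous_intros)
  obtain N where N: "{x \<in> space lebesgue. \<not> (x \<in> \<Omega> \<longrightarrow> norm (f x) \<le> \<epsilon>)} \<subseteq> N" "N \<in> null_sets lebesgue"
    using AE unfolding eventually_ae_filter by auto
  have "negligible N" using N(2) by (simp add: negligible_iff_null_sets)
  moreover have "\<Omega> \<inter> {x. \<epsilon> < norm (f x)} \<subseteq> N" using N(1) by auto
  ultimately have "negligible (\<Omega> \<inter> {x. \<epsilon> < norm (f x)})" using negligible_subset by blast
  with o ne show False using open_not_negligible by blast
qed

text \<open>Ellipticity makes B(xi) injective, so away from the origin \<open>m \<xi>\<close> is
  B^dagger(xi) w. Its value at 0 is arbitrary.\<close>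

locale common_image_vector =
  fixes B :: "('n::finite, 'v::euclidean_space, 'w::euclidean_space) operator"
    and w :: 'w and m :: "real ^ 'n \<Rightarrow> 'v"
  assumes elliptic: "elliptic B"
    and symbol_m: "\<And>\<xi>. \<xi> \<noteq> 0 \<Longrightarrow> symbol B \<xi> (m \<xi>) = w"
begin

definition amp :: "'n multi_index \<Rightarrow> real ^ 'n \<Rightarrow> 'v" where
  "amp \<beta> \<xi> = monomial \<beta> \<xi> *\<^sub>R (gauss_diff \<xi> *\<^sub>R m \<xi>)"

text \<open>The orders at the origin add up: |beta| from the monomial, 2 from the Gaussian
  difference, -n from \<open>m\<close>. At infinity the decay of the Gaussian difference may be
  prescribed, and -n - |beta| brings the total to -2n.\<close>

lemma symbol_class_amp:
  "symbol_class e k (real (mi_order \<beta>) + 2 - real CARD('n)) (- 2 * real CARD('n)) (amp \<beta>)"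
proof -
  have "symbol_class e k (0 - real CARD('n)) (0 - real CARD('n)) m"
    by (rule symbol_class_solve[OF elliptic symbol_class_const[of e k w] symbol_m])
  moreover have "symbol_class e k 2 (- real CARD('n) - real (mi_order \<beta>)) (gauss_diff :: real ^ 'n \<Rightarrow> real)"
    by (rule symbol_class_gauss_diff) simp
  ultimately have "symbol_class e k (real (mi_order \<beta>) + (2 + (0 - real CARD('n))))
      (real (mi_order \<beta>) + ((- real CARD('n) - real (mi_order \<beta>)) + (0 - real CARD('n))))
      (\<lambda>\<xi>. monomial \<beta> \<xi> *\<^sub>R (gauss_diff \<xi> *\<^sub>R m \<xi>))"
    by (intro symbol_class_scaleR symbol_class_monomial)
  then show ?thesis by (simp add: amp_def[abs_def] algebra_simps)
qed

lemma amp_integrable: "integrable lborel (amp \<beta>)"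
  by (rule symbol_class_integrable[OF symbol_class_amp[of 0 0]]) auto

text \<open>\<open>V mi_zero\<close> is, up to a constant, the real form of the inverse Fourier transform of
  \<open>i\<^sup>-\<^sup>n gauss_diff(\<xi>) m(\<xi>)\<close>, and \<open>V \<beta>\<close> is its derivative \<open>\<partial>\<^sup>\<beta>\<close>; a factor \<open>i\<close> turns into a shift of the
  cosine by \<open>pi/2\<close>.\<close>

definition V :: "'n multi_index \<Rightarrow> real ^ 'n \<Rightarrow> 'v" where
  "V \<beta> = osc (real (mi_order \<beta>) - real CARD('n)) (amp \<beta>)"

lemma V_continuous: "continuous_on UNIV (V \<beta>)"
  unfolding V_def by (rule osc_continuous[OF amp_integrable])

lemma V_decay: "\<exists>C\<ge>0. \<forall>x. x \<noteq> 0 \<longrightarrow> norm (V \<beta> x) \<le> C * norm x powr - (real (mi_order \<beta>) + 1 / 2)"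
proof -
  obtain C where "C \<ge> 0" "\<And>l x. x \<noteq> 0 \<Longrightarrow> norm (osc l (amp \<beta>) x) \<le> C * norm x powr - (real (mi_order \<beta>) + 1 / 2)"
    using osc_decay[where f="amp \<beta>" and k="mi_order \<beta>" and p="real (mi_order \<beta>) + 2 - real CARD('n)"
        and q="- 2 * real CARD('n)", OF symbol_class_amp] by auto
  then show ?thesis unfolding V_def by blast
qed

abbreviation mi_zero :: "'n multi_index" where "mi_zero \<equiv> \<lambda>_. 0"

lemma mi_zero_simps [simp]: "mi_order mi_zero = 0" "monomial mi_zero \<xi> = 1"
  by (simp_all add: mi_order_def monomial_def)

text \<open>Moving the derivatives onto the plane wave multiplies \<open>amp mi_zero\<close> by the
  monomial, which gives \<open>amp \<beta>\<close>, and shifts the phase from -n to |beta| - n.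
  These are the two changes that lead from \<open>V mi_zero\<close> to
  \<open>V \<beta>\<close>.\<close>

lemma V_weak_derivative:
  assumes \<phi>: "test_function \<phi>"
  shows "(LINT x|lborel. mi_deriv \<beta> \<phi> x *\<^sub>R V mi_zero (a *\<^sub>R x)) =
    (-1) ^ mi_order \<beta> *\<^sub>R (LINT x|lborel. \<phi> x *\<^sub>R (a ^ mi_order \<beta> *\<^sub>R V \<beta> (a *\<^sub>R x)))"
proof -
  have "(LINT x|lborel. mi_deriv \<beta> \<phi> x *\<^sub>R V mi_zero (a *\<^sub>R x)) =
     (LINT \<xi>|lborel. (LINT x|lborel. mi_deriv \<beta> \<phi> x * cosine_shift (- real CARD('n)) (a * (x \<bullet> \<xi>))) *\<^sub>R amp mi_zero \<xi>)"
    unfolding V_def by (subst osc_test_integral[OF test_function_mi_deriv[OF \<phi>] amp_integrable]) simp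
  also have "\<dots> = (LINT \<xi>|lborel. ((-1) ^ mi_order \<beta> * a ^ mi_order \<beta>) *\<^sub>R
      ((LINT x|lborel. \<phi> x * cosine_shift (real (mi_order \<beta>) - real CARD('n)) (a * (x \<bullet> \<xi>))) *\<^sub>R amp \<beta> \<xi>))"
    by (intro Bochner_Integration.integral_cong refl, subst mi_deriv_integral_by_parts[OF \<phi>])
       (simp add: amp_def mult_ac)
  also have "\<dots> = ((-1) ^ mi_order \<beta> * a ^ mi_order \<beta>) *\<^sub>R (LINT x|lborel. \<phi> x *\<^sub>R V \<beta> (a *\<^sub>R x))"
    unfolding V_def integral_scaleR_right osc_test_integral[OF \<phi> amp_integrable] ..
  also have "\<dots> = (-1) ^ mi_order \<beta> *\<^sub>R (LINT x|lborel. \<phi> x *\<^sub>R (a ^ mi_order \<beta> *\<^sub>R V \<beta> (a *\<^sub>R x)))"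
  proof -
    have "(LINT x|lborel. \<phi> x *\<^sub>R (a ^ mi_order \<beta> *\<^sub>R V \<beta> (a *\<^sub>R x))) =
        (LINT x|lborel. a ^ mi_order \<beta> *\<^sub>R (\<phi> x *\<^sub>R V \<beta> (a *\<^sub>R x)))"
      by (intro Bochner_Integration.integral_cong refl) (simp add: mult.commute)
    also have "\<dots> = a ^ mi_order \<beta> *\<^sub>R (LINT x|lborel. \<phi> x *\<^sub>R V \<beta> (a *\<^sub>R x))"
      by (rule integral_scaleR_right)
    finally show ?thesis by simp
  qed
  finally show ?thesis .
qed

text \<open>\<open>S \<beta> J\<close> and \<open>U \<beta>\<close> are the derivatives \<open>\<partial>\<^sup>\<beta>\<close> of the approximations \<open>u\<^sub>J\<close> and of their limit \<open>u\<close>.\<close>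

definition S :: "'n multi_index \<Rightarrow> nat \<Rightarrow> real ^ 'n \<Rightarrow> 'v" where
  "S \<beta> J x = (\<Sum>j<J. (2 ^ j) ^ mi_order \<beta> *\<^sub>R V \<beta> (2 ^ j *\<^sub>R x))"

definition U :: "'n multi_index \<Rightarrow> real ^ 'n \<Rightarrow> 'v" where
  "U \<beta> x = (\<Sum>j. (2 ^ j) ^ mi_order \<beta> *\<^sub>R V \<beta> (2 ^ j *\<^sub>R x))"

lemma S_continuous: "continuous_on UNIV (S \<beta> J)"
  unfolding S_def by (intro continuous_intros continuous_on_compose2[OF V_continuous]) auto

lemma S_measurable: "S \<beta> J \<in> borel_measurable borel"
  by (rule borel_measurable_continuous_onI[OF S_continuous])

lemma U_measurable: "U \<beta> \<in> borel_measurable borel"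
  unfolding U_def
  by (intro borel_measurable_suminf borel_measurable_continuous_onI continuous_intros
      continuous_on_compose2[OF V_continuous]) auto

text \<open>By \<open>V_decay\<close> the j-th term is at most a multiple of 2^(j|beta|)
  2^(-j(|beta|+1/2)) = 2^(-j/2) times the power of |x|, so the tail is geometric. The origin is
  excluded: all terms there are multiples of \<open>V \<beta> 0\<close>, and the series need not
  converge.\<close>

lemma U_S_bound:
  "\<exists>D\<ge>0. \<forall>J x. x \<noteq> 0 \<longrightarrow> norm (U \<beta> x - S \<beta> J x) \<le> D * (2 powr (- 1 / 2)) ^ J * norm x powr - (real (mi_order \<beta>) + 1 / 2)"
proof -
  obtain C where C: "C \<ge> 0" "\<And>x. x \<noteq> 0 \<Longrightarrow> norm (V \<beta> x) \<le> C * norm x powr - (real (mi_order \<beta>) + 1 / 2)"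
    using V_decay by blast
  define \<rho> :: real where "\<rho> = 2 powr (- 1 / 2)"
  have \<rho>: "0 < \<rho>" "\<rho> < 1" by (auto simp: \<rho>_def powr_less_one)
  have "norm (U \<beta> x - S \<beta> J x) \<le> C / (1 - \<rho>) * \<rho> ^ J * norm x powr - (real (mi_order \<beta>) + 1 / 2)" if x: "x \<noteq> 0" for J x
  proof -
    let ?W = "norm x powr - (real (mi_order \<beta>) + 1 / 2)"
    let ?f = "\<lambda>j. (2 ^ j) ^ mi_order \<beta> *\<^sub>R V \<beta> (2 ^ j *\<^sub>R x)"
    have b: "norm (?f j) \<le> (C * ?W) * \<rho> ^ j" for j
    proof -
      have r: "\<rho> ^ j = 2 powr (- 1 / 2 * real j)"
        unfolding \<rho>_def by (subst powr_realpow[symmetric]) (simp_all add: powr_powr)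
      have pj: "(2::real) ^ j = 2 powr real j" by (simp add: powr_realpow)
      have pm: "((2::real) ^ j) ^ mi_order \<beta> = 2 powr (real j * real (mi_order \<beta>))"
        by (simp add: pj powr_realpow[symmetric] powr_powr)
      have nW: "norm ((2 ^ j :: real) *\<^sub>R x) powr - (real (mi_order \<beta>) + 1 / 2) =
          2 powr (- real j * (real (mi_order \<beta>) + 1 / 2)) * ?W"
        by (simp add: powr_mult pj powr_powr algebra_simps)
      have "norm (?f j) = (2 ^ j) ^ mi_order \<beta> * norm (V \<beta> (2 ^ j *\<^sub>R x))" by simp
      also have "\<dots> \<le> (2 ^ j) ^ mi_order \<beta> * (C * norm ((2 ^ j :: real) *\<^sub>R x) powr - (real (mi_order \<beta>) + 1 / 2))"
        using x by (intro mult_left_mono C(2)) auto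
      also have "\<dots> = (C * ?W) * (2 powr (real j * real (mi_order \<beta>)) * 2 powr (- real j * (real (mi_order \<beta>) + 1 / 2)))"
        unfolding pm nW by (simp only: mult_ac)
      also have "2 powr (real j * real (mi_order \<beta>)) * 2 powr (- real j * (real (mi_order \<beta>) + 1 / 2)) = \<rho> ^ j"
        unfolding powr_add[symmetric] r by (simp add: algebra_simps)
      finally show ?thesis .
    qed
    have g: "summable (\<lambda>j. (C * ?W) * \<rho> ^ j)" using \<rho> by (intro summable_mult summable_geometric) auto
    have sm: "summable (\<lambda>j. norm (?f j))" by (rule summable_comparison_test'[OF g]) (use b in auto)
    have "U \<beta> x - S \<beta> J x = (\<Sum>j. ?f (j + J))"
      unfolding U_def S_def using suminf_split_initial_segment[OF summable_norm_cancel[OF sm], of J] by simp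
    also have "norm \<dots> \<le> (\<Sum>j. norm (?f (j + J)))"
      by (rule summable_norm, rule summable_ignore_initial_segment[OF sm])
    also have "\<dots> \<le> (\<Sum>j. (C * ?W) * \<rho> ^ (j + J))"
      by (rule suminf_le[OF b summable_ignore_initial_segment[OF sm] summable_ignore_initial_segment[OF g]])
    also have "\<dots> = (\<Sum>j. ((C * ?W) * \<rho> ^ J) * \<rho> ^ j)" by (simp add: power_add mult_ac)
    also have "\<dots> = ((C * ?W) * \<rho> ^ J) * (1 / (1 - \<rho>))"
      using \<rho> by (subst suminf_mult) (auto simp: suminf_geometric intro!: summable_geometric)
    finally show ?thesis by (simp add: mult_ac)
  qed
  moreover have "C / (1 - \<rho>) \<ge> 0" using C \<rho> by simp
  ultimately show ?thesis unfolding \<rho>_def by blast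
qed

end

section \<open>Gaussian approximations of the Dirac measure\<close>

text \<open>The cosine transform of exp(-|xi|^2/2) with the constant that comes out of it. The total
  mass is not normalised and is recorded as \<open>gmass\<close>.\<close>

definition gau :: "'a::euclidean_space \<Rightarrow> real" where
  "gau x = sqrt (2 * pi) ^ DIM('a) * exp (- (norm x)\<^sup>2 / 2)"

lemma gau_pos: "gau x > 0"
  by (simp add: gau_def)

lemma gau_continuous: "continuous_on UNIV gau"
  unfolding gau_def[abs_def] by (intro continuous_intros) auto

lemma gau_measurable [measurable]: "gau \<in> borel_measurable borel"
  by (rule borel_measurable_continuous_onI[OF gau_continuous])

lemma gau_integrable: "integrable lborel gau"
  unfolding gau_def[abs_def] by (intro integrable_mult_right gaussian_fourier(1))

lemma gauss_diff_fourier: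
  fixes y :: "'a::euclidean_space"
  shows "integrable lborel (\<lambda>\<xi>. gauss_diff \<xi> * cos (\<xi> \<bullet> y))"
    and "(LINT \<xi>|lborel. gauss_diff \<xi> * cos (\<xi> \<bullet> y)) = 2 ^ DIM('a) * gau (2 *\<^sub>R y) - gau y"
proof -
  have i: "integrable lborel (\<lambda>\<xi>::'a. exp (- (norm \<xi>)\<^sup>2 / 2) * cos (\<xi> \<bullet> z))" for z
    by (rule Bochner_Integration.integrable_bound[OF gaussian_fourier(1)])
       (auto simp: abs_mult mult_left_le)
  have e: "exp (- (norm ((1/2) *\<^sub>R \<xi>))\<^sup>2 / 2) * cos (((1/2) *\<^sub>R \<xi>) \<bullet> (2 *\<^sub>R y)) = exp (- (1/8) * (norm \<xi>)\<^sup>2) * cos (\<xi> \<bullet> y)"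
    for \<xi> :: 'a by (simp add: power_divide)
  have i8: "integrable lborel (\<lambda>\<xi>. exp (- (1/8) * (norm \<xi>)\<^sup>2) * cos (\<xi> \<bullet> y))"
    using integrable_lborel_scale[OF i[of "2 *\<^sub>R y"], of "1/2"] unfolding e by simp
  have "(1/2) ^ DIM('a) * (LINT \<xi>|lborel. exp (- (1/8) * (norm \<xi>)\<^sup>2) * cos (\<xi> \<bullet> y)) = gau (2 *\<^sub>R y)"
    using integral_lborel_scale[OF i[of "2 *\<^sub>R y"], of "1/2"] gaussian_fourier(2)[of "2 *\<^sub>R y"]
    unfolding e by (simp add: gau_def)
  then have s8: "(LINT \<xi>|lborel. exp (- (1/8) * (norm \<xi>)\<^sup>2) * cos (\<xi> \<bullet> y)) = 2 ^ DIM('a) * gau (2 *\<^sub>R y)"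
    by (simp add: power_one_over field_simps)
  have d: "gauss_diff \<xi> * cos (\<xi> \<bullet> y) = exp (- (1/8) * (norm \<xi>)\<^sup>2) * cos (\<xi> \<bullet> y) - exp (- (norm \<xi>)\<^sup>2 / 2) * cos (\<xi> \<bullet> y)" for \<xi>
    by (simp add: gauss_diff_def left_diff_distrib)
  show "integrable lborel (\<lambda>\<xi>. gauss_diff \<xi> * cos (\<xi> \<bullet> y))"
    unfolding d by (rule Bochner_Integration.integrable_diff[OF i8 i])
  show "(LINT \<xi>|lborel. gauss_diff \<xi> * cos (\<xi> \<bullet> y)) = 2 ^ DIM('a) * gau (2 *\<^sub>R y) - gau y"
    unfolding d Bochner_Integration.integral_diff[OF i8 i] s8 gaussian_fourier(2) by (simp add: gau_def)
qed

definition bell :: "nat \<Rightarrow> 'a::euclidean_space \<Rightarrow> real" where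
  "bell J x = (2 ^ J) ^ DIM('a) * gau ((2 ^ J :: real) *\<^sub>R x)"

lemma bell_pos: "bell J x > 0"
  by (simp add: bell_def gau_pos)

lemma bell_0 [simp]: "bell 0 = gau"
  by (simp add: bell_def fun_eq_iff)

lemma bell_continuous: "continuous_on UNIV (bell J)"
  unfolding bell_def by (intro continuous_intros continuous_on_compose2[OF gau_continuous]) auto

lemma bell_measurable [measurable]: "bell J \<in> borel_measurable borel"
  by (rule borel_measurable_continuous_onI[OF bell_continuous])

lemma bell_integrable: "integrable lborel (bell J)"
  unfolding bell_def by (intro integrable_mult_right integrable_lborel_scale gau_integrable) auto

definition gmass :: "'a::euclidean_space itself \<Rightarrow> real" where
  "gmass _ = (LINT x|lborel. gau (x::'a))"

lemma gmass_pos: "gmass TYPE('a::euclidean_space) > 0"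
proof -
  have "(LINT \<xi>|lborel. exp (- (norm (\<xi>::'a))\<^sup>2 / 2)) = sqrt (2 * pi) ^ DIM('a)"
    using gaussian_fourier(2)[of "0 :: 'a"] by simp
  then show ?thesis unfolding gmass_def gau_def by simp
qed

lemma bell_test_integral:
  fixes f :: "'a::euclidean_space \<Rightarrow> real"
  assumes f: "f \<in> borel_measurable borel" and C: "\<And>x. \<bar>f x\<bar> \<le> C"
  shows "integrable lborel (\<lambda>x. f x * bell J x)"
    and "(LINT x|lborel. f x * bell J x) = (LINT x|lborel. f (inverse (2 ^ J) *\<^sub>R x) * gau x)"
proof -
  have i: "integrable lborel (\<lambda>x. f (inverse (2 ^ J) *\<^sub>R x) * gau x)"
  proof (rule Bochner_Integration.integrable_bound[OF integrable_mult_right[OF gau_integrable, of C]])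
    have "(\<lambda>x. f (inverse (2 ^ J) *\<^sub>R x)) \<in> borel_measurable borel"
      by (rule measurable_compose[OF _ f]) simp
    then show "(\<lambda>x. f (inverse (2 ^ J) *\<^sub>R x) * gau x) \<in> borel_measurable lborel" by simp
    show "AE x in lborel. norm (f (inverse (2 ^ J) *\<^sub>R x) * gau x) \<le> norm (C * gau x)"
      using C gau_pos by (intro AE_I2) (auto simp: abs_mult intro!: mult_right_mono order_trans[OF C abs_ge_self])
  qed
  have e: "f (inverse (2 ^ J) *\<^sub>R ((2 ^ J :: real) *\<^sub>R x)) * gau ((2 ^ J :: real) *\<^sub>R x) = f x * gau ((2 ^ J :: real) *\<^sub>R x)" for x
    by simp
  have i': "integrable lborel (\<lambda>x. f x * gau ((2 ^ J :: real) *\<^sub>R x))"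
    using integrable_lborel_scale[OF i, of "2 ^ J"] unfolding e by simp
  show "integrable lborel (\<lambda>x. f x * bell J x)"
    using integrable_mult_right[OF i', of "(2 ^ J) ^ DIM('a)"] by (simp add: bell_def mult_ac)
  show "(LINT x|lborel. f x * bell J x) = (LINT x|lborel. f (inverse (2 ^ J) *\<^sub>R x) * gau x)"
    using integral_lborel_scale[OF i, of "2 ^ J"] unfolding e
    by (simp add: bell_def mult.left_commute[of "f _"])
qed

text \<open>Continuity at the origin alone is assumed, so that the limit covers test functions as
  well as indicators of sets whose frontier avoids the origin.\<close>

lemma bell_test_tendsto:
  fixes f :: "'a::euclidean_space \<Rightarrow> real"
  assumes f: "f \<in> borel_measurable borel" and C: "\<And>x. \<bar>f x\<bar> \<le> C" and c: "isCont f 0"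
  shows "(\<lambda>J. LINT x|lborel. f x * bell J x) \<longlonglongrightarrow> f 0 * gmass TYPE('a)"
proof -
  have "(\<lambda>J. LINT x|lborel. f (inverse (2 ^ J) *\<^sub>R x) * gau x) \<longlonglongrightarrow> (LINT x|lborel. f 0 * gau (x::'a))"
  proof (rule integral_dominated_convergence[where w="\<lambda>x. C * gau x"])
    show "integrable lborel (\<lambda>x::'a. C * gau x)" by (rule integrable_mult_right[OF gau_integrable])
    have "(\<lambda>x. f (inverse (2 ^ J) *\<^sub>R x)) \<in> borel_measurable borel" for J :: nat
      by (rule measurable_compose[OF _ f]) simp
    then show "(\<lambda>x. f (inverse (2 ^ J) *\<^sub>R x) * gau x) \<in> borel_measurable lborel" for J :: nat by simp
    show "AE x in lborel. norm (f (inverse (2 ^ J) *\<^sub>R x) * gau x) \<le> C * gau x" for J :: nat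
      using C by (intro AE_I2) (simp add: abs_mult abs_of_pos[OF gau_pos] mult_right_mono less_imp_le[OF gau_pos])
    have "(\<lambda>J. inverse (2 ^ J) *\<^sub>R x) \<longlonglongrightarrow> 0 *\<^sub>R x" for x :: 'a
      by (intro tendsto_intros LIMSEQ_inverse_realpow_zero) simp
    then have "(\<lambda>J. inverse (2 ^ J) *\<^sub>R x) \<longlonglongrightarrow> 0" for x :: 'a
      by simp
    then have "(\<lambda>J. f (inverse (2 ^ J) *\<^sub>R x)) \<longlonglongrightarrow> f 0" for x
      by (rule isCont_tendsto_compose[OF c])
    then show "AE x in lborel. (\<lambda>J. f (inverse (2 ^ J) *\<^sub>R x) * gau x) \<longlonglongrightarrow> f 0 * gau x"
      by (intro AE_I2 tendsto_mult tendsto_const)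
  qed simp
  then show ?thesis unfolding bell_test_integral(2)[OF f C] gmass_def by simp
qed

lemma bell_tendsto_0:
  assumes x: "x \<noteq> (0 :: 'a::euclidean_space)"
  shows "(\<lambda>J. bell J x) \<longlonglongrightarrow> 0"
proof -
  \<comment> \<open>The exponent -n - 1 beats the dilation factor 2^(Jn) and leaves 2^(-J).\<close>
  obtain C where C: "C \<ge> 0" "\<And>r. r > 0 \<Longrightarrow> exp (- (1/2) * r\<^sup>2) \<le> C * r powr (- real DIM('a) - 1)"
    using exp_minus_le_powr[of "1/2" "- real DIM('a) - 1"] by auto
  define K where "K = sqrt (2 * pi) ^ DIM('a) * C * norm x powr (- real DIM('a) - 1)"
  have "norm (bell J x) \<le> K * inverse (2 ^ J)" for J
  proof -
    let ?a = "2 ^ J :: real"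
    have "exp (- (norm (?a *\<^sub>R x))\<^sup>2 / 2) \<le> C * norm (?a *\<^sub>R x) powr (- real DIM('a) - 1)"
      using C(2)[of "norm (?a *\<^sub>R x)"] x by simp
    also have "norm (?a *\<^sub>R x) powr (- real DIM('a) - 1) = ?a powr (- real DIM('a) - 1) * norm x powr (- real DIM('a) - 1)"
      by (simp add: powr_mult)
    also have "?a powr (- real DIM('a) - 1) = inverse (?a ^ DIM('a)) * inverse ?a"
      by (simp add: powr_diff powr_minus powr_realpow divide_inverse)
    finally have "bell J x \<le> ?a ^ DIM('a) * (sqrt (2 * pi) ^ DIM('a) *
        (C * (inverse (?a ^ DIM('a)) * inverse ?a * norm x powr (- real DIM('a) - 1))))"
      unfolding bell_def gau_def by (intro mult_left_mono) auto
    also have "\<dots> = K * inverse ?a" by (simp add: K_def field_simps)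
    finally show ?thesis using bell_pos[of J x] by simp
  qed
  moreover have "(\<lambda>J. K * inverse (2 ^ J)) \<longlonglongrightarrow> 0"
    by (rule tendsto_mult_right_zero) (rule LIMSEQ_inverse_realpow_zero, simp)
  ultimately show ?thesis by (intro Lim_null_comparison[of "\<lambda>J. bell J x"]) auto
qed

lemma L1_loc_borelI:
  fixes f :: "'a::euclidean_space \<Rightarrow> 'b::euclidean_space"
  assumes f: "f \<in> borel_measurable borel"
    and i: "\<And>R. R > 0 \<Longrightarrow> integrable lborel (\<lambda>x. indicator (cball 0 R) x *\<^sub>R f x)"
  shows "L1_loc f" and "compact K \<Longrightarrow> integrable lborel (\<lambda>x. indicator K x *\<^sub>R f x)"
proof -
  have K: "integrable lborel (\<lambda>x. indicator K x *\<^sub>R f x)" if K: "compact K" for K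
  proof -
    obtain R where R: "R > 0" "\<And>x. x \<in> K \<Longrightarrow> norm x \<le> R"
      using compact_imp_bounded[OF K] unfolding bounded_pos by blast
    show ?thesis
    proof (rule Bochner_Integration.integrable_bound[OF i[OF R(1)]])
      show "(\<lambda>x. indicator K x *\<^sub>R f x) \<in> borel_measurable lborel"
        using f borel_compact[OF K] by simp
      show "AE x in lborel. norm (indicator K x *\<^sub>R f x) \<le> norm (indicator (cball 0 R) x *\<^sub>R f x)"
        using R(2) by (intro AE_I2) (auto simp: indicator_def)
    qed
  qed
  then show "compact K \<Longrightarrow> integrable lborel (\<lambda>x. indicator K x *\<^sub>R f x)" .
  show "L1_loc f"
    unfolding L1_loc_def set_integrable_def
  proof (intro allI impI)
    fix K :: "'a set" assume k: "compact K"
    show "integrable lebesgue (\<lambda>x. indicator K x *\<^sub>R f x)"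
      by (subst integrable_completion) (use K[OF k] in auto)
  qed
qed

lemma lborel_test_integrable:
  assumes f: "f \<in> borel_measurable borel" and L: "L1_loc f" and \<phi>: "test_function \<phi>"
  shows "integrable lborel (\<lambda>x. \<phi> x *\<^sub>R f x)"
    and "(LINT x|lebesgue. \<phi> x *\<^sub>R f x) = (LINT x|lborel. \<phi> x *\<^sub>R f x)"
proof -
  have m: "(\<lambda>x. \<phi> x *\<^sub>R f x) \<in> borel_measurable lborel"
    using f test_function_measurable[OF \<phi>] by simp
  show "integrable lborel (\<lambda>x. \<phi> x *\<^sub>R f x)"
    using L1_loc_test_integrable[OF L \<phi>] by (subst (asm) integrable_completion[OF m])
  show "(LINT x|lebesgue. \<phi> x *\<^sub>R f x) = (LINT x|lborel. \<phi> x *\<^sub>R f x)"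
    by (rule integral_completion[OF m])
qed

lemma L1_loc_continuous:
  fixes f :: "'a::euclidean_space \<Rightarrow> 'b::euclidean_space"
  assumes f: "continuous_on UNIV f"
  shows "L1_loc f"
proof (rule L1_loc_borelI)
  show "integrable lborel (\<lambda>x. indicator (cball 0 R) x *\<^sub>R f x)" for R
    by (rule borel_integrable_compact) (use f in \<open>auto intro: continuous_on_subset\<close>)
qed (rule borel_measurable_continuous_onI[OF f])

section \<open>Convergence of the dyadic sums together with their derivatives of order below
  n\<close>

context common_image_vector
begin

text \<open>For |beta| = n the phase shift is 0. Under the integral the sum over beta reassembles
  B(xi) m(xi) = w, and what remains is the cosine transform of the Gaussian difference.\<close>

lemma sum_B_V:
  "(\<Sum>\<beta> | mi_order \<beta> = CARD('n). blinfun_apply (B \<beta>) (V \<beta> y)) = (2 ^ CARD('n) * gau (2 *\<^sub>R y) - gau y) *\<^sub>R w"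
proof -
  have "blinfun_apply (B \<beta>) (V \<beta> y) = (LINT \<xi>|lborel. cosine_shift 0 (\<xi> \<bullet> y) *\<^sub>R blinfun_apply (B \<beta>) (amp \<beta> \<xi>))"
    if "mi_order \<beta> = CARD('n)" for \<beta>
    using integral_bounded_linear[OF blinfun.bounded_linear_right osc_integrable[OF amp_integrable], of "B \<beta>" 0 y \<beta>] that
    by (simp add: V_def osc_def blinfun.scaleR_right)
  then have "(\<Sum>\<beta> | mi_order \<beta> = CARD('n). blinfun_apply (B \<beta>) (V \<beta> y)) =
      (\<Sum>\<beta> | mi_order \<beta> = CARD('n). (LINT \<xi>|lborel. cosine_shift 0 (\<xi> \<bullet> y) *\<^sub>R blinfun_apply (B \<beta>) (amp \<beta> \<xi>)))"
    by simp
  also have "\<dots> = (LINT \<xi>|lborel. (\<Sum>\<beta> | mi_order \<beta> = CARD('n). cosine_shift 0 (\<xi> \<bullet> y) *\<^sub>R blinfun_apply (B \<beta>) (amp \<beta> \<xi>)))"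
    by (intro Bochner_Integration.integral_sum[symmetric] osc_integrable
        integrable_bounded_linear[OF blinfun.bounded_linear_right amp_integrable])
  also have "\<dots> = (LINT \<xi>|lborel. (gauss_diff \<xi> * cos (\<xi> \<bullet> y)) *\<^sub>R w)"
  proof (intro Bochner_Integration.integral_cong refl)
    fix \<xi> :: "real ^ 'n"
    have "(\<Sum>\<beta> | mi_order \<beta> = CARD('n). cosine_shift 0 (\<xi> \<bullet> y) *\<^sub>R blinfun_apply (B \<beta>) (amp \<beta> \<xi>)) =
        (gauss_diff \<xi> * cos (\<xi> \<bullet> y)) *\<^sub>R symbol B \<xi> (m \<xi>)"
      by (auto simp: symbol_eq amp_def blinfun.scaleR_right scaleR_sum_right cosine_shift_def mult_ac intro!: sum.cong)
    \<comment> \<open>The equation for \<open>m\<close> fails to be known only at xi = 0, where the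
      Gaussian difference is 0.\<close>
    also have "\<dots> = (gauss_diff \<xi> * cos (\<xi> \<bullet> y)) *\<^sub>R w"
      by (cases "\<xi> = 0") (simp_all add: symbol_m gauss_diff_def)
    finally show "(\<Sum>\<beta> | mi_order \<beta> = CARD('n). cosine_shift 0 (\<xi> \<bullet> y) *\<^sub>R blinfun_apply (B \<beta>) (amp \<beta> \<xi>)) =
        (gauss_diff \<xi> * cos (\<xi> \<bullet> y)) *\<^sub>R w" .
  qed
  also have "\<dots> = (LINT \<xi>|lborel. gauss_diff \<xi> * cos (\<xi> \<bullet> y)) *\<^sub>R w"
    by (rule integral_scaleR_left) (rule gauss_diff_fourier(1))
  finally show ?thesis by (simp add: gauss_diff_fourier(2))
qed

text \<open>For |beta| = n the chain-rule factor 2^(jn) is exactly the normalisation of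
  \<open>bell\<close>, so the j-th summand is the difference of two consecutive bells times
  \<open>w\<close>.\<close>

lemma sum_B_S:
  "(\<Sum>\<beta> | mi_order \<beta> = CARD('n). blinfun_apply (B \<beta>) (S \<beta> J x)) = (bell J x - gau x) *\<^sub>R w"
proof -
  have "(\<Sum>\<beta> | mi_order \<beta> = CARD('n). blinfun_apply (B \<beta>) (S \<beta> J x)) =
      (\<Sum>\<beta> | mi_order \<beta> = CARD('n). \<Sum>j<J. (2 ^ j) ^ CARD('n) *\<^sub>R blinfun_apply (B \<beta>) (V \<beta> (2 ^ j *\<^sub>R x)))"
    by (intro sum.cong refl) (auto simp: S_def blinfun.sum_right blinfun.scaleR_right)
  also have "\<dots> = (\<Sum>j<J. (2 ^ j) ^ CARD('n) *\<^sub>R (\<Sum>\<beta> | mi_order \<beta> = CARD('n). blinfun_apply (B \<beta>) (V \<beta> (2 ^ j *\<^sub>R x))))"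
    by (subst sum.swap) (simp add: scaleR_sum_right)
  also have "\<dots> = (\<Sum>j<J. (bell (Suc j) x - bell j x) *\<^sub>R w)"
    by (intro sum.cong refl) (simp add: sum_B_V bell_def right_diff_distrib power_mult_distrib mult_ac)
  also have "\<dots> = (bell J x - gau x) *\<^sub>R w"
    by (simp only: scaleR_sum_left[symmetric] sum_lessThan_telescope[of "\<lambda>j. bell j x"] bell_0)
  finally show ?thesis .
qed

lemma S_weak:
  assumes \<phi>: "test_function \<phi>"
  shows "(LINT x|lborel. mi_deriv \<beta> \<phi> x *\<^sub>R S mi_zero J x) = (-1) ^ mi_order \<beta> *\<^sub>R (LINT x|lborel. \<phi> x *\<^sub>R S \<beta> J x)"
proof -
  have i: "integrable lborel (\<lambda>x. \<psi> x *\<^sub>R (c *\<^sub>R V \<gamma> ((a::real) *\<^sub>R x)))" if "test_function \<psi>" for \<psi> c \<gamma> a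
  proof -
    have "continuous_on UNIV (\<lambda>x. c *\<^sub>R V \<gamma> (a *\<^sub>R x))"
      by (intro continuous_intros continuous_on_compose2[OF V_continuous]) auto
    then show ?thesis
      by (intro lborel_test_integrable(1) that L1_loc_continuous borel_measurable_continuous_onI)
  qed
  have "(LINT x|lborel. mi_deriv \<beta> \<phi> x *\<^sub>R S mi_zero J x) = (\<Sum>j<J. LINT x|lborel. mi_deriv \<beta> \<phi> x *\<^sub>R V mi_zero (2 ^ j *\<^sub>R x))"
    using i[OF test_function_mi_deriv[OF \<phi>], of _ 1]
    by (simp add: S_def scaleR_sum_right)
  also have "\<dots> = (\<Sum>j<J. (-1) ^ mi_order \<beta> *\<^sub>R (LINT x|lborel. \<phi> x *\<^sub>R ((2 ^ j) ^ mi_order \<beta> *\<^sub>R V \<beta> (2 ^ j *\<^sub>R x))))"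
    by (simp only: V_weak_derivative[OF \<phi>])
  also have "\<dots> = (-1) ^ mi_order \<beta> *\<^sub>R (LINT x|lborel. \<phi> x *\<^sub>R S \<beta> J x)"
    unfolding S_def scaleR_sum_right[of "\<phi> _"]
    by (subst Bochner_Integration.integral_sum[OF i[OF \<phi>]]) (rule scaleR_sum_right[symmetric])
  finally show ?thesis .
qed

lemma L1_loc_S: "L1_loc (S \<beta> J)"
  by (rule L1_loc_continuous[OF S_continuous])

lemma S_is_weak_deriv: "is_weak_deriv \<beta> (S mi_zero J) (S \<beta> J)"
  unfolding is_weak_deriv_def
proof (intro conjI allI impI L1_loc_S)
  fix \<phi> :: "real ^ 'n \<Rightarrow> real" assume \<phi>: "test_function \<phi>"
  show "(LINT x|lebesgue. mi_deriv \<beta> \<phi> x *\<^sub>R S mi_zero J x) = (-1) ^ mi_order \<beta> *\<^sub>R (LINT x|lebesgue. \<phi> x *\<^sub>R S \<beta> J x)"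
    unfolding lborel_test_integrable(2)[OF S_measurable L1_loc_S \<phi>]
      lborel_test_integrable(2)[OF S_measurable L1_loc_S test_function_mi_deriv[OF \<phi>]]
    by (rule S_weak[OF \<phi>])
qed

lemma U_bound_integrable:
  assumes "mi_order \<beta> < CARD('n)" "R > 0"
  shows "integrable lborel (\<lambda>x::real ^ 'n. indicator (cball 0 R) x * norm x powr - (real (mi_order \<beta>) + 1 / 2))"
  by (rule integrable_ball_powr) (use assms in auto)

lemma U_S_integrable:
  assumes \<beta>: "mi_order \<beta> < CARD('n)" and R: "R > 0"
  shows "integrable lborel (\<lambda>x. indicator (cball 0 R) x *\<^sub>R (U \<beta> x - S \<beta> J x))"
proof -
  obtain D where D: "\<And>J x. x \<noteq> 0 \<Longrightarrow> norm (U \<beta> x - S \<beta> J x) \<le> D * (2 powr (- 1 / 2)) ^ J * norm x powr - (real (mi_order \<beta>) + 1 / 2)"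
    using U_S_bound by blast
  show ?thesis
  proof (rule Bochner_Integration.integrable_bound[OF integrable_mult_right[OF U_bound_integrable[OF \<beta> R], of "D * (2 powr (- 1 / 2)) ^ J"]])
    have "(indicator (cball 0 R) :: real ^ 'n \<Rightarrow> real) \<in> borel_measurable borel"
      by (rule borel_measurable_indicator) simp
    then show "(\<lambda>x. indicator (cball 0 R) x *\<^sub>R (U \<beta> x - S \<beta> J x)) \<in> borel_measurable lborel"
      unfolding measurable_lborel2 measurable_lborel1
      by (intro borel_measurable_scaleR borel_measurable_diff U_measurable S_measurable)
    have "AE x in lborel. x \<noteq> (0 :: real ^ 'n)" by (rule AE_lborel_singleton)
    then show "AE x in lborel. norm (indicator (cball 0 R) x *\<^sub>R (U \<beta> x - S \<beta> J x)) \<le>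
        norm (D * (2 powr (- 1 / 2)) ^ J * (indicator (cball 0 R) x * norm x powr - (real (mi_order \<beta>) + 1 / 2)))"
    proof eventually_elim
      case (elim x)
      then show ?case using order_trans[OF D[OF elim] abs_ge_self] by (auto simp: indicator_def)
    qed
  qed
qed

text \<open>For J = 0 the sum \<open>S \<beta> 0\<close> is empty, so \<open>U_S_integrable\<close>
  is a statement about \<open>U \<beta>\<close> itself.\<close>

lemma L1_loc_U: "mi_order \<beta> < CARD('n) \<Longrightarrow> L1_loc (U \<beta>)"
  using L1_loc_borelI(1)[OF U_measurable] U_S_integrable[of \<beta> _ 0] by (simp add: S_def)

lemma U_S_tendsto:
  assumes \<beta>: "mi_order \<beta> < CARD('n)" and R: "R > 0"
  shows "(\<lambda>J. LINT x|lborel. norm (indicator (cball 0 R) x *\<^sub>R (U \<beta> x - S \<beta> J x))) \<longlonglongrightarrow> 0"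
proof -
  let ?W = "\<lambda>x::real ^ 'n. indicator (cball 0 R) x * norm x powr - (real (mi_order \<beta>) + 1 / 2)"
  obtain D where D: "\<And>J x. x \<noteq> 0 \<Longrightarrow> norm (U \<beta> x - S \<beta> J x) \<le> D * (2 powr (- 1 / 2)) ^ J * norm x powr - (real (mi_order \<beta>) + 1 / 2)"
    using U_S_bound by blast
  have "(LINT x|lborel. norm (indicator (cball 0 R) x *\<^sub>R (U \<beta> x - S \<beta> J x))) \<le>
      (LINT x|lborel. D * (2 powr (- 1 / 2)) ^ J * ?W x)" for J
  proof (rule integral_mono_AE[OF integrable_norm[OF U_S_integrable[OF \<beta> R]] integrable_mult_right[OF U_bound_integrable[OF \<beta> R]]])
    have "AE x in lborel. x \<noteq> (0 :: real ^ 'n)" by (rule AE_lborel_singleton)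
    then show "AE x in lborel. norm (indicator (cball 0 R) x *\<^sub>R (U \<beta> x - S \<beta> J x)) \<le> D * (2 powr (- 1 / 2)) ^ J * ?W x"
    proof eventually_elim
      case (elim x)
      then show ?case using D[OF elim] by (auto simp: indicator_def)
    qed
  qed
  moreover have "(LINT x|lborel. D * (2 powr (- 1 / 2)) ^ J * ?W x) = D * (LINT x|lborel. ?W x) * (2 powr (- 1 / 2)) ^ J" for J
    unfolding integral_mult_right_zero by (simp only: mult_ac)
  moreover have "0 \<le> (LINT x|lborel. norm (indicator (cball 0 R) x *\<^sub>R (U \<beta> x - S \<beta> J x)))" for J
    by (rule integral_nonneg_AE) simp
  ultimately have "norm (LINT x|lborel. norm (indicator (cball 0 R) x *\<^sub>R (U \<beta> x - S \<beta> J x))) \<le>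
      D * (LINT x|lborel. ?W x) * (2 powr (- 1 / 2)) ^ J" for J
    by (simp only: real_norm_def abs_of_nonneg)
  moreover have "(\<lambda>J. D * (LINT x|lborel. ?W x) * (2 powr (- 1 / 2)) ^ J) \<longlonglongrightarrow> 0"
    by (rule tendsto_mult_right_zero, rule LIMSEQ_realpow_zero) (auto simp: powr_less_one)
  ultimately show ?thesis by (rule Lim_null_comparison[OF always_eventually[OF allI]])
qed

lemma U_S_test_tendsto:
  assumes \<beta>: "mi_order \<beta> < CARD('n)" and \<phi>: "test_function \<phi>"
  shows "(\<lambda>J. LINT x|lborel. \<phi> x *\<^sub>R S \<beta> J x) \<longlonglongrightarrow> (LINT x|lborel. \<phi> x *\<^sub>R U \<beta> x)"
proof -
  obtain C R where C: "\<And>x. \<bar>\<phi> x\<bar> \<le> C" and R: "R > 0" "\<And>x. norm x \<ge> R \<Longrightarrow> \<phi> x = 0"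
    using test_function_support[OF \<phi>] test_function_bounded[OF \<phi>] by metis
  have i: "integrable lborel (\<lambda>x. \<phi> x *\<^sub>R U \<beta> x)" "integrable lborel (\<lambda>x. \<phi> x *\<^sub>R S \<beta> J x)" for J
    using lborel_test_integrable(1)[OF U_measurable L1_loc_U[OF \<beta>] \<phi>] lborel_test_integrable(1)[OF S_measurable L1_loc_S \<phi>] by auto
  have "norm ((LINT x|lborel. \<phi> x *\<^sub>R S \<beta> J x) - (LINT x|lborel. \<phi> x *\<^sub>R U \<beta> x)) \<le>
      C * (LINT x|lborel. norm (indicator (cball 0 R) x *\<^sub>R (U \<beta> x - S \<beta> J x)))" for J
  proof -
    have "norm ((LINT x|lborel. \<phi> x *\<^sub>R S \<beta> J x) - (LINT x|lborel. \<phi> x *\<^sub>R U \<beta> x)) =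
        norm (LINT x|lborel. \<phi> x *\<^sub>R S \<beta> J x - \<phi> x *\<^sub>R U \<beta> x)"
      by (subst Bochner_Integration.integral_diff[OF i(2) i(1)]) simp
    also have "\<dots> \<le> (LINT x|lborel. norm (\<phi> x *\<^sub>R S \<beta> J x - \<phi> x *\<^sub>R U \<beta> x))"
      by (rule integral_norm_bound)
    also have "\<dots> \<le> (LINT x|lborel. C * norm (indicator (cball 0 R) x *\<^sub>R (U \<beta> x - S \<beta> J x)))"
    proof (rule integral_mono)
      show "integrable lborel (\<lambda>x. norm (\<phi> x *\<^sub>R S \<beta> J x - \<phi> x *\<^sub>R U \<beta> x))"
        by (intro integrable_norm Bochner_Integration.integrable_diff i)
      show "integrable lborel (\<lambda>x. C * norm (indicator (cball 0 R) x *\<^sub>R (U \<beta> x - S \<beta> J x)))"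
        by (intro integrable_mult_right integrable_norm U_S_integrable \<beta> R)
      fix x
      have "norm (\<phi> x *\<^sub>R S \<beta> J x - \<phi> x *\<^sub>R U \<beta> x) = \<bar>\<phi> x\<bar> * norm (U \<beta> x - S \<beta> J x)"
        by (simp add: scaleR_diff_right[symmetric] norm_minus_commute)
      also have "\<dots> \<le> C * norm (indicator (cball 0 R) x *\<^sub>R (U \<beta> x - S \<beta> J x))"
        using C[of x] R(2)[of x] by (cases "norm x \<le> R") (auto intro: mult_right_mono)
      finally show "norm (\<phi> x *\<^sub>R S \<beta> J x - \<phi> x *\<^sub>R U \<beta> x) \<le> C * norm (indicator (cball 0 R) x *\<^sub>R (U \<beta> x - S \<beta> J x))" .
    qed
    finally show ?thesis by simp
  qed
  moreover have "(\<lambda>J. C * (LINT x|lborel. norm (indicator (cball 0 R) x *\<^sub>R (U \<beta> x - S \<beta> J x)))) \<longlonglongrightarrow> 0"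
    by (rule tendsto_mult_right_zero[OF U_S_tendsto[OF \<beta> R(1)]])
  ultimately have "(\<lambda>J. (LINT x|lborel. \<phi> x *\<^sub>R S \<beta> J x) - (LINT x|lborel. \<phi> x *\<^sub>R U \<beta> x)) \<longlonglongrightarrow> 0"
    by (rule Lim_null_comparison[OF always_eventually[OF allI]])
  then show ?thesis by (simp add: LIM_zero_iff)
qed

text \<open>The identity for the sums passes to the limit on both sides. For |beta| = n the bound
  |x|^(-n-1/2) is no longer locally integrable, which is why the order stays below n.\<close>

lemma U_is_weak_deriv:
  assumes \<beta>: "mi_order \<beta> < CARD('n)"
  shows "is_weak_deriv \<beta> (U mi_zero) (U \<beta>)"
  unfolding is_weak_deriv_def
proof (intro conjI allI impI)
  show "L1_loc (U \<beta>)" by (rule L1_loc_U[OF \<beta>])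
  fix \<phi> :: "real ^ 'n \<Rightarrow> real" assume \<phi>: "test_function \<phi>"
  have z: "mi_order mi_zero < CARD('n)" by simp
  have "(\<lambda>J. LINT x|lborel. mi_deriv \<beta> \<phi> x *\<^sub>R S mi_zero J x) \<longlonglongrightarrow> (LINT x|lborel. mi_deriv \<beta> \<phi> x *\<^sub>R U mi_zero x)"
    by (rule U_S_test_tendsto[OF z test_function_mi_deriv[OF \<phi>]])
  moreover have "(\<lambda>J. LINT x|lborel. mi_deriv \<beta> \<phi> x *\<^sub>R S mi_zero J x) \<longlonglongrightarrow> (-1) ^ mi_order \<beta> *\<^sub>R (LINT x|lborel. \<phi> x *\<^sub>R U \<beta> x)"
    unfolding S_weak[OF \<phi>] by (intro tendsto_scaleR tendsto_const U_S_test_tendsto[OF \<beta> \<phi>])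
  ultimately have "(LINT x|lborel. mi_deriv \<beta> \<phi> x *\<^sub>R U mi_zero x) = (-1) ^ mi_order \<beta> *\<^sub>R (LINT x|lborel. \<phi> x *\<^sub>R U \<beta> x)"
    by (rule LIMSEQ_unique)
  then show "(LINT x|lebesgue. mi_deriv \<beta> \<phi> x *\<^sub>R U mi_zero x) = (-1) ^ mi_order \<beta> *\<^sub>R (LINT x|lebesgue. \<phi> x *\<^sub>R U \<beta> x)"
    using lborel_test_integrable(2)[OF U_measurable L1_loc_U[OF \<beta>] \<phi>]
      lborel_test_integrable(2)[OF U_measurable L1_loc_U[OF z] test_function_mi_deriv[OF \<phi>, of \<beta>]] by simp
qed

lemma conv_W1_loc_S_U: "conv_W1_loc (CARD('n) - 1) (S mi_zero) (U mi_zero)"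
proof -
  have lt: "mi_order \<beta> < CARD('n)" if "mi_order \<beta> \<le> CARD('n) - 1" for \<beta> :: "'n multi_index"
    using that zero_less_card_finite[where 'a='n] by linarith
  have "(\<lambda>J. LINT x:K|lebesgue. norm (weak_deriv \<beta> (S mi_zero J) x - weak_deriv \<beta> (U mi_zero) x)) \<longlonglongrightarrow> 0"
    if \<beta>: "mi_order \<beta> < CARD('n)" and K: "compact K" for \<beta> :: "'n multi_index" and K
  proof -
    obtain R where R: "R > 0" "\<And>x. x \<in> K \<Longrightarrow> norm x \<le> R"
      using compact_imp_bounded[OF K] unfolding bounded_pos by blast
    have KR: "(\<lambda>x. indicator K x *\<^sub>R norm (S \<beta> J x - U \<beta> x)) \<in> borel_measurable lborel" for J
      using S_measurable U_measurable borel_compact[OF K] by simp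
    have eq: "(LINT x:K|lebesgue. norm (weak_deriv \<beta> (S mi_zero J) x - weak_deriv \<beta> (U mi_zero) x)) =
        (LINT x|lborel. indicator K x *\<^sub>R norm (S \<beta> J x - U \<beta> x))" for J
    proof -
      \<comment> \<open>\<open>weak_deriv\<close> is an arbitrary representative; almost everywhere
        it may be replaced by the explicit \<open>S \<beta> J\<close> and
        \<open>U \<beta>\<close>.\<close>
      have AE: "AE x in lebesgue. indicator K x *\<^sub>R norm (S \<beta> J x - U \<beta> x) =
          indicator K x *\<^sub>R norm (weak_deriv \<beta> (S mi_zero J) x - weak_deriv \<beta> (U mi_zero) x)"
        using weak_deriv_AE[OF S_is_weak_deriv[of \<beta> J]] weak_deriv_AE[OF U_is_weak_deriv[OF \<beta>]]
        by eventually_elim simp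
      have m1: "(\<lambda>x. indicator K x *\<^sub>R norm (S \<beta> J x - U \<beta> x)) \<in> borel_measurable lebesgue"
        using KR by (rule measurable_completion)
      have m2: "(\<lambda>x. indicator K x *\<^sub>R norm (weak_deriv \<beta> (S mi_zero J) x - weak_deriv \<beta> (U mi_zero) x)) \<in> borel_measurable lebesgue"
      proof -
        have "is_weak_deriv \<beta> u (weak_deriv \<beta> u)" if "is_weak_deriv \<beta> u g" for u g :: "real ^ 'n \<Rightarrow> 'v"
          unfolding weak_deriv_def by (rule someI[of "is_weak_deriv \<beta> u", OF that])
        note this[OF S_is_weak_deriv[of \<beta> J]] this[OF U_is_weak_deriv[OF \<beta>]]
        then have "L1_loc (weak_deriv \<beta> (S mi_zero J))" "L1_loc (weak_deriv \<beta> (U mi_zero))"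
          unfolding is_weak_deriv_def by blast+
        then have "(\<lambda>x. indicator K x *\<^sub>R weak_deriv \<beta> (S mi_zero J) x) \<in> borel_measurable lebesgue"
          "(\<lambda>x. indicator K x *\<^sub>R weak_deriv \<beta> (U mi_zero) x) \<in> borel_measurable lebesgue"
          using K unfolding L1_loc_def set_integrable_def by (meson borel_measurable_integrable)+
        then have "(\<lambda>x. norm (indicator K x *\<^sub>R weak_deriv \<beta> (S mi_zero J) x - indicator K x *\<^sub>R weak_deriv \<beta> (U mi_zero) x))
            \<in> borel_measurable lebesgue"
          by (rule measurable_compose[OF borel_measurable_diff borel_measurable_norm])
        then show ?thesis by (simp add: scaleR_diff_right[symmetric])
      qed
      show ?thesis
        unfolding set_lebesgue_integral_def
        using integral_cong_AE[OF m1 m2 AE] integral_completion[OF KR[of J]] by simp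
    qed
    have "norm (LINT x|lborel. indicator K x *\<^sub>R norm (S \<beta> J x - U \<beta> x)) \<le>
        (LINT x|lborel. norm (indicator (cball 0 R) x *\<^sub>R (U \<beta> x - S \<beta> J x)))" for J
    proof -
      have le: "norm (indicator K x *\<^sub>R norm (S \<beta> J x - U \<beta> x)) \<le> norm (indicator (cball 0 R) x *\<^sub>R (U \<beta> x - S \<beta> J x))" for x
        using R(2)[of x] by (auto simp: indicator_def norm_minus_commute)
      have "integrable lborel (\<lambda>x. indicator K x *\<^sub>R norm (S \<beta> J x - U \<beta> x))"
        by (rule Bochner_Integration.integrable_bound[OF U_S_integrable[OF \<beta> R(1)] KR]) (rule AE_I2[OF le])
      then show ?thesis
        by (rule Bochner_Integration.integral_norm_bound_integral[OF _ integrable_norm[OF U_S_integrable[OF \<beta> R(1)]]]) (rule le)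
    qed
    then show ?thesis
      unfolding eq by (rule Lim_null_comparison[OF always_eventually[OF allI] U_S_tendsto[OF \<beta> R(1)]])
  qed
  moreover have "W1_loc (CARD('n) - 1) (S mi_zero J)" for J
    unfolding W1_loc_def using L1_loc_S S_is_weak_deriv by blast
  moreover have "W1_loc (CARD('n) - 1) (U mi_zero)"
    unfolding W1_loc_def using L1_loc_U[of mi_zero] U_is_weak_deriv lt by auto
  ultimately show ?thesis unfolding conv_W1_loc_def using lt by blast
qed

end

section \<open>Strict convergence without uniform convergence\<close>

lemma density_lborel_facts:
  fixes f :: "'a::euclidean_space \<Rightarrow> real"
  assumes f: "integrable lborel f" and pos: "\<And>x. f x \<ge> 0"
  shows finite_on_bounded_density: "finite_on_bounded (density lborel (\<lambda>x. ennreal (f x)))"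
    and emeasure_density_lborel: "E \<in> sets borel \<Longrightarrow>
      emeasure (density lborel (\<lambda>x. ennreal (f x))) E = ennreal (LINT x|lborel. indicator E x * f x)"
    and measure_density_lborel_eq: "E \<in> sets borel \<Longrightarrow>
      measure (density lborel (\<lambda>x. ennreal (f x))) E = (LINT x|lborel. indicator E x * f x)"
proof -
  have m: "f \<in> borel_measurable borel" using f by auto
  have i: "integrable lborel (\<lambda>x. indicator E x * f x)" if "E \<in> sets borel" for E
    using integrable_mult_indicator[OF _ f, of E] that by simp
  have e: "emeasure (density lborel (\<lambda>x. ennreal (f x))) E = ennreal (LINT x|lborel. indicator E x * f x)"
    if E: "E \<in> sets borel" for E
  proof -
    have "emeasure (density lborel (\<lambda>x. ennreal (f x))) E = (\<integral>\<^sup>+x. ennreal (f x) * indicator E x \<partial>lborel)"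
      using E m by (intro emeasure_density) auto
    also have "\<dots> = (\<integral>\<^sup>+x. ennreal (indicator E x * f x) \<partial>lborel)"
      by (intro nn_integral_cong) (auto simp: indicator_def)
    also have "\<dots> = ennreal (LINT x|lborel. indicator E x * f x)"
      by (rule nn_integral_eq_integral[OF i[OF E]]) (use pos in simp)
    finally show ?thesis .
  qed
  then show "E \<in> sets borel \<Longrightarrow>
      emeasure (density lborel (\<lambda>x. ennreal (f x))) E = ennreal (LINT x|lborel. indicator E x * f x)" .
  show "finite_on_bounded (density lborel (\<lambda>x. ennreal (f x)))"
    by (simp add: finite_on_bounded_def e)
  show "measure (density lborel (\<lambda>x. ennreal (f x))) E = (LINT x|lborel. indicator E x * f x)" if "E \<in> sets borel"
    using e[OF that] pos by (simp add: measure_def integral_nonneg_AE)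
qed

definition bell_measure :: "nat \<Rightarrow> 'a::euclidean_space measure" where
  "bell_measure J = density lborel (\<lambda>x. ennreal (bell J x))"

lemmas bell_measure_facts =
  density_lborel_facts[OF bell_integrable less_imp_le[OF bell_pos], folded bell_measure_def]

text \<open>The limit of the bells, all of which have mass \<open>gmass\<close>; hence this weight
  at the origin.\<close>

definition dirac_measure :: "'a::euclidean_space measure" where
  "dirac_measure = density (return borel 0) (\<lambda>_. ennreal (gmass TYPE('a)))"

lemma emeasure_dirac_measure:
  "E \<in> sets borel \<Longrightarrow> emeasure (dirac_measure :: 'a::euclidean_space measure) E = ennreal (gmass TYPE('a) * indicator E 0)"
proof -
  assume E: "E \<in> sets borel"
  have "emeasure (dirac_measure :: 'a measure) E =
      (\<integral>\<^sup>+x. ennreal (gmass TYPE('a)) * indicator E x \<partial>return borel 0)"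
    unfolding dirac_measure_def by (rule emeasure_density) (use E in auto)
  also have "\<dots> = ennreal (gmass TYPE('a)) * indicator E 0"
    by (rule nn_integral_return) (use E in auto)
  finally show ?thesis by (simp add: indicator_def)
qed

lemma finite_on_bounded_dirac_measure: "finite_on_bounded dirac_measure"
  by (simp add: finite_on_bounded_def emeasure_dirac_measure) (simp add: dirac_measure_def)

lemma measure_dirac_measure:
  "E \<in> sets borel \<Longrightarrow> measure (dirac_measure :: 'a::euclidean_space measure) E = gmass TYPE('a) * indicator E 0"
  by (simp add: measure_def emeasure_dirac_measure less_imp_le[OF gmass_pos])

lemma integral_dirac_measure:
  fixes f :: "'a::euclidean_space \<Rightarrow> real"
  assumes "f \<in> borel_measurable borel"
  shows "(LINT x|dirac_measure. f x) = gmass TYPE('a) * f 0"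
  unfolding dirac_measure_def using assms gmass_pos[where 'a='a]
  by (subst integral_density) (auto simp: integral_return less_imp_le)

text \<open>|a - b| = a + b - 2 min(a, b). The minimum of the two bells is dominated by
  \<open>gau\<close> and tends to 0 off the origin, so in the limit the concentrating bell and the
  fixed one do not cancel.\<close>

lemma tendsto_integral_bell_diff:
  fixes \<Omega> :: "'a::euclidean_space set"
  assumes \<Omega>: "\<Omega> \<in> sets borel" and z: "0 \<notin> frontier \<Omega>"
  shows "(\<lambda>J. LINT x|lborel. indicator \<Omega> x * \<bar>bell J x - gau x\<bar>) \<longlonglongrightarrow>
    gmass TYPE('a) * indicator \<Omega> 0 + (LINT x|lborel. indicator \<Omega> x * gau x)"
proof -
  have c: "isCont (indicator \<Omega> :: 'a \<Rightarrow> real) 0"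
    using z by (simp add: isCont_indicator)
  have I: "(\<lambda>J. LINT x|lborel. indicator \<Omega> x * bell J x) \<longlonglongrightarrow> indicator \<Omega> 0 * gmass TYPE('a)"
    by (rule bell_test_tendsto[of _ 1]) (use \<Omega> c in auto)
  have mi: "integrable lborel (\<lambda>x. indicator \<Omega> x * f x :: real)" if "integrable lborel f" for f
    using integrable_mult_indicator[OF _ that, of \<Omega>] \<Omega> by simp
  have mm: "integrable lborel (\<lambda>x::'a. min (bell J x) (gau x))" for J
    by (rule Bochner_Integration.integrable_bound[OF gau_integrable])
       (auto simp: min_def abs_of_pos[OF bell_pos] abs_of_pos[OF gau_pos])
  have M: "(\<lambda>J. LINT x|lborel. indicator \<Omega> x * min (bell J x) (gau x)) \<longlonglongrightarrow> (LINT x|(lborel :: 'a measure). (0::real))"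
  proof (rule integral_dominated_convergence[OF _ _ gau_integrable])
    show "(\<lambda>x. indicator \<Omega> x * min (bell J x) (gau x)) \<in> borel_measurable lborel" for J
      using \<Omega> by simp
    show "AE x in lborel. norm (indicator \<Omega> x * min (bell J x) (gau x)) \<le> gau x" for J
      by (intro AE_I2) (auto simp: indicator_def min_def abs_of_pos[OF bell_pos] abs_of_pos[OF gau_pos]
          less_imp_le[OF gau_pos])
    have "AE x in lborel. x \<noteq> (0::'a)" by (rule AE_lborel_singleton)
    then show "AE x in lborel. (\<lambda>J. indicator \<Omega> x * min (bell J x) (gau x)) \<longlonglongrightarrow> 0"
    proof eventually_elim
      case (elim x)
      have "(\<lambda>J. indicator \<Omega> x * min (bell J x) (gau x)) \<longlonglongrightarrow> indicator \<Omega> x * min 0 (gau x)"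
        by (intro tendsto_intros bell_tendsto_0 elim)
      then show ?case using gau_pos[of x] by (simp add: min_def)
    qed
  qed simp
  have "(LINT x|lborel. indicator \<Omega> x * \<bar>bell J x - gau x\<bar>) =
      (LINT x|lborel. indicator \<Omega> x * bell J x) + (LINT x|lborel. indicator \<Omega> x * gau x) -
      2 * (LINT x|lborel. indicator \<Omega> x * min (bell J x) (gau x))" for J
  proof -
    have "(LINT x|lborel. indicator \<Omega> x * \<bar>bell J x - gau x\<bar>) =
      (LINT x|lborel. (indicator \<Omega> x * bell J x + indicator \<Omega> x * gau x) - 2 * (indicator \<Omega> x * min (bell J x) (gau x)))"
      by (intro Bochner_Integration.integral_cong) (auto simp: indicator_def min_def)
    then show ?thesis
      using mi[OF bell_integrable[of J]] mi[OF gau_integrable] mi[OF mm[of J]] by simp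
  qed
  moreover have "(\<lambda>J. (LINT x|lborel. indicator \<Omega> x * bell J x) + (LINT x|lborel. indicator \<Omega> x * gau x) -
      2 * (LINT x|lborel. indicator \<Omega> x * min (bell J x) (gau x))) \<longlonglongrightarrow>
      indicator \<Omega> 0 * gmass TYPE('a) + (LINT x|lborel. indicator \<Omega> x * gau x) - 2 * (LINT x|(lborel :: 'a measure). (0::real))"
    by (intro tendsto_intros I M)
  ultimately show ?thesis by (simp add: mult.commute)
qed

section \<open>Representing measures and variations of the approximations and of the limit\<close>

context common_image_vector
begin

text \<open>All derivatives are moved back from the test function to the sum, which is legitimate at
  order n too because \<open>S \<beta> J\<close> is continuous; the two signs cancel.\<close>

lemma adjoint_S:
  assumes \<phi>: "test_function \<phi>"
  shows "(\<Sum>\<beta> | mi_order \<beta> = CARD('n). (-1) ^ mi_order \<beta> *\<^sub>R blinfun_apply (B \<beta>) (LINT x|lebesgue. mi_deriv \<beta> \<phi> x *\<^sub>R S mi_zero J x)) =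
    ((LINT x|lborel. \<phi> x * bell J x) - (LINT x|lborel. \<phi> x * gau x)) *\<^sub>R w"
proof -
  obtain C where C: "\<And>x. \<bar>\<phi> x\<bar> \<le> C" using test_function_bounded[OF \<phi>] by metis
  note bi = bell_test_integral(1)[OF test_function_measurable[OF \<phi>] C]
  note i = lborel_test_integrable(1)[OF S_measurable L1_loc_S \<phi>]
  have *: "(-1) ^ mi_order \<beta> *\<^sub>R blinfun_apply (B \<beta>) (LINT x|lebesgue. mi_deriv \<beta> \<phi> x *\<^sub>R S mi_zero J x) =
      (LINT x|lborel. \<phi> x *\<^sub>R blinfun_apply (B \<beta>) (S \<beta> J x))" for \<beta>
  proof -
    have "(-1) ^ mi_order \<beta> *\<^sub>R blinfun_apply (B \<beta>) (LINT x|lebesgue. mi_deriv \<beta> \<phi> x *\<^sub>R S mi_zero J x) =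
        blinfun_apply (B \<beta>) (LINT x|lborel. \<phi> x *\<^sub>R S \<beta> J x)"
      unfolding lborel_test_integrable(2)[OF S_measurable L1_loc_S test_function_mi_deriv[OF \<phi>]] S_weak[OF \<phi>]
      by (simp add: blinfun.scaleR_right power_mult_distrib[symmetric])
    also have "\<dots> = (LINT x|lborel. blinfun_apply (B \<beta>) (\<phi> x *\<^sub>R S \<beta> J x))"
      by (rule integral_bounded_linear[OF blinfun.bounded_linear_right i, symmetric])
    finally show ?thesis by (simp add: blinfun.scaleR_right)
  qed
  have "(\<Sum>\<beta> | mi_order \<beta> = CARD('n). (-1) ^ mi_order \<beta> *\<^sub>R blinfun_apply (B \<beta>) (LINT x|lebesgue. mi_deriv \<beta> \<phi> x *\<^sub>R S mi_zero J x)) =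
      (\<Sum>\<beta> | mi_order \<beta> = CARD('n). LINT x|lborel. \<phi> x *\<^sub>R blinfun_apply (B \<beta>) (S \<beta> J x))"
    by (simp only: *)
  also have "\<dots> = (LINT x|lborel. (\<Sum>\<beta> | mi_order \<beta> = CARD('n). \<phi> x *\<^sub>R blinfun_apply (B \<beta>) (S \<beta> J x)))"
    using integrable_bounded_linear[OF blinfun.bounded_linear_right i]
    by (intro Bochner_Integration.integral_sum[symmetric]) (simp add: blinfun.scaleR_right)
  also have "\<dots> = (LINT x|lborel. (\<phi> x * bell J x - \<phi> x * gau x) *\<^sub>R w)"
    by (simp add: scaleR_sum_right[symmetric] sum_B_S right_diff_distrib)
  also have "\<dots> = (LINT x|lborel. \<phi> x * bell J x - \<phi> x * gau x) *\<^sub>R w"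
    using bi[of J] bi[of 0] by (intro integral_scaleR_left Bochner_Integration.integrable_diff) auto
  also have "(LINT x|lborel. \<phi> x * bell J x - \<phi> x * gau x) = (LINT x|lborel. \<phi> x * bell J x) - (LINT x|lborel. \<phi> x * gau x)"
    using bi[of J] bi[of 0] by (intro Bochner_Integration.integral_diff) auto
  finally show ?thesis .
qed

lemma integral_bell_measure:
  assumes "test_function \<phi>"
  shows "(LINT x|bell_measure J. \<phi> x) = (LINT x|lborel. \<phi> x * bell J x)"
  unfolding bell_measure_def using test_function_measurable[OF assms]
  by (subst integral_density) (auto simp: less_imp_le[OF bell_pos] mult.commute)

lemma represents_S:
  "represents B (S mi_zero J) (\<lambda>E. (measure (bell_measure J) E - measure (bell_measure 0) E) *\<^sub>R w)"
  unfolding represents_def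
proof (intro conjI allI impI)
  show "radon_measure (\<lambda>E. (measure (bell_measure J) E - measure (bell_measure 0) E) *\<^sub>R w)"
    by (intro radon_measure_scaled bell_measure_facts(1) finite_on_bounded_dirac_measure)
  fix \<phi> :: "real ^ 'n \<Rightarrow> real" assume \<phi>: "test_function \<phi>"
  show "vector_integral (\<lambda>E. (measure (bell_measure J) E - measure (bell_measure 0) E) *\<^sub>R w) \<phi> =
    (\<Sum>\<beta> | mi_order \<beta> = CARD('n). (-1) ^ mi_order \<beta> *\<^sub>R blinfun_apply (B \<beta>) (LINT x|lebesgue. mi_deriv \<beta> \<phi> x *\<^sub>R S mi_zero J x))"
    unfolding vector_integral_scaled[OF bell_measure_facts(1) bell_measure_facts(1) \<phi>] adjoint_S[OF \<phi>] by (simp add: integral_bell_measure[OF \<phi>])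
qed

text \<open>Derivatives of order n of the limit are never formed. The tested expression involves
  only \<open>S mi_zero\<close>, which converges locally in L^1 to \<open>U mi_zero\<close>, while
  the bells on the other side converge to the point mass.\<close>

lemma represents_U:
  "represents B (U mi_zero) (\<lambda>E. (measure dirac_measure E - measure (bell_measure 0) E) *\<^sub>R w)"
  unfolding represents_def
proof (intro conjI allI impI)
  show "radon_measure (\<lambda>E. (measure dirac_measure E - measure (bell_measure 0) E) *\<^sub>R w)"
    by (intro radon_measure_scaled bell_measure_facts(1) finite_on_bounded_dirac_measure)
  fix \<phi> :: "real ^ 'n \<Rightarrow> real" assume \<phi>: "test_function \<phi>"
  obtain C where C: "\<And>x. \<bar>\<phi> x\<bar> \<le> C" using test_function_bounded[OF \<phi>] by metis
  have z: "mi_order mi_zero < CARD('n)" by simp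
  let ?A = "\<lambda>u. \<Sum>\<beta> | mi_order \<beta> = CARD('n). (-1) ^ mi_order \<beta> *\<^sub>R blinfun_apply (B \<beta>) (LINT x|lebesgue. mi_deriv \<beta> \<phi> x *\<^sub>R u x)"
  note le = lborel_test_integrable(2)[OF S_measurable L1_loc_S test_function_mi_deriv[OF \<phi>]]
    lborel_test_integrable(2)[OF U_measurable L1_loc_U[OF z] test_function_mi_deriv[OF \<phi>]]
  have "(\<lambda>J. ?A (S mi_zero J)) \<longlonglongrightarrow> ?A (U mi_zero)"
    unfolding le
    by (intro tendsto_sum tendsto_scaleR tendsto_const bounded_linear.tendsto[OF blinfun.bounded_linear_right]
        U_S_test_tendsto[OF z test_function_mi_deriv[OF \<phi>]])
  moreover have "(\<lambda>J. ?A (S mi_zero J)) \<longlonglongrightarrow> (\<phi> 0 * gmass TYPE(real ^ 'n) - (LINT x|lborel. \<phi> x * gau x)) *\<^sub>R w"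
    unfolding adjoint_S[OF \<phi>]
  proof (intro tendsto_intros bell_test_tendsto[OF test_function_measurable[OF \<phi>] C])
    show "isCont \<phi> 0" using test_function_continuous[OF \<phi>] by (simp add: continuous_on_eq_continuous_at)
  qed
  ultimately have "?A (U mi_zero) = (\<phi> 0 * gmass TYPE(real ^ 'n) - (LINT x|lborel. \<phi> x * gau x)) *\<^sub>R w"
    by (rule LIMSEQ_unique)
  then show "vector_integral (\<lambda>E. (measure dirac_measure E - measure (bell_measure 0) E) *\<^sub>R w) \<phi> = ?A (U mi_zero)"
    unfolding vector_integral_scaled[OF finite_on_bounded_dirac_measure bell_measure_facts(1) \<phi>]
    by (simp add: integral_bell_measure[OF \<phi>] integral_dirac_measure test_function_measurable[OF \<phi>] mult.commute)
qed

lemma op_variation_S: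
  assumes E: "E \<in> sets borel" "bounded E"
  shows "op_variation B (S mi_zero J) E = ennreal (norm w * (LINT x|lborel. indicator E x * \<bar>bell J x - gau x\<bar>))"
proof -
  let ?f = "\<lambda>x::real ^ 'n. \<bar>bell J x - gau x\<bar>"
  let ?\<nu> = "\<lambda>A :: (real ^ 'n) set. measure (bell_measure J) A - measure (bell_measure 0) A :: real"
  have fi: "integrable lborel ?f"
    by (intro integrable_abs Bochner_Integration.integrable_diff bell_integrable gau_integrable)
  note \<sigma> = emeasure_density_lborel[OF fi abs_ge_zero]
  have mi: "integrable lborel (\<lambda>x. indicator A x * f x :: real)" if "integrable lborel f" "A \<in> sets borel"
    for f :: "real ^ 'n \<Rightarrow> real" and A
    using integrable_mult_indicator[OF _ that(1), of A] that(2) by simp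
  have \<nu>: "?\<nu> A = (LINT x|lborel. indicator A x * (bell J x - gau x))" if A: "A \<in> sets borel" for A
    using mi[OF bell_integrable[of J] A] mi[OF gau_integrable A]
    by (simp add: bell_measure_facts(3)[OF A] right_diff_distrib)
  \<comment> \<open>A Hahn set of the signed density: nonnegative on it, negative off it.\<close>
  let ?P = "{x :: real ^ 'n. gau x \<le> bell J x}"
  have P: "?P \<in> sets borel" by measurable
  have "total_variation (\<lambda>A. ?\<nu> A *\<^sub>R w) E = ennreal (norm w) * emeasure (density lborel (\<lambda>x. ennreal (?f x))) E"
  proof (rule total_variation_scaled[OF _ E(1) P])
    fix A :: "(real ^ 'n) set" assume A: "A \<in> sets borel"
    have "\<bar>LINT x|lborel. indicator A x * (bell J x - gau x)\<bar> \<le> (LINT x|lborel. \<bar>indicator A x * (bell J x - gau x)\<bar>)"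
      using integral_norm_bound[of lborel "\<lambda>x. indicator A x * (bell J x - gau x)"] by simp
    also have "\<dots> = (LINT x|lborel. indicator A x * ?f x)"
      by (simp add: abs_mult)
    finally show "ennreal \<bar>?\<nu> A\<bar> \<le> emeasure (density lborel (\<lambda>x. ennreal (?f x))) A"
      unfolding \<nu>[OF A] \<sigma>[OF A] by (rule ennreal_leI)
  next
    have EP: "E \<inter> ?P \<in> sets borel" "E - ?P \<in> sets borel" using E(1) P by auto
    have nn: "0 \<le> (LINT x|lborel. indicator A x * ?f x)" for A
      by (rule integral_nonneg_AE) simp
    have "(LINT x|lborel. indicator (E \<inter> ?P) x * (bell J x - gau x)) = (LINT x|lborel. indicator (E \<inter> ?P) x * ?f x)"
      by (intro Bochner_Integration.integral_cong) (auto simp: indicator_def)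
    then show "ennreal \<bar>?\<nu> (E \<inter> ?P)\<bar> = emeasure (density lborel (\<lambda>x. ennreal (?f x))) (E \<inter> ?P)"
      unfolding \<nu>[OF EP(1)] \<sigma>[OF EP(1)] using nn by simp
    have "(LINT x|lborel. indicator (E - ?P) x * (bell J x - gau x)) = (LINT x|lborel. - (indicator (E - ?P) x * ?f x))"
      by (intro Bochner_Integration.integral_cong) (auto simp: indicator_def)
    then show "ennreal \<bar>?\<nu> (E - ?P)\<bar> = emeasure (density lborel (\<lambda>x. ennreal (?f x))) (E - ?P)"
      unfolding \<nu>[OF EP(2)] \<sigma>[OF EP(2)] using nn by simp
  qed simp
  then show ?thesis
    unfolding op_variation_eq[OF represents_S E(2)] \<sigma>[OF E(1)]
    by (simp add: ennreal_mult' integral_nonneg_AE)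
qed

lemma op_variation_U:
  assumes E: "E \<in> sets borel" "bounded E"
  shows "op_variation B (U mi_zero) E =
    ennreal (norm w * (gmass TYPE(real ^ 'n) * indicator E 0 + (LINT x|lborel. indicator E x * gau x)))"
proof -
  let ?\<nu> = "\<lambda>A :: (real ^ 'n) set. measure dirac_measure A - measure (bell_measure 0) A :: real"
  let ?\<sigma> = "add_measure dirac_measure (bell_measure 0) :: (real ^ 'n) measure"
  note fob = finite_on_bounded_dirac_measure[where 'a="real ^ 'n"] bell_measure_facts(1)[of 0, where 'a="real ^ 'n"]
  have nn: "0 \<le> (LINT x|lborel. indicator A x * gau (x :: real ^ 'n))" for A
    by (rule integral_nonneg_AE) (auto simp: less_imp_le[OF gau_pos])
  have g: "gmass TYPE(real ^ 'n) \<ge> 0" by (rule less_imp_le[OF gmass_pos])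
  have \<nu>: "?\<nu> A = gmass TYPE(real ^ 'n) * indicator A 0 - (LINT x|lborel. indicator A x * gau x)" if "A \<in> sets borel" for A
    using that by (simp add: measure_dirac_measure bell_measure_facts(3))
  have \<sigma>: "emeasure ?\<sigma> A = ennreal (gmass TYPE(real ^ 'n) * indicator A 0 + (LINT x|lborel. indicator A x * gau x))"
    if "A \<in> sets borel" for A
    using that nn g by (simp add: emeasure_add_measure[OF fob] emeasure_dirac_measure bell_measure_facts(2) ennreal_plus[symmetric] del: ennreal_plus)
  have "total_variation (\<lambda>A. ?\<nu> A *\<^sub>R w) E = ennreal (norm w) * emeasure ?\<sigma> E"
  proof (rule total_variation_scaled[OF sets_add_measure[OF fob] E(1)])
    \<comment> \<open>The point mass and the Gaussian density are mutually singular, so the origin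
      alone is a Hahn set and the two variations add.\<close>
    show "{0} \<in> sets (borel :: (real ^ 'n) measure)" by simp
    fix A :: "(real ^ 'n) set" assume A: "A \<in> sets borel"
    have "0 \<le> gmass TYPE(real ^ 'n) * indicator A 0" using g by simp
    then show "ennreal \<bar>?\<nu> A\<bar> \<le> emeasure ?\<sigma> A"
      unfolding \<nu>[OF A] \<sigma>[OF A] using nn[of A] by (intro ennreal_leI) linarith
  next
    have b: "E \<inter> {0} \<in> sets borel" "E - {0} \<in> sets borel" using E(1) by auto
    have "AE x in lborel. x \<noteq> (0 :: real ^ 'n)" by (rule AE_lborel_singleton)
    then have "AE x in lborel. indicator (E \<inter> {0}) x * gau x = (0 :: real)"
      by eventually_elim simp
    then have "(LINT x|lborel. indicator (E \<inter> {0}) x * gau x) = (LINT x|(lborel :: (real ^ 'n) measure). (0 :: real))"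
      by (rule integral_cong_AE[rotated 2]) (use b in simp_all)
    then show "ennreal \<bar>?\<nu> (E \<inter> {0})\<bar> = emeasure ?\<sigma> (E \<inter> {0})"
      unfolding \<nu>[OF b(1)] \<sigma>[OF b(1)] using g by simp
    show "ennreal \<bar>?\<nu> (E - {0})\<bar> = emeasure ?\<sigma> (E - {0})"
      unfolding \<nu>[OF b(2)] \<sigma>[OF b(2)] using nn by simp
  qed
  then show ?thesis
    unfolding op_variation_eq[OF represents_U E(2)] \<sigma>[OF E(1)] using nn g by (simp add: ennreal_mult')
qed

text \<open>The limit measure has an atom at the origin. A frontier of zero variation therefore
  avoids the origin, and this is what \<open>tendsto_integral_bell_diff\<close> requires.\<close>

lemma conv_strict_S_U:
  assumes w: "w \<noteq> 0"
  shows "conv_strict_loc B (S mi_zero) (U mi_zero)"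
  unfolding conv_strict_loc_def
proof (intro conjI allI impI conv_W1_loc_S_U)
  fix \<Omega> :: "(real ^ 'n) set"
  assume \<Omega>: "open \<Omega>" "bounded \<Omega>" and fr: "op_variation B (U mi_zero) (frontier \<Omega>) = 0"
  have nn: "0 \<le> (LINT x|lborel. indicator A x * gau (x :: real ^ 'n))" for A
    by (rule integral_nonneg_AE) (auto simp: less_imp_le[OF gau_pos])
  have "norm w * (gmass TYPE(real ^ 'n) * indicator (frontier \<Omega>) 0 + (LINT x|lborel. indicator (frontier \<Omega>) x * gau x)) \<le> 0"
  proof -
    have "bounded (frontier \<Omega>)"
      by (rule bounded_subset[OF bounded_closure[OF \<Omega>(2)]]) (auto simp: frontier_def)
    moreover have "frontier \<Omega> \<in> sets borel" by (intro borel_closed frontier_closed)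
    ultimately show ?thesis using fr op_variation_U[of "frontier \<Omega>"] by (simp add: ennreal_eq_0_iff)
  qed
  then have "gmass TYPE(real ^ 'n) * indicator (frontier \<Omega>) 0 + (LINT x|lborel. indicator (frontier \<Omega>) x * gau x) \<le> 0"
    using w by (simp add: mult_le_0_iff)
  then have "gmass TYPE(real ^ 'n) * indicator (frontier \<Omega>) 0 \<le> 0"
    using nn[of "frontier \<Omega>"] by linarith
  then have "0 \<notin> frontier \<Omega>" using gmass_pos[where 'a="real ^ 'n"] by (auto simp: indicator_def)
  then show "(\<lambda>J. op_variation B (S mi_zero J) \<Omega>) \<longlonglongrightarrow> op_variation B (U mi_zero) \<Omega>"
    using \<Omega> by (auto simp: op_variation_S op_variation_U intro!: tendsto_ennrealI tendsto_mult tendsto_integral_bell_diff)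
qed

lemma BV_loc_S: "BV_loc B (S mi_zero J)" and BV_loc_U: "BV_loc B (U mi_zero)"
  unfolding BV_loc_def using conv_W1_loc_S_U represents_S represents_U by (auto simp: conv_W1_loc_def)

text \<open>Dilation by 2^J preserves the supremum while the unit ball comes to represent the ball
  of radius 2^J. Smallness of consecutive differences on a fixed ball is thus smallness of
  \<open>V mi_zero\<close> everywhere.\<close>

lemma V_eq_0_if_conv_Linf:
  assumes c: "conv_Linf (cball 0 1) (S mi_zero) (U mi_zero)"
  shows "V mi_zero y = 0"
proof -
  let ?M = "restrict_space lebesgue (cball (0 :: real ^ 'n) 1)"
  have "norm (V mi_zero y) \<le> 2 * \<epsilon>" if \<epsilon>: "\<epsilon> > 0" for \<epsilon>
  proof -
    have "(\<lambda>J. Linf_norm (cball 0 1) (\<lambda>x. S mi_zero J x - U mi_zero x)) \<longlonglongrightarrow> 0"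
      using c by (simp add: conv_Linf_def)
    then have "\<forall>\<^sub>F J in sequentially. Linf_norm (cball 0 1) (\<lambda>x. S mi_zero J x - U mi_zero x) < ennreal \<epsilon>"
      by (rule order_tendstoD(2)) (use \<epsilon> in simp)
    then obtain J0 where J0: "\<And>J. J \<ge> J0 \<Longrightarrow> Linf_norm (cball 0 1) (\<lambda>x. S mi_zero J x - U mi_zero x) < ennreal \<epsilon>"
      by (auto simp: eventually_sequentially)
    have ae: "AE x in lebesgue. x \<in> cball 0 1 \<longrightarrow> norm (S mi_zero J x - U mi_zero x) \<le> \<epsilon>" if "J \<ge> J0" for J
    proof -
      have "AE x in ?M. ennreal (norm (S mi_zero J x - U mi_zero x)) \<le> Linf_norm (cball 0 1) (\<lambda>x. S mi_zero J x - U mi_zero x)"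
        unfolding Linf_norm_def by (rule esssup_AE)
      then have "AE x in ?M. norm (S mi_zero J x - U mi_zero x) \<le> \<epsilon>"
      proof eventually_elim
        case (elim x)
        then have "ennreal (norm (S mi_zero J x - U mi_zero x)) \<le> ennreal \<epsilon>"
          using J0[OF that] by (meson less_imp_le order_trans)
        then show ?case using \<epsilon> by simp
      qed
      then show ?thesis by (subst (asm) AE_restrict_space_iff) auto
    qed
    \<comment> \<open>J has to be past the threshold for \<open>\<epsilon>\<close> and large enough
      for y / 2^J to lie in the open unit ball.\<close>
    obtain k where k: "norm y < 2 ^ k" using real_arch_pow[of 2 "norm y"] by auto
    define J where "J = max J0 k"
    have J0J: "J \<ge> J0" by (simp add: J_def)
    have "norm y < 2 ^ J"
      by (rule less_le_trans[OF k]) (simp add: J_def power_increasing)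
    then have yJ: "inverse (2 ^ J) *\<^sub>R y \<in> ball 0 1" by (simp add: field_simps)
    have "AE x in lebesgue. x \<in> ball 0 1 \<longrightarrow> norm (V mi_zero (2 ^ J *\<^sub>R x)) \<le> 2 * \<epsilon>"
      using ae[OF J0J] ae[OF le_SucI[OF J0J]]
    proof eventually_elim
      case *: (elim x)
      show ?case
      proof
        assume x: "x \<in> ball 0 1"
        have "V mi_zero (2 ^ J *\<^sub>R x) = (S mi_zero (Suc J) x - U mi_zero x) - (S mi_zero J x - U mi_zero x)"
          by (simp add: S_def)
        then have "norm (V mi_zero (2 ^ J *\<^sub>R x)) \<le> norm (S mi_zero (Suc J) x - U mi_zero x) + norm (S mi_zero J x - U mi_zero x)"
          by (metis norm_triangle_ineq4)
        also have "\<dots> \<le> 2 * \<epsilon>" using * x by (auto simp: J_def)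
        finally show "norm (V mi_zero (2 ^ J *\<^sub>R x)) \<le> 2 * \<epsilon>" .
      qed
    qed
    \<comment> \<open>The bound holds almost everywhere only; continuity of \<open>V mi_zero\<close>
      makes it valid at the chosen point.\<close>
    then have "norm (V mi_zero (2 ^ J *\<^sub>R (inverse (2 ^ J) *\<^sub>R y))) \<le> 2 * \<epsilon>"
      by (intro AE_bound_imp_bound[where f="\<lambda>x. V mi_zero (2 ^ J *\<^sub>R x)", OF _ open_ball _ yJ]
          continuous_on_compose2[OF V_continuous] continuous_intros) auto
    then show ?thesis by simp
  qed
  note le = this
  have "norm (V mi_zero y) \<le> 0"
  proof (rule field_le_epsilon)
    fix e :: real assume "0 < e"
    then show "norm (V mi_zero y) \<le> 0 + e" using le[of "e / 2"] by simp
  qed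
  then show ?thesis by simp
qed

lemma not_conv_Linf:
  assumes w: "w \<noteq> 0"
  shows "\<not> conv_Linf (cball 0 1) (S mi_zero) (U mi_zero)"
proof
  assume "conv_Linf (cball 0 1) (S mi_zero) (U mi_zero)"
  then have S0: "S mi_zero (Suc 0) x = 0" for x using V_eq_0_if_conv_Linf by (simp add: S_def)
  let ?h = "\<lambda>x :: real ^ 'n. bell 1 x - gau x"
  have c: "continuous_on UNIV ?h" by (intro continuous_intros bell_continuous gau_continuous)
  \<comment> \<open>Only \<open>V mi_zero\<close> is known to vanish, not the separately defined
    \<open>V \<beta>\<close>. So the equation B u_1 = (bell 1 - gau) w is used in its tested form,
    which involves \<open>S mi_zero\<close> alone.\<close>
  have "AE x in lebesgue. ?h x = 0"
  proof (rule L1_loc_real_eq_0[OF L1_loc_continuous[OF c]])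
    fix \<phi> :: "real ^ 'n \<Rightarrow> real" assume \<phi>: "test_function \<phi>"
    obtain C where C: "\<And>x. \<bar>\<phi> x\<bar> \<le> C" using test_function_bounded[OF \<phi>] by metis
    note bi = bell_test_integral(1)[OF test_function_measurable[OF \<phi>] C]
    have "(LINT x|lborel. \<phi> x * bell 1 x) - (LINT x|lborel. \<phi> x * gau x) = 0"
      using adjoint_S[OF \<phi>, of 1] w by (simp add: S0)
    then have "(LINT x|lborel. \<phi> x * ?h x) = 0"
      using bi[of 1] bi[of 0] by (simp add: right_diff_distrib)
    moreover have "(LINT x|lebesgue. \<phi> x * ?h x) = (LINT x|lborel. \<phi> x * ?h x)"
      using lborel_test_integrable(2)[OF borel_measurable_continuous_onI[OF c] L1_loc_continuous[OF c] \<phi>] by simp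
    ultimately show "(LINT x|lebesgue. \<phi> x * ?h x) = 0" by simp
  qed
  then have "AE x in lebesgue. x \<in> UNIV \<longrightarrow> norm (?h x) \<le> 0" by simp
  \<comment> \<open>At the origin the two bells differ by the factor 2^n > 1, which contradicts
    their equality.\<close>
  then have "norm (?h 0) \<le> 0" by (rule AE_bound_imp_bound[OF c open_UNIV]) simp
  then have "(2 ^ CARD('n) - 1) * gau (0 :: real ^ 'n) = 0" by (simp add: bell_def left_diff_distrib)
  then have "(2::real) ^ CARD('n) = 1" using gau_pos[of "0 :: real ^ 'n"] by simp
  moreover have "(2::real) ^ CARD('n) > 1" by (rule one_less_power) auto
  ultimately show False by simp
qed

end

theorem lemma3p2:
  fixes B :: "('n::finite, 'v::euclidean_space, 'w::euclidean_space) operator"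
  assumes "elliptic B"
    and "weakly_canceling B"
    and "\<And>(u\<^sub>j :: nat \<Rightarrow> real ^ 'n \<Rightarrow> 'v) (u :: real ^ 'n \<Rightarrow> 'v) (K :: (real ^ 'n) set).
           (\<And>j. BV_loc B (u\<^sub>j j)) \<Longrightarrow> BV_loc B u \<Longrightarrow> conv_strict_loc B u\<^sub>j u \<Longrightarrow>
           compact K \<Longrightarrow> conv_Linf K u\<^sub>j u"
  shows "canceling B"
proof (rule ccontr)
  assume "\<not> canceling B"
  moreover have "0 \<in> common_image B"
    unfolding common_image_def using linear_0[OF linear_symbol] by (auto intro: range_eqI[OF sym])
  ultimately obtain w where w: "w \<in> common_image B" "w \<noteq> 0"
    unfolding canceling_def by blast
  have "\<exists>v. symbol B \<xi> v = w" if \<xi>: "\<xi> \<noteq> 0" for \<xi>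
  proof -
    \<comment> \<open>Membership in the common image speaks of unit vectors only; homogeneity of the
      symbol extends solvability to all nonzero xi.\<close>
    have "inverse (norm \<xi>) *\<^sub>R \<xi> \<in> sphere 0 1" using \<xi> by simp
    then obtain v where "w = symbol B (inverse (norm \<xi>) *\<^sub>R \<xi>) v"
      using w(1) unfolding common_image_def by blast
    then have "w = inverse (norm \<xi>) ^ CARD('n) *\<^sub>R symbol B \<xi> v" by (simp add: symbol_scaleR)
    then have "symbol B \<xi> (inverse (norm \<xi>) ^ CARD('n) *\<^sub>R v) = w"
      by (simp add: linear_scale[OF linear_symbol])
    then show ?thesis by blast
  qed
  then obtain m where m: "\<And>\<xi>. \<xi> \<noteq> 0 \<Longrightarrow> symbol B \<xi> (m \<xi>) = w" by metis
  interpret common_image_vector B w m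
    by unfold_locales (use assms(1) m in auto)
  have "conv_Linf (cball 0 1) (S mi_zero) (U mi_zero)"
    by (rule assms(3)[OF BV_loc_S BV_loc_U conv_strict_S_U[OF w(2)] compact_cball])
  with not_conv_Linf[OF w(2)] show False by contradiction
qed

end
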